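(* There is a universal constant $\mathsf C'>0$ such that the following holds. Let $\pi\in\mathcal P(\mathbb R^d)$ satisfy the standing decomposition assumption with constants $\mathsf M,\mathsf L$. Let $\mathsf P$ be the Random–Walk Metropolis kernel for $\pi$ with step size $h$ satisfying $0<h\le \frac{1}{\sqrt d}\min\{\frac{1}{2\sqrt{\mathsf M}},\frac{1}{16\mathsf L}\}$. Then: (i) if $\pi$ satisfies a log-Sobolev inequality with constant $\mathsf C_{\mathrm{LSI}}>0$, then $\mathrm{Gap}(\mathsf P)\ge \mathsf C'\,\dfrac{h^4}{\mathsf C_{\mathrm{LSI}}^2+h^4}$; (ii) if $\pi$ satisfies a Poincaré inequality with constant $\mathsf C_{\mathrm{PI}}>0$, then $\mathrm{Gap}(\mathsf P)\ge \mathsf C'\,\dfrac{h^4}{\mathsf C_{\mathrm{PI}}^2+h^4}$.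
   Context: Standing decomposition assumption: $\pi$ has a positive density with $\log\pi=f+g$, $f$ differentiable with $\|\nabla f(x)-\nabla f(y)\|\le \mathsf M\|x-y\|$, and $|g(x)-g(y)|\le\mathsf L\|x-y\|$ for all $x,y$. Log-Sobolev inequality with constant $\mathsf C_{\mathrm{LSI}}$: for all locally Lipschitz $u$, $\mathbb E_\pi\big[|u|^2\log\frac{|u|^2}{\mathbb E_\pi|u|^2}\big]\le \mathsf C_{\mathrm{LSI}}\,\mathbb E_\pi\|\nabla u\|^2$. Poincaré inequality with constant $\mathsf C_{\mathrm{PI}}$: for all locally Lipschitz $u$, $\mathbb E_\pi[(u-\mathbb E_\pi u)^2]\le\mathsf C_{\mathrm{PI}}\,\mathbb E_\pi\|\nabla u\|^2$. Metropolis kernel with proposal $\mathsf Q$: $\alpha(x,x')=\min\{1,\frac{\pi(x')\mathsf Q(x',x)}{\pi(x)\mathsf Q(x,x')}\}$, $\mathsf P(x,y)=\alpha(x,y)\mathsf Q(x,y)+(1-\int\alpha(x,x')\mathsf Q(x,x')dx')\delta_x(y)$. RWM with step size $h$: $\mathsf Q(x,\cdot)=\mathcal N(x,h^2I)$. Spectral gap: $\mathrm{Gap}(\mathsf P)=\inf\{1-\mathbb E_\pi[u\,\mathsf Pu]/\mathbb E_\pi[u^2]: 0\ne u\in L^2(\pi),\ \mathbb E_\pi u=0\}$. *)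

theory Defs
  imports "HOL-Probability.Probability"
begin

text \<open>Points of R^d are represented as functions nat => real restricted to the
extensional carrier PiE {..<d} (only coordinates i < d matter).  Lebesgue measure
on R^d is the product of d copies of lborel.\<close>

definition Rd :: "nat \<Rightarrow> (nat \<Rightarrow> real) set" where
  "Rd d = PiE {..<d} (\<lambda>_. UNIV)"

definition lebd :: "nat \<Rightarrow> (nat \<Rightarrow> real) measure" where
  "lebd d = PiM {..<d} (\<lambda>_. lborel)"

definition dnorm :: "nat \<Rightarrow> (nat \<Rightarrow> real) \<Rightarrow> real" where
  "dnorm d x = sqrt (\<Sum>i<d. (x i)\<^sup>2)"

definition ddist :: "nat \<Rightarrow> (nat \<Rightarrow> real) \<Rightarrow> (nat \<Rightarrow> real) \<Rightarrow> real" where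
  "ddist d x y = sqrt (\<Sum>i<d. (x i - y i)\<^sup>2)"

definition has_grad_at :: "nat \<Rightarrow> ((nat \<Rightarrow> real) \<Rightarrow> real) \<Rightarrow> (nat \<Rightarrow> real) \<Rightarrow> (nat \<Rightarrow> real) \<Rightarrow> bool" where
  "has_grad_at d u v x \<longleftrightarrow>
     (\<forall>e>0. \<exists>\<delta>>0. \<forall>y\<in>Rd d. ddist d y x < \<delta> \<longrightarrow>
        \<bar>u y - u x - (\<Sum>i<d. v i * (y i - x i))\<bar> \<le> e * ddist d y x)"

definition locally_lipschitz_d :: "nat \<Rightarrow> ((nat \<Rightarrow> real) \<Rightarrow> real) \<Rightarrow> bool" where
  "locally_lipschitz_d d u \<longleftrightarrow>
     (\<forall>x\<in>Rd d. \<exists>r>0. \<exists>K. \<forall>y\<in>Rd d. \<forall>z\<in>Rd d.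
        ddist d y x < r \<and> ddist d z x < r \<longrightarrow> \<bar>u y - u z\<bar> \<le> K * ddist d y z)"

definition target :: "nat \<Rightarrow> ((nat \<Rightarrow> real) \<Rightarrow> real) \<Rightarrow> (nat \<Rightarrow> real) measure" where
  "target d p = density (lebd d) (\<lambda>x. ennreal (p x))"

definition decomposition_assumption ::
  "nat \<Rightarrow> ((nat \<Rightarrow> real) \<Rightarrow> real) \<Rightarrow> ((nat \<Rightarrow> real) \<Rightarrow> real) \<Rightarrow> ((nat \<Rightarrow> real) \<Rightarrow> real)
   \<Rightarrow> real \<Rightarrow> real \<Rightarrow> bool" where
  "decomposition_assumption d p f g M L \<longleftrightarrow>
     p \<in> borel_measurable (lebd d) \<and> prob_space (target d p) \<and>
     (\<forall>x\<in>Rd d. p x > 0 \<and> ln (p x) = f x + g x) \<and>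
     (\<exists>F. (\<forall>x\<in>Rd d. has_grad_at d f (F x) x) \<and>
          (\<forall>x\<in>Rd d. \<forall>y\<in>Rd d. ddist d (F x) (F y) \<le> M * ddist d x y)) \<and>
     (\<forall>x\<in>Rd d. \<forall>y\<in>Rd d. \<bar>g x - g y\<bar> \<le> L * ddist d x y)"

definition admissible ::
  "nat \<Rightarrow> ((nat \<Rightarrow> real) \<Rightarrow> real) \<Rightarrow> ((nat \<Rightarrow> real) \<Rightarrow> real) \<Rightarrow> ((nat \<Rightarrow> real) \<Rightarrow> (nat \<Rightarrow> real)) \<Rightarrow> bool" where
  "admissible d p u G \<longleftrightarrow>
     locally_lipschitz_d d u \<and>
     (AE x in lebd d. has_grad_at d u (G x) x) \<and>
     integrable (target d p) (\<lambda>x. (u x)\<^sup>2) \<and>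
     integrable (target d p) (\<lambda>x. (dnorm d (G x))\<^sup>2)"

definition LSI :: "nat \<Rightarrow> ((nat \<Rightarrow> real) \<Rightarrow> real) \<Rightarrow> real \<Rightarrow> bool" where
  "LSI d p C \<longleftrightarrow>
     (\<forall>u G. admissible d p u G \<longrightarrow>
        (let m = (\<integral>y. (u y)\<^sup>2 \<partial>target d p);
             ent = (\<lambda>x. (u x)\<^sup>2 * ln ((u x)\<^sup>2 / m))
         in integrable (target d p) ent \<and>
            (\<integral>x. ent x \<partial>target d p) \<le> C * (\<integral>x. (dnorm d (G x))\<^sup>2 \<partial>target d p)))"

definition PI :: "nat \<Rightarrow> ((nat \<Rightarrow> real) \<Rightarrow> real) \<Rightarrow> real \<Rightarrow> bool" where
  "PI d p C \<longleftrightarrow>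
     (\<forall>u G. admissible d p u G \<longrightarrow>
        (\<integral>x. (u x - (\<integral>y. u y \<partial>target d p))\<^sup>2 \<partial>target d p)
          \<le> C * (\<integral>x. (dnorm d (G x))\<^sup>2 \<partial>target d p))"

definition accept ::
  "((nat \<Rightarrow> real) \<Rightarrow> real) \<Rightarrow> ((nat \<Rightarrow> real) \<Rightarrow> (nat \<Rightarrow> real) \<Rightarrow> real) \<Rightarrow> (nat \<Rightarrow> real) \<Rightarrow> (nat \<Rightarrow> real) \<Rightarrow> real" where
  "accept p Q x x' = min 1 ((p x' * Q x' x) / (p x * Q x x'))"

definition metropolis_op ::
  "nat \<Rightarrow> ((nat \<Rightarrow> real) \<Rightarrow> real) \<Rightarrow> ((nat \<Rightarrow> real) \<Rightarrow> (nat \<Rightarrow> real) \<Rightarrow> real)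
   \<Rightarrow> ((nat \<Rightarrow> real) \<Rightarrow> real) \<Rightarrow> (nat \<Rightarrow> real) \<Rightarrow> real" where
  "metropolis_op d p Q u x =
     (\<integral>y. accept p Q x y * Q x y * u y \<partial>lebd d)
     + (1 - (\<integral>x'. accept p Q x x' * Q x x' \<partial>lebd d)) * u x"

definition gauss_prop :: "nat \<Rightarrow> real \<Rightarrow> (nat \<Rightarrow> real) \<Rightarrow> (nat \<Rightarrow> real) \<Rightarrow> real" where
  "gauss_prop d h x y = (2 * pi * h\<^sup>2) powr (- real d / 2) * exp (- (ddist d y x)\<^sup>2 / (2 * h\<^sup>2))"

definition spectral_gap ::
  "nat \<Rightarrow> ((nat \<Rightarrow> real) \<Rightarrow> real) \<Rightarrow> ((nat \<Rightarrow> real) \<Rightarrow> (nat \<Rightarrow> real) \<Rightarrow> real) \<Rightarrow> real" where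
  "spectral_gap d p Q = Inf
     {1 - (\<integral>x. u x * metropolis_op d p Q u x \<partial>target d p) / (\<integral>x. (u x)\<^sup>2 \<partial>target d p) | u.
        u \<in> borel_measurable (lebd d) \<and> integrable (target d p) (\<lambda>x. (u x)\<^sup>2) \<and>
        (\<integral>x. (u x)\<^sup>2 \<partial>target d p) \<noteq> 0 \<and> (\<integral>x. u x \<partial>target d p) = 0}"

definition rwm_gap :: "nat \<Rightarrow> ((nat \<Rightarrow> real) \<Rightarrow> real) \<Rightarrow> real \<Rightarrow> real" where
  "rwm_gap d p h = spectral_gap d p (gauss_prop d h)"

end

theory Submission
  imports Defs
begin

text \<open>The gap is bounded below by comparing the variance of \<open>u\<close> with its Dirichlet form directly,
  without conductance. Moves \<open>x \<rightarrow> y\<close> with \<open>\<nabla>f x \<bullet> (y - x) > -1\<close> are accepted with probability bounded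
  below, up to a factor absorbed by shrinking the Gaussian slightly. Let \<open>k(x, y)\<close> be the shrunken
  Gaussian density times the square of a Lipschitz cut-off to this half-space, varying over the width
  \<open>1 + \<sigma> |\<nabla>f x|\<close>. Then \<open>k\<close> has mass bounded below, and because \<open>\<nabla>f\<close> is Lipschitz, \<open>x \<mapsto> sqrt (k(x, \<cdot>))\<close>
  is Lipschitz in \<open>L\<^sup>2\<close> with a dimension-free constant of order \<open>1 / h\<close>. Hence the local average \<open>v\<close> of \<open>u\<close>
  under \<open>k\<close> satisfies \<open>|\<nabla>v|\<^sup>2 \<le> const / h\<^sup>2\<close> times the local variance of \<open>u\<close>, so \<open>E |u - v|\<^sup>2\<close> and
  \<open>h\<^sup>2 E |\<nabla>v|\<^sup>2\<close> are both bounded by the Dirichlet form of \<open>u\<close>. The Poincare inequality for \<open>v\<close>, mollified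
  by a narrow Gaussian to make it differentiable, gives a gap of order \<open>h\<^sup>2 / (C + h\<^sup>2)\<close>, which is stronger than
  \<open>h\<^sup>4 / (C\<^sup>2 + h\<^sup>4)\<close>. The log-Sobolev case reduces to the Poincare case for bounded functions.\<close>

section \<open>Euclidean geometry and Gaussian moments on the product space\<close>

text \<open>The gradient of \<open>f\<close> has a Lipschitz constant but no size bound: where it is
  long, about half of all proposals go steeply downhill and are rejected. On the half-space,
  \<open>p\<close> drops by at most a constant factor, apart from terms controlled by
  \<open>M\<close> and \<open>L\<close>. A sharp half-space would turn too abruptly with
  \<open>x\<close>; dividing its affine function by 1 + \<sigma> |F x| makes the cut-off change by
  O(|x' - x| / \<sigma>) once M \<sigma>^2 \<le> 1/4. Square roots of densities are used because b^2
  - a^2 = (b - a)(b + a): Cauchy-Schwarz bounds an increment of the local average by a Hellinger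
  distance times a local variance, free of the dimension and of sup |u|. The bound K on |u| enters
  only error terms that vanish with the difference step or the mollification width, so truncation
  can be removed at the end. The rate constant is 2239488 = 8 * 54 * 36 * 144: 54 = 2 * 27 from
  kernel domination, 36 from the gradient bound, 144 from the kernel mass 1/12, and three factors 2
  from \<sigma>^2 \<ge> h^2 / 2, from the energy being twice the Dirichlet form, and from the
  passage to fourth powers.\<close>

definition dotd :: "nat \<Rightarrow> (nat \<Rightarrow> real) \<Rightarrow> (nat \<Rightarrow> real) \<Rightarrow> real" where
  "dotd d a b = (\<Sum>i<d. a i * b i)"

lemma dnorm_L2_set: "dnorm d x = L2_set x {..<d}"
  by (simp add: dnorm_def L2_set_def)

lemma ddist_eq_dnorm: "ddist d x y = dnorm d (\<lambda>i. x i - y i)"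
  by (simp add: dnorm_def ddist_def)

lemma dnorm_nonneg [simp]: "0 \<le> dnorm d x"
  by (simp add: dnorm_def sum_nonneg)

lemma ddist_nonneg [simp]: "0 \<le> ddist d x y"
  by (simp add: ddist_eq_dnorm)

lemma dnorm_sq: "(dnorm d x)\<^sup>2 = (\<Sum>i<d. (x i)\<^sup>2)"
  by (simp add: dnorm_def sum_nonneg)

lemma ddist_sq: "(ddist d x y)\<^sup>2 = (\<Sum>i<d. (x i - y i)\<^sup>2)"
  by (simp add: ddist_def sum_nonneg)

lemma ddist_commute: "ddist d x y = ddist d y x"
  by (simp add: ddist_def power2_commute)

lemma ddist_self [simp]: "ddist d x x = 0"
  by (simp add: ddist_def)

lemma dotd_self: "dotd d a a = (dnorm d a)\<^sup>2"
  unfolding dnorm_sq dotd_def by (simp add: power2_eq_square)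

lemma dotd_le: "\<bar>dotd d a b\<bar> \<le> dnorm d a * dnorm d b"
proof -
  have "\<bar>dotd d a b\<bar> \<le> (\<Sum>i<d. \<bar>a i\<bar> * \<bar>b i\<bar>)"
    unfolding dotd_def by (rule order_trans[OF sum_abs]) (simp add: abs_mult)
  also have "\<dots> \<le> dnorm d a * dnorm d b"
    unfolding dnorm_L2_set by (rule L2_set_mult_ineq)
  finally show ?thesis .
qed

lemma dotd_add_right: "dotd d a (\<lambda>i. b i + c i) = dotd d a b + dotd d a c"
  by (simp add: dotd_def sum.distrib algebra_simps)

lemma dotd_diff_left: "dotd d (\<lambda>i. b i - c i) a = dotd d b a - dotd d c a"
  by (simp add: dotd_def sum_subtractf algebra_simps)

lemma dotd_scale_right: "dotd d a (\<lambda>i. c * b i) = c * dotd d a b"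
  by (simp add: dotd_def sum_distrib_left algebra_simps)

lemma dotd_scale_left: "dotd d (\<lambda>i. c * a i) b = c * dotd d a b"
  by (simp add: dotd_def sum_distrib_left algebra_simps)

lemma dnorm_scale: "dnorm d (\<lambda>i. c * a i) = \<bar>c\<bar> * dnorm d a"
  by (simp add: dnorm_def power_mult_distrib sum_distrib_left[symmetric] real_sqrt_mult)

lemma dnorm_triangle: "dnorm d (\<lambda>i. a i + b i) \<le> dnorm d a + dnorm d b"
  unfolding dnorm_L2_set by (rule L2_set_triangle_ineq)

lemma ddist_triangle: "ddist d x z \<le> ddist d x y + ddist d y z"
  using dnorm_triangle[of d "\<lambda>i. x i - y i" "\<lambda>i. y i - z i"] by (simp add: ddist_eq_dnorm)

lemma dnorm_triangle_diff: "\<bar>dnorm d a - dnorm d b\<bar> \<le> ddist d a b"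
  using ddist_triangle[of d a "\<lambda>_. 0" b] ddist_triangle[of d b "\<lambda>_. 0" a]
  by (simp add: ddist_eq_dnorm ddist_commute[of d b a, unfolded ddist_eq_dnorm])

lemma coord_le_ddist: "i < d \<Longrightarrow> \<bar>x i - y i\<bar> \<le> ddist d x y"
  using member_le_L2_set[of "{..<d}" i "\<lambda>i. \<bar>x i - y i\<bar>"]
  by (simp add: ddist_def L2_set_def)

lemma coord_le_dnorm: "i < d \<Longrightarrow> \<bar>x i\<bar> \<le> dnorm d x"
  using coord_le_ddist[of i d x "\<lambda>_. 0"] by (simp add: ddist_eq_dnorm)

section \<open>Lebesgue measure on \<open>Rd d\<close> and measurability\<close>

interpretation lborel_prod: product_sigma_finite "\<lambda>_::nat. lborel :: real measure" ..

lemma space_lebd [simp]: "space (lebd d) = Rd d"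
  by (simp add: lebd_def space_PiM Rd_def)

lemma sigma_finite_lebd: "sigma_finite_measure (lebd d)"
  unfolding lebd_def by (rule lborel_prod.sigma_finite) simp

interpretation lebd: sigma_finite_measure "lebd d" for d
  by (rule sigma_finite_lebd)

interpretation lebd_pair: pair_sigma_finite "lebd d" "lebd d" for d ..

lemma measurable_coord [measurable (raw)]: "i < d \<Longrightarrow> (\<lambda>x. x i) \<in> borel_measurable (lebd d)"
  unfolding lebd_def by measurable

lemma measurable_coord_comp [measurable_dest]:
  "X \<in> measurable N (lebd d) \<Longrightarrow> i < d \<Longrightarrow> (\<lambda>w. X w i) \<in> borel_measurable N"
  using measurable_compose[OF _ measurable_coord] by blast

lemma measurable_ddist [measurable (raw)]:
  assumes [measurable]: "X \<in> measurable N (lebd d)" "Y \<in> measurable N (lebd d)"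
  shows "(\<lambda>w. ddist d (X w) (Y w)) \<in> borel_measurable N"
proof -
  have [measurable]: "\<And>i. i \<in> {..<d} \<Longrightarrow> (\<lambda>w. X w i) \<in> borel_measurable N"
    "\<And>i. i \<in> {..<d} \<Longrightarrow> (\<lambda>w. Y w i) \<in> borel_measurable N"
    by auto
  show ?thesis
    unfolding ddist_def by measurable
qed

lemma measurable_gauss_prop [measurable (raw)]:
  assumes [measurable]: "X \<in> measurable N (lebd d)" "Y \<in> measurable N (lebd d)"
  shows "(\<lambda>w. gauss_prop d h (X w) (Y w)) \<in> borel_measurable N"
  unfolding gauss_prop_def by measurable

lemma measurable_dotd [measurable (raw)]:
  assumes "\<And>i. i < d \<Longrightarrow> (\<lambda>w. X w i) \<in> borel_measurable N" "\<And>i. i < d \<Longrightarrow> (\<lambda>w. Y w i) \<in> borel_measurable N"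
  shows "(\<lambda>w. dotd d (X w) (Y w)) \<in> borel_measurable N"
  unfolding dotd_def using assms by (intro borel_measurable_sum borel_measurable_times) auto

text \<open>The bound constrains \<open>w\<close> only on \<open>Rd d\<close>, so \<open>w\<close>
  is precomposed with \<open>restrict\<close>; the result is continuous for the product topology on
  all of \<open>nat \<Rightarrow> real\<close>, whose Borel sets form the product sigma-algebra.
  This later gives measurability of averages over a kernel that is known to be measurable in its
  second argument.\<close>

lemma Lipschitz_measurable:
  assumes lip: "\<And>x y. x \<in> Rd d \<Longrightarrow> y \<in> Rd d \<Longrightarrow> \<bar>w x - w y\<bar> \<le> K * ddist d x y"
  shows "w \<in> borel_measurable (lebd d)"
proof -
  define w' where "w' z = w (restrict z {..<d})" for z
  have "isCont w' z0" for z0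
  proof -
    have coord: "((\<lambda>z. z i) \<longlongrightarrow> z0 i) (at z0)" for i :: nat
    proof -
      have "continuous_on UNIV (\<lambda>z :: nat \<Rightarrow> real. z i)" by simp
      then show ?thesis by (simp add: continuous_on_def)
    qed
    have "((\<lambda>z. ddist d z z0) \<longlongrightarrow> ddist d z0 z0) (at z0)"
      unfolding ddist_def by (intro tendsto_intros coord)
    then have "((\<lambda>z. K * ddist d z z0) \<longlongrightarrow> K * 0) (at z0)"
      by (intro tendsto_intros) simp
    moreover have "\<bar>w' z - w' z0\<bar> \<le> K * ddist d z z0" for z
      using lip[of "restrict z {..<d}" "restrict z0 {..<d}"] by (simp add: w'_def Rd_def ddist_def)
    ultimately have "((\<lambda>z. w' z - w' z0) \<longlongrightarrow> 0) (at z0)"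
      by (intro Lim_null_comparison[of "\<lambda>z. w' z - w' z0" "\<lambda>z. K * ddist d z z0"])
         (simp_all add: always_eventually)
    then show ?thesis
      using LIM_zero_iff isCont_def by blast
  qed
  then have "w' \<in> borel_measurable borel"
    by (intro borel_measurable_continuous_onI continuous_at_imp_continuous_on) auto
  moreover have "(\<lambda>x. x) \<in> measurable (lebd d) (PiM UNIV (\<lambda>_. borel))"
  proof (rule measurable_PiM_single')
    fix i :: nat
    show "(\<lambda>x. x i) \<in> borel_measurable (lebd d)"
    proof (cases "i < d")
      \<comment> \<open>Points of \<open>Rd d\<close> are extensional: every coordinate from
        \<open>d\<close> on is the constant \<open>undefined\<close>.\<close>
      case False
      then have "\<And>x. x \<in> space (lebd d) \<Longrightarrow> x i = undefined"
        by (auto simp: Rd_def PiE_def extensional_def)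
      then show ?thesis
        using measurable_cong[of "lebd d" "\<lambda>x. x i" "\<lambda>_. undefined" borel] by simp
    qed simp
  qed auto
  ultimately have w'_meas: "w' \<in> borel_measurable (lebd d)"
    using measurable_cong_sets[OF sets_PiM_equal_borel refl, of "borel :: real measure"]
      measurable_compose[of "\<lambda>x. x"] by blast
  moreover have "w' x = w x" if "x \<in> Rd d" for x
    using that by (simp add: w'_def Rd_def restrict_PiE_iff[symmetric] PiE_restrict)
  ultimately show ?thesis
    using measurable_cong[of "lebd d" w w' borel] by simp
qed

section \<open>The Gaussian density as a product, and its first two moments\<close>

lemma gauss_prop_pos: "0 < h \<Longrightarrow> 0 < gauss_prop d h x y"
  by (simp add: gauss_prop_def)

lemma gauss_prop_nonneg [simp]: "0 \<le> gauss_prop d h x y"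
  by (simp add: gauss_prop_def)

lemma gauss_prop_commute: "gauss_prop d h x y = gauss_prop d h y x"
  by (simp add: gauss_prop_def ddist_commute)

lemma gauss_prop_eq_prod:
  assumes "0 < h"
  shows "gauss_prop d h x y = (\<Prod>i<d. normal_density (x i) h (y i))"
proof -
  have "(\<Prod>i<d. normal_density (x i) h (y i))
      = (1 / sqrt (2 * pi * h\<^sup>2)) ^ d * exp (\<Sum>i<d. - (y i - x i)\<^sup>2 / (2 * h\<^sup>2))"
    unfolding normal_density_def prod.distrib by (simp add: exp_sum)
  also have "(1 / sqrt (2 * pi * h\<^sup>2)) ^ d = (2 * pi * h\<^sup>2) powr (- real d / 2)"
  proof -
    have "1 / sqrt (2 * pi * h\<^sup>2) = (2 * pi * h\<^sup>2) powr (- 1 / 2)"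
      using assms by (simp add: powr_minus_divide powr_half_sqrt[symmetric])
    then show ?thesis
      using assms by (simp add: powr_power)
  qed
  also have "(\<Sum>i<d. - (y i - x i)\<^sup>2 / (2 * h\<^sup>2)) = - (ddist d y x)\<^sup>2 / (2 * h\<^sup>2)"
    by (simp add: ddist_sq sum_divide_distrib sum_negf)
  finally show ?thesis
    by (simp add: gauss_prop_def)
qed

text \<open>Fubini for products of one-variable factors: all moments below are read off from
  one-dimensional normal moments.\<close>

lemma gauss_prod_moment:
  assumes h: "0 < h"
    and int: "\<And>i. i < d \<Longrightarrow> has_bochner_integral lborel (\<lambda>y. normal_density (x i) h y * a i y) (m i)"
  shows "has_bochner_integral (lebd d) (\<lambda>y. gauss_prop d h x y * (\<Prod>i<d. a i (y i))) (\<Prod>i<d. m i)"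
proof -
  have 1: "(\<lambda>y. gauss_prop d h x y * (\<Prod>i<d. a i (y i)))
      = (\<lambda>y. \<Prod>i<d. (\<lambda>y. normal_density (x i) h y * a i y) (y i))"
    by (simp add: gauss_prop_eq_prod[OF h] prod.distrib)
  have 2: "\<And>i. i \<in> {..<d} \<Longrightarrow> integrable lborel (\<lambda>y. normal_density (x i) h y * a i y)"
    using int by (auto simp: has_bochner_integral_iff)
  show ?thesis
    unfolding 1 lebd_def has_bochner_integral_iff
  proof (intro conjI)
    show "integrable (Pi\<^sub>M {..<d} (\<lambda>_. lborel)) (\<lambda>y. \<Prod>i<d. normal_density (x i) h (y i) * a i (y i))"
      using lborel_prod.product_integrable_prod[of "{..<d}", OF _ 2] by simp
    show "(\<integral>y. (\<Prod>i<d. normal_density (x i) h (y i) * a i (y i)) \<partial>Pi\<^sub>M {..<d} (\<lambda>_. lborel)) = prod m {..<d}"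
      using lborel_prod.product_integral_prod[of "{..<d}", OF _ 2] int
      by (simp add: has_bochner_integral_iff)
  qed
qed

lemma has_gauss_total: "0 < h \<Longrightarrow> has_bochner_integral (lebd d) (\<lambda>y. gauss_prop d h x y) 1"
  using gauss_prod_moment[of h d x "\<lambda>_ _. 1" "\<lambda>_. 1"] by (simp add: has_bochner_integral_iff)

lemma has_gauss_cov:
  assumes h: "0 < h" and ij: "i < d" "j < d"
  shows "has_bochner_integral (lebd d) (\<lambda>y. gauss_prop d h x y * ((y i - x i) * (y j - x j)))
           (if i = j then h\<^sup>2 else 0)"
proof -
  \<comment> \<open>Each index contributes one factor at its own coordinate: for
    \<open>i = j\<close> the single factor is a square, otherwise two mean-zero factors
    appear.\<close>
  define a where "a k = (\<lambda>y. (if k = i then y - x k else 1) * (if k = j then y - x k else 1))" for k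
  define m where "m k = (if k = i \<and> k = j then h\<^sup>2 else if k = i \<or> k = j then 0 else 1)" for k
  have 1: "has_bochner_integral lborel (\<lambda>y. normal_density (x k) h y * a k y) (m k)" for k
    using normal_moment_even[OF h, of "x k" 1] normal_moment_odd[OF h, of "x k" 0]
      normal_moment_even[OF h, of "x k" 0]
    by (auto simp: a_def m_def power2_eq_square)
  have "(\<Prod>k<d. a k (y k)) = (y i - x i) * (y j - x j)" for y
    using ij by (simp add: a_def prod.distrib prod.delta)
  moreover have "(\<Prod>k<d. m k) = (if i = j then h\<^sup>2 else 0)"
  proof (cases "i = j")
    case True
    then have "m k = (if k = i then h\<^sup>2 else 1)" for k by (simp add: m_def)
    with True ij show ?thesis by simp
  next
    case False
    with ij show ?thesis by (auto simp: m_def intro!: prod_zero)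
  qed
  ultimately show ?thesis
    using gauss_prod_moment[OF h, of d x a m] 1 by simp
qed

lemma has_gauss_mean:
  assumes h: "0 < h" and i: "i < d"
  shows "has_bochner_integral (lebd d) (\<lambda>y. gauss_prop d h x y * (y i - x i)) 0"
proof -
  have "has_bochner_integral lborel (\<lambda>y. normal_density (x k) h y * (if k = i then y - x k else 1))
     (if k = i then 0 else 1)" for k
    using normal_moment_odd[OF h, of "x k" 0] normal_moment_even[OF h, of "x k" 0] by auto
  from gauss_prod_moment[OF h, of d x "\<lambda>k y. if k = i then y - x k else 1", OF this]
  show ?thesis using i by (simp add: prod.delta)
qed

lemma has_gauss_dotd:
  assumes h: "0 < h"
  shows "has_bochner_integral (lebd d) (\<lambda>y. gauss_prop d h x y * dotd d t (\<lambda>i. y i - x i)) 0"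
proof -
  have "has_bochner_integral (lebd d) (\<lambda>y. \<Sum>i<d. t i * (gauss_prop d h x y * (y i - x i))) (\<Sum>i<d. t i * 0)"
    using has_gauss_mean[OF h] by (intro has_bochner_integral_sum has_bochner_integral_mult_right) auto
  then show ?thesis
    by (simp add: dotd_def sum_distrib_left mult_ac)
qed

lemma has_gauss_dotd_sq:
  assumes h: "0 < h"
  shows "has_bochner_integral (lebd d) (\<lambda>y. gauss_prop d h x y * (dotd d t (\<lambda>i. y i - x i))\<^sup>2)
    (h\<^sup>2 * (dnorm d t)\<^sup>2)"
proof -
  have "has_bochner_integral (lebd d)
     (\<lambda>y. \<Sum>i<d. \<Sum>j<d. (t i * t j) * (gauss_prop d h x y * ((y i - x i) * (y j - x j))))
     (\<Sum>i<d. \<Sum>j<d. (t i * t j) * (if i = j then h\<^sup>2 else 0))"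
    using has_gauss_cov[OF h] by (intro has_bochner_integral_sum has_bochner_integral_mult_right) auto
  moreover have "(\<Sum>i<d. \<Sum>j<d. (t i * t j) * (gauss_prop d h x y * ((y i - x i) * (y j - x j))))
      = gauss_prop d h x y * (dotd d t (\<lambda>i. y i - x i))\<^sup>2" for y
    by (simp add: dotd_def power2_eq_square sum_product sum_distrib_left mult_ac)
  moreover have "(\<Sum>i<d. \<Sum>j<d. (t i * t j) * (if i = j then h\<^sup>2 else 0)) = h\<^sup>2 * (dnorm d t)\<^sup>2"
    unfolding dnorm_sq sum_distrib_left
    by (simp add: if_distrib power2_eq_square mult_ac cong: if_cong)
  ultimately show ?thesis by simp
qed

lemma has_gauss_ddist_sq:
  assumes h: "0 < h"
  shows "has_bochner_integral (lebd d) (\<lambda>y. gauss_prop d h x y * (ddist d y x)\<^sup>2) (h\<^sup>2 * real d)"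
proof -
  have "has_bochner_integral (lebd d)
     (\<lambda>y. \<Sum>i<d. (gauss_prop d h x y * ((y i - x i) * (y i - x i)))) (\<Sum>i<d. h\<^sup>2)"
    using has_gauss_cov[OF h, of i d i x for i] by (intro has_bochner_integral_sum) simp
  then show ?thesis
    unfolding ddist_sq sum_distrib_left by (simp add: power2_eq_square mult_ac)
qed

section \<open>Gaussian convolution\<close>

text \<open>It suffices to check boxes, where this is translation invariance of each
  \<open>lborel\<close>. The \<open>restrict\<close> in the map keeps images extensional.\<close>

lemma distr_lebd_translate:
  "distr (lebd d) (lebd d) (\<lambda>y. \<lambda>i\<in>{..<d}. y i + t i) = lebd d"
  unfolding lebd_def
proof (rule lborel_prod.PiM_eqI)
  fix A :: "nat \<Rightarrow> real set"
  assume "\<And>i. i \<in> {..<d} \<Longrightarrow> A i \<in> sets lborel"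
  then have A: "\<And>i. i \<in> {..<d} \<Longrightarrow> A i \<in> sets borel" by simp
  define T where "T y = (\<lambda>i\<in>{..<d}. y i + t i)" for y :: "nat \<Rightarrow> real"
  have T: "T \<in> measurable (Pi\<^sub>M {..<d} (\<lambda>_. lborel)) (Pi\<^sub>M {..<d} (\<lambda>_. lborel))"
    unfolding T_def by measurable
  have pre: "(\<lambda>y. y + t i) -` A i \<in> sets borel" if "i < d" for i
    using measurable_sets[of "\<lambda>y. y + t i" borel borel "A i"] A that by simp
  have em: "emeasure lborel ((\<lambda>y. y + t i) -` A i) = emeasure lborel (A i)" if "i < d" for i
  proof -
    have "emeasure lborel (A i) = emeasure (distr lborel borel ((+) (t i))) (A i)"
      by (simp add: lborel_distr_plus)
    also have "\<dots> = emeasure lborel ((+) (t i) -` A i \<inter> space lborel)"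
      using A that by (intro emeasure_distr) auto
    also have "(+) (t i) = (\<lambda>y. y + t i)" by (simp add: fun_eq_iff add.commute)
    finally show ?thesis by simp
  qed
  have vim: "T -` (Pi\<^sub>E {..<d} A) \<inter> space (Pi\<^sub>M {..<d} (\<lambda>_. lborel))
      = Pi\<^sub>E {..<d} (\<lambda>i. (\<lambda>y. y + t i) -` A i)"
    by (auto simp: T_def space_PiM PiE_iff)
  have "emeasure (distr (Pi\<^sub>M {..<d} (\<lambda>_. lborel)) (Pi\<^sub>M {..<d} (\<lambda>_. lborel)) T) (Pi\<^sub>E {..<d} A)
      = (\<Prod>i<d. emeasure lborel (A i))"
  proof -
    have "emeasure (distr (Pi\<^sub>M {..<d} (\<lambda>_. lborel)) (Pi\<^sub>M {..<d} (\<lambda>_. lborel)) T) (Pi\<^sub>E {..<d} A)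
        = emeasure (Pi\<^sub>M {..<d} (\<lambda>_. lborel)) (T -` (Pi\<^sub>E {..<d} A) \<inter> space (Pi\<^sub>M {..<d} (\<lambda>_. lborel)))"
      using A by (intro emeasure_distr[OF T] sets_PiM_I_finite) auto
    also have "\<dots> = emeasure (Pi\<^sub>M {..<d} (\<lambda>_. lborel)) (Pi\<^sub>E {..<d} (\<lambda>i. (\<lambda>y. y + t i) -` A i))"
      by (simp only: vim)
    also have "\<dots> = (\<Prod>i<d. emeasure lborel ((\<lambda>y. y + t i) -` A i))"
      using pre by (intro lborel_prod.emeasure_PiM) auto
    finally show ?thesis using em by simp
  qed
  then show "emeasure (distr (Pi\<^sub>M {..<d} (\<lambda>_. lborel)) (Pi\<^sub>M {..<d} (\<lambda>_. lborel)) (\<lambda>y. \<lambda>i\<in>{..<d}. y i + t i)) (Pi\<^sub>E {..<d} A)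
      = (\<Prod>i<d. emeasure lborel (A i))"
    by (simp add: T_def[abs_def])
qed simp_all

lemma measurable_translate [measurable]: "(\<lambda>y. \<lambda>i\<in>{..<d}. y i + t i) \<in> measurable (lebd d) (lebd d)"
  unfolding lebd_def by measurable

lemma integral_translate:
  fixes H :: "(nat \<Rightarrow> real) \<Rightarrow> real"
  assumes "H \<in> borel_measurable (lebd d)"
  shows "(\<integral>y. H (\<lambda>i\<in>{..<d}. y i + t i) \<partial>lebd d) = (\<integral>y. H y \<partial>lebd d)"
  using integral_distr[OF measurable_translate assms, of t] by (simp add: distr_lebd_translate)

section \<open>Cauchy-Schwarz and comparison of shifted Gaussians\<close>

lemma integrable_L2_mult:
  fixes f g :: "'a \<Rightarrow> real"
  assumes [measurable]: "f \<in> borel_measurable M" "g \<in> borel_measurable M"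
    and f: "integrable M (\<lambda>x. (f x)\<^sup>2)" and g: "integrable M (\<lambda>x. (g x)\<^sup>2)"
  shows "integrable M (\<lambda>x. f x * g x)"
proof (rule Bochner_Integration.integrable_bound[OF Bochner_Integration.integrable_add[OF f g]])
  show "AE x in M. norm (f x * g x) \<le> norm ((f x)\<^sup>2 + (g x)\<^sup>2)"
  proof (rule AE_I2)
    fix x
    have "2 * (\<bar>f x\<bar> * \<bar>g x\<bar>) \<le> (f x)\<^sup>2 + (g x)\<^sup>2"
      using sum_squares_bound[of "\<bar>f x\<bar>" "\<bar>g x\<bar>"] by (simp add: mult.assoc)
    moreover have "0 \<le> \<bar>f x\<bar> * \<bar>g x\<bar>" by simp
    ultimately show "norm (f x * g x) \<le> norm ((f x)\<^sup>2 + (g x)\<^sup>2)"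
      by (simp only: real_norm_def abs_mult)
  qed
qed measurable

lemma Cauchy_Schwarz_integral:
  fixes f g :: "'a \<Rightarrow> real"
  assumes [measurable]: "f \<in> borel_measurable M" "g \<in> borel_measurable M"
    and f: "integrable M (\<lambda>x. (f x)\<^sup>2)" and g: "integrable M (\<lambda>x. (g x)\<^sup>2)"
  shows "(\<integral>x. f x * g x \<partial>M)\<^sup>2 \<le> (\<integral>x. (f x)\<^sup>2 \<partial>M) * (\<integral>x. (g x)\<^sup>2 \<partial>M)"
proof -
  define A B C where "A = (\<integral>x. (g x)\<^sup>2 \<partial>M)" and "B = (\<integral>x. f x * g x \<partial>M)" and "C = (\<integral>x. (f x)\<^sup>2 \<partial>M)"
  have fg: "integrable M (\<lambda>x. f x * g x)" using integrable_L2_mult[OF assms] .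
  have quad: "0 \<le> A * s\<^sup>2 - 2 * B * s + C" for s
  proof -
    have "0 \<le> (\<integral>x. (f x - s * g x)\<^sup>2 \<partial>M)" by simp
    also have "(\<lambda>x. (f x - s * g x)\<^sup>2) = (\<lambda>x. (f x)\<^sup>2 - (2 * s) * (f x * g x) + s\<^sup>2 * (g x)\<^sup>2)"
      by (simp add: power2_eq_square algebra_simps)
    also have "(\<integral>x. (f x)\<^sup>2 - (2 * s) * (f x * g x) + s\<^sup>2 * (g x)\<^sup>2 \<partial>M) = C - (2 * s) * B + s\<^sup>2 * A"
      unfolding A_def B_def C_def using f g fg by simp
    finally show ?thesis by (simp add: algebra_simps)
  qed
  have A0: "0 \<le> A" by (simp add: A_def)
  have "B\<^sup>2 \<le> C * A"
  proof (cases "A = 0")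
    case True
    have "B = 0"
    proof (rule ccontr)
      assume "B \<noteq> 0"
      \<comment> \<open>With \<open>A = 0\<close> the quadratic is affine in \<open>s\<close>; at
        this \<open>s\<close> it takes the value -1.\<close>
      with quad[of "(C + 1) / (2 * B)"] True show False by simp
    qed
    with True show ?thesis by simp
  next
    case False
    with A0 have "0 < A" by simp
    with quad[of "B / A"] have "0 \<le> A * (A * (B / A)\<^sup>2 - 2 * B * (B / A) + C)" by simp
    with \<open>0 < A\<close> show ?thesis by (simp add: power2_eq_square field_simps)
  qed
  then show ?thesis by (simp add: A_def B_def C_def)
qed

text \<open>Parallelogram identity around the midpoint of \<open>x\<close> and \<open>x'\<close>.
  The exponential factor is the Hellinger affinity of the two Gaussians.\<close>

lemma gauss_midpoint:
  assumes "0 < h"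
  shows "sqrt (gauss_prop d h x y) * sqrt (gauss_prop d h x' y)
     = gauss_prop d h (\<lambda>i. (x i + x' i) / 2) y * exp (- (ddist d x' x)\<^sup>2 / (8 * h\<^sup>2))"
proof -
  define c where "c = (2 * pi * h\<^sup>2) powr (- real d / 2)"
  have "(ddist d y x)\<^sup>2 + (ddist d y x')\<^sup>2
      = 2 * (ddist d y (\<lambda>i. (x i + x' i) / 2))\<^sup>2 + (ddist d x' x)\<^sup>2 / 2"
    unfolding ddist_sq sum_distrib_left sum_divide_distrib sum.distrib[symmetric]
    by (intro sum.cong refl) (simp add: power2_eq_square field_simps)
  then have A_eq: "(ddist d y x)\<^sup>2 = 2 * (ddist d y (\<lambda>i. (x i + x' i) / 2))\<^sup>2 + (ddist d x' x)\<^sup>2 / 2 - (ddist d y x')\<^sup>2"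
    by simp
  then have exponent: "- (ddist d y x)\<^sup>2 / (2 * h\<^sup>2) + - (ddist d y x')\<^sup>2 / (2 * h\<^sup>2)
      = 2 * (- (ddist d y (\<lambda>i. (x i + x' i) / 2))\<^sup>2 / (2 * h\<^sup>2)) + 2 * (- (ddist d x' x)\<^sup>2 / (8 * h\<^sup>2))"
    unfolding A_eq using assms by (simp add: field_simps)
  have "gauss_prop d h x y * gauss_prop d h x' y
      = (gauss_prop d h (\<lambda>i. (x i + x' i) / 2) y * exp (- (ddist d x' x)\<^sup>2 / (8 * h\<^sup>2)))\<^sup>2"
    using arg_cong[OF exponent, of exp]
    unfolding gauss_prop_def c_def[symmetric] power_mult_distrib power2_eq_square[of c] exp_add exp_double
    by (simp add: mult_ac)
  then show ?thesis
    by (simp add: real_sqrt_mult[symmetric])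
qed

text \<open>Parallelogram identity with \<open>x'\<close> as the midpoint of \<open>x\<close> and
  its mirror image. After division by the density at \<open>x\<close>, the right side is a Gaussian
  times a constant, so the second moment of the likelihood ratio is explicit.\<close>

lemma gauss_reflect:
  assumes "0 < h"
  shows "(gauss_prop d h x' y)\<^sup>2
     = gauss_prop d h x y * (gauss_prop d h (\<lambda>i. 2 * x' i - x i) y * exp ((ddist d x' x)\<^sup>2 / h\<^sup>2))"
proof -
  define c where "c = (2 * pi * h\<^sup>2) powr (- real d / 2)"
  have "2 * (ddist d y x')\<^sup>2 + 2 * (ddist d x' x)\<^sup>2
      = (ddist d y x)\<^sup>2 + (ddist d y (\<lambda>i. 2 * x' i - x i))\<^sup>2"
    unfolding ddist_sq sum_distrib_left sum_divide_distrib sum.distrib[symmetric]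
    by (intro sum.cong refl) (simp add: power2_eq_square algebra_simps)
  then have A_eq: "(ddist d y x)\<^sup>2 = 2 * (ddist d y x')\<^sup>2 + 2 * (ddist d x' x)\<^sup>2 - (ddist d y (\<lambda>i. 2 * x' i - x i))\<^sup>2"
    by simp
  then have exponent: "2 * (- (ddist d y x')\<^sup>2 / (2 * h\<^sup>2))
      = - (ddist d y x)\<^sup>2 / (2 * h\<^sup>2) + - (ddist d y (\<lambda>i. 2 * x' i - x i))\<^sup>2 / (2 * h\<^sup>2) + (ddist d x' x)\<^sup>2 / h\<^sup>2"
    unfolding A_eq using assms by (simp add: field_simps)
  show ?thesis
    using arg_cong[OF exponent, of exp]
    unfolding gauss_prop_def c_def[symmetric] power_mult_distrib power2_eq_square[of c] exp_add exp_double
    by (simp add: mult_ac)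
qed

lemma integrable_gauss_bounded:
  fixes w :: "(nat \<Rightarrow> real) \<Rightarrow> real"
  assumes h: "0 < h" and w[measurable]: "w \<in> borel_measurable (lebd d)" and x: "x \<in> Rd d"
    and K: "\<And>y. y \<in> Rd d \<Longrightarrow> \<bar>w y\<bar> \<le> K"
  shows "integrable (lebd d) (\<lambda>y. gauss_prop d h x y * w y)"
proof (rule Bochner_Integration.integrable_bound[of _ "\<lambda>y. gauss_prop d h x y * K"])
  show "integrable (lebd d) (\<lambda>y. gauss_prop d h x y * K)"
    using has_gauss_total[OF h, of d x] by (simp add: has_bochner_integral_iff)
  have [measurable]: "x \<in> space (lebd d)" using x by simp
  show "(\<lambda>y. gauss_prop d h x y * w y) \<in> borel_measurable (lebd d)"
    by measurable
  show "AE y in lebd d. norm (gauss_prop d h x y * w y) \<le> norm (gauss_prop d h x y * K)"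
    using K by (intro AE_I2) (auto simp: abs_mult intro!: mult_left_mono order_trans[OF K])
qed

lemma gauss_Jensen_sq:
  fixes w :: "(nat \<Rightarrow> real) \<Rightarrow> real"
  assumes h: "0 < h" and w[measurable]: "w \<in> borel_measurable (lebd d)" and x: "x \<in> Rd d"
    and i: "integrable (lebd d) (\<lambda>y. gauss_prop d h x y * (w y)\<^sup>2)"
  shows "integrable (lebd d) (\<lambda>y. gauss_prop d h x y * w y)"
    and "(\<integral>y. gauss_prop d h x y * w y \<partial>lebd d)\<^sup>2 \<le> (\<integral>y. gauss_prop d h x y * (w y)\<^sup>2 \<partial>lebd d)"
proof -
  have [measurable]: "x \<in> space (lebd d)" using x by simp
  have 1: "sqrt (gauss_prop d h x y) * (sqrt (gauss_prop d h x y) * w y) = gauss_prop d h x y * w y" for y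
    by (simp add: mult.assoc[symmetric])
  have 2: "(sqrt (gauss_prop d h x y) * w y)\<^sup>2 = gauss_prop d h x y * (w y)\<^sup>2" for y
    by (simp add: power_mult_distrib)
  have 3: "integrable (lebd d) (\<lambda>y. (sqrt (gauss_prop d h x y))\<^sup>2)"
    "(\<integral>y. (sqrt (gauss_prop d h x y))\<^sup>2 \<partial>lebd d) = 1"
    using has_gauss_total[OF h, of d x] by (auto simp: has_bochner_integral_iff)
  show "integrable (lebd d) (\<lambda>y. gauss_prop d h x y * w y)"
    using integrable_L2_mult[of "\<lambda>y. sqrt (gauss_prop d h x y)" "lebd d" "\<lambda>y. sqrt (gauss_prop d h x y) * w y"] i 3
    unfolding 1 2 by simp
  show "(\<integral>y. gauss_prop d h x y * w y \<partial>lebd d)\<^sup>2 \<le> (\<integral>y. gauss_prop d h x y * (w y)\<^sup>2 \<partial>lebd d)"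
    using Cauchy_Schwarz_integral[of "\<lambda>y. sqrt (gauss_prop d h x y)" "lebd d" "\<lambda>y. sqrt (gauss_prop d h x y) * w y"] i 3
    unfolding 1 2 by simp
qed

text \<open>The cross term of the square integrates to the affinity from
  \<open>gauss_midpoint\<close>, so the integral is 2 - 2 exp (- r^2 / (8 h^2)) with r the distance,
  and 1 - exp (-s) \<le> s. No power of the dimension appears.\<close>

lemma gauss_Hellinger:
  assumes h: "0 < h"
  shows "integrable (lebd d) (\<lambda>y. (sqrt (gauss_prop d h x' y) - sqrt (gauss_prop d h x y))\<^sup>2)"
    and "(\<integral>y. (sqrt (gauss_prop d h x' y) - sqrt (gauss_prop d h x y))\<^sup>2 \<partial>lebd d) \<le> (ddist d x' x)\<^sup>2 / (4 * h\<^sup>2)"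
proof -
  define m where "m = (\<lambda>i. (x i + x' i) / 2)"
  define E where "E = exp (- (ddist d x' x)\<^sup>2 / (8 * h\<^sup>2))"
  have eq: "(\<lambda>y. (sqrt (gauss_prop d h x' y) - sqrt (gauss_prop d h x y))\<^sup>2)
      = (\<lambda>y. gauss_prop d h x' y + gauss_prop d h x y - 2 * (gauss_prop d h m y * E))"
    using gauss_midpoint[OF h, of d x _ x'] by (auto simp: power2_diff m_def E_def mult_ac)
  have "has_bochner_integral (lebd d) (\<lambda>y. gauss_prop d h x' y + gauss_prop d h x y - 2 * (gauss_prop d h m y * E))
     (1 + 1 - 2 * (1 * E))"
    by (intro has_bochner_integral_add has_bochner_integral_diff has_bochner_integral_mult_right
      has_bochner_integral_mult_left has_gauss_total h)
  then show "integrable (lebd d) (\<lambda>y. (sqrt (gauss_prop d h x' y) - sqrt (gauss_prop d h x y))\<^sup>2)"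
    and "(\<integral>y. (sqrt (gauss_prop d h x' y) - sqrt (gauss_prop d h x y))\<^sup>2 \<partial>lebd d) \<le> (ddist d x' x)\<^sup>2 / (4 * h\<^sup>2)"
    unfolding eq has_bochner_integral_iff
    using exp_ge_add_one_self[of "- (ddist d x' x)\<^sup>2 / (8 * h\<^sup>2)"] by (auto simp: E_def)
qed

section \<open>Differentiability of Gaussian mollification\<close>

definition gconv :: "nat \<Rightarrow> real \<Rightarrow> ((nat \<Rightarrow> real) \<Rightarrow> real) \<Rightarrow> (nat \<Rightarrow> real) \<Rightarrow> real" where
  "gconv d e v x = (\<integral>y. gauss_prop d e x y * v y \<partial>lebd d)"

text \<open>The derivative falls on the Gaussian, whose logarithmic gradient in \<open>x\<close> is
  (y - x) / e^2; this makes sense for \<open>v\<close> that is merely bounded and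
  measurable.\<close>

definition ggrad :: "nat \<Rightarrow> real \<Rightarrow> ((nat \<Rightarrow> real) \<Rightarrow> real) \<Rightarrow> (nat \<Rightarrow> real) \<Rightarrow> nat \<Rightarrow> real" where
  "ggrad d e v x i = (\<integral>y. gauss_prop d e x y * ((y i - x i) / e\<^sup>2 * v y) \<partial>lebd d)"

text \<open>The chi-square divergence of \<open>N(x', e\<^sup>2 I)\<close> from \<open>N(x, e\<^sup>2 I)\<close>, after removing the
  linear term of the likelihood ratio.\<close>

lemma gauss_second_order:
  fixes d :: nat and x x' :: "nat \<Rightarrow> real"
  assumes e: "0 < e"
  defines "t \<equiv> \<lambda>i. (x' i - x i) / e\<^sup>2"
  defines "\<tau> \<equiv> (ddist d x' x)\<^sup>2 / e\<^sup>2"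
  shows "has_bochner_integral (lebd d)
    (\<lambda>y. gauss_prop d e x y * (gauss_prop d e x' y / gauss_prop d e x y - 1 - dotd d t (\<lambda>i. y i - x i))\<^sup>2)
    (exp \<tau> - 1 - \<tau>)"
proof -
  define x'' where "x'' = (\<lambda>i. 2 * x' i - x i)"
  let ?g = "\<lambda>y. gauss_prop d e x y" and ?g' = "\<lambda>y. gauss_prop d e x' y" and ?g'' = "\<lambda>y. gauss_prop d e x'' y"
  let ?D = "\<lambda>y. dotd d t (\<lambda>i. y i - x i)" and ?D' = "\<lambda>y. dotd d t (\<lambda>i. y i - x' i)"
  have t: "t = (\<lambda>i. (1 / e\<^sup>2) * (x' i - x i))" by (simp add: t_def)
  have tau: "dotd d t (\<lambda>i. x' i - x i) = \<tau>"
    unfolding t dotd_scale_left dotd_self \<tau>_def by (simp add: ddist_eq_dnorm)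
  have tn: "e\<^sup>2 * (dnorm d t)\<^sup>2 = \<tau>"
    unfolding t dnorm_scale \<tau>_def ddist_eq_dnorm using e by (simp add: power_mult_distrib power_divide power2_eq_square)
  \<comment> \<open>Recentring at \<open>x'\<close> splits \<open>?D\<close> into a part of mean
    zero under \<open>?g'\<close> and its mean \<tau>, so every term of the expanded square has a
    known integral.\<close>
  have D: "?D y = ?D' y + \<tau>" for y
    using dotd_add_right[of d t "\<lambda>i. y i - x' i" "\<lambda>i. x' i - x i"] tau by simp
  have eq: "?g y * (?g' y / ?g y - 1 - ?D y)\<^sup>2
      = ?g'' y * exp \<tau> + ?g y + ?g y * (?D y)\<^sup>2 - 2 * ?g' y - 2 * (?g' y * ?D' y + \<tau> * ?g' y) + 2 * (?g y * ?D y)" for y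
  proof -
    have pos: "0 < ?g y" by (simp add: gauss_prop_pos e)
    have "(?g' y)\<^sup>2 = ?g y * (?g'' y * exp \<tau>)"
      using gauss_reflect[OF e, of d x' y x] by (simp add: x''_def \<tau>_def)
    then have r: "?g'' y * exp \<tau> = (?g' y)\<^sup>2 / ?g y" using pos by simp
    have "?g y * (?g' y / ?g y - 1 - ?D y)\<^sup>2
        = (?g' y)\<^sup>2 / ?g y + ?g y + ?g y * (?D y)\<^sup>2 - 2 * ?g' y - 2 * (?g' y * ?D y) + 2 * (?g y * ?D y)"
      using pos by (simp add: power2_eq_square field_simps)
    then show ?thesis unfolding r D by (simp add: algebra_simps)
  qed
  have "has_bochner_integral (lebd d)
    (\<lambda>y. ?g'' y * exp \<tau> + ?g y + ?g y * (?D y)\<^sup>2 - 2 * ?g' y - 2 * (?g' y * ?D' y + \<tau> * ?g' y) + 2 * (?g y * ?D y))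
    (1 * exp \<tau> + 1 + e\<^sup>2 * (dnorm d t)\<^sup>2 - 2 * 1 - 2 * (0 + \<tau> * 1) + 2 * 0)"
    by (intro has_bochner_integral_add has_bochner_integral_diff has_bochner_integral_mult_right
      has_bochner_integral_mult_left has_gauss_total has_gauss_dotd has_gauss_dotd_sq e)
  then show ?thesis
    unfolding eq tn by simp
qed

text \<open>The remainder is the integral of \<open>v\<close> against the likelihood ratio minus its
  linearisation. Jensen and |v| \<le> K bound it through \<open>gauss_second_order\<close>; for
  small \<tau> the bound is of order \<tau>, hence quadratic in the displacement.\<close>

lemma gconv_expansion:
  fixes d :: nat and x x' :: "nat \<Rightarrow> real" and v :: "(nat \<Rightarrow> real) \<Rightarrow> real"
  assumes e: "0 < e" and [measurable]: "v \<in> borel_measurable (lebd d)"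
    and x: "x \<in> Rd d" and x': "x' \<in> Rd d"
    and K: "\<And>y. y \<in> Rd d \<Longrightarrow> \<bar>v y\<bar> \<le> K"
  defines "\<tau> \<equiv> (ddist d x' x)\<^sup>2 / e\<^sup>2"
  shows "\<bar>gconv d e v x' - gconv d e v x - (\<Sum>i<d. ggrad d e v x i * (x' i - x i))\<bar>
    \<le> K * sqrt (exp \<tau> - 1 - \<tau>)"
proof -
  have [measurable]: "x \<in> space (lebd d)" "x' \<in> space (lebd d)" using x x' by auto
  have K0: "0 \<le> K" using K[OF x] by linarith
  define t where "t = (\<lambda>i. (x' i - x i) / e\<^sup>2)"
  define \<rho> where "\<rho> y = gauss_prop d e x' y / gauss_prop d e x y - 1 - dotd d t (\<lambda>i. y i - x i)" for y
  have mD: "(\<lambda>y. dotd d t (\<lambda>i. y i - x i)) \<in> borel_measurable (lebd d)"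
    by (intro measurable_dotd) measurable
  then have m\<rho>[measurable]: "\<rho> \<in> borel_measurable (lebd d)"
    unfolding \<rho>_def[abs_def] by measurable
  note so = gauss_second_order[OF e, of d x x', folded t_def \<tau>_def, folded \<rho>_def]
  have sq: "(v y)\<^sup>2 \<le> K\<^sup>2" if "y \<in> Rd d" for y
    using K[OF that] by (simp add: abs_le_square_iff[symmetric] K0)
  have i2: "integrable (lebd d) (\<lambda>y. gauss_prop d e x y * (\<rho> y * v y)\<^sup>2)"
  proof (rule Bochner_Integration.integrable_bound[of _ "\<lambda>y. K\<^sup>2 * (gauss_prop d e x y * (\<rho> y)\<^sup>2)"])
    show "integrable (lebd d) (\<lambda>y. K\<^sup>2 * (gauss_prop d e x y * (\<rho> y)\<^sup>2))"
      using so by (simp add: has_bochner_integral_iff)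
    show "AE y in lebd d. norm (gauss_prop d e x y * (\<rho> y * v y)\<^sup>2) \<le> norm (K\<^sup>2 * (gauss_prop d e x y * (\<rho> y)\<^sup>2))"
    proof (rule AE_I2)
      fix y assume "y \<in> space (lebd d)"
      then show "norm (gauss_prop d e x y * (\<rho> y * v y)\<^sup>2) \<le> norm (K\<^sup>2 * (gauss_prop d e x y * (\<rho> y)\<^sup>2))"
        using mult_left_mono[OF sq, of y "gauss_prop d e x y * (\<rho> y)\<^sup>2"]
        by (simp add: power_mult_distrib abs_mult mult_ac)
    qed
  qed measurable
  have x1: "integrable (lebd d) (\<lambda>y. gauss_prop d e x y * (\<rho> y * v y))"
    "(\<integral>y. gauss_prop d e x y * (\<rho> y * v y) \<partial>lebd d)\<^sup>2 \<le> (\<integral>y. gauss_prop d e x y * (\<rho> y * v y)\<^sup>2 \<partial>lebd d)"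
    using gauss_Jensen_sq[OF e _ x i2] by simp_all
  have "(\<integral>y. gauss_prop d e x y * (\<rho> y * v y)\<^sup>2 \<partial>lebd d) \<le> (\<integral>y. K\<^sup>2 * (gauss_prop d e x y * (\<rho> y)\<^sup>2) \<partial>lebd d)"
  proof (rule integral_mono[OF i2])
    show "integrable (lebd d) (\<lambda>y. K\<^sup>2 * (gauss_prop d e x y * (\<rho> y)\<^sup>2))"
      using so by (simp add: has_bochner_integral_iff)
    fix y assume "y \<in> space (lebd d)"
    then show "gauss_prop d e x y * (\<rho> y * v y)\<^sup>2 \<le> K\<^sup>2 * (gauss_prop d e x y * (\<rho> y)\<^sup>2)"
      using mult_left_mono[OF sq, of y "gauss_prop d e x y * (\<rho> y)\<^sup>2"]
      by (simp add: power_mult_distrib mult_ac)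
  qed
  also have "\<dots> = K\<^sup>2 * (exp \<tau> - 1 - \<tau>)"
    using so by (simp add: has_bochner_integral_iff)
  finally have "(\<integral>y. gauss_prop d e x y * (\<rho> y * v y) \<partial>lebd d)\<^sup>2 \<le> K\<^sup>2 * (exp \<tau> - 1 - \<tau>)"
    using x1(2) by linarith
  then have "\<bar>\<integral>y. gauss_prop d e x y * (\<rho> y * v y) \<partial>lebd d\<bar> \<le> sqrt (K\<^sup>2 * (exp \<tau> - 1 - \<tau>))"
    using real_le_rsqrt[of "\<bar>\<integral>y. gauss_prop d e x y * (\<rho> y * v y) \<partial>lebd d\<bar>"] by simp
  then have bound: "\<bar>\<integral>y. gauss_prop d e x y * (\<rho> y * v y) \<partial>lebd d\<bar> \<le> K * sqrt (exp \<tau> - 1 - \<tau>)"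
    using K0 by (simp add: real_sqrt_mult)
  have ig: "integrable (lebd d) (\<lambda>y. gauss_prop d e x y * ((y i - x i) / e\<^sup>2 * v y))" if "i < d" for i
  proof -
    have c: "has_bochner_integral (lebd d) (\<lambda>y. gauss_prop d e x y * (y i - x i)\<^sup>2) (e\<^sup>2)"
      using has_gauss_cov[OF e that that, of x] by (simp add: power2_eq_square)
    have "integrable (lebd d) (\<lambda>y. gauss_prop d e x y * ((y i - x i) / e\<^sup>2 * v y)\<^sup>2)"
    proof (rule Bochner_Integration.integrable_bound[of _ "\<lambda>y. (K\<^sup>2 / e ^ 4) * (gauss_prop d e x y * (y i - x i)\<^sup>2)"])
      show "integrable (lebd d) (\<lambda>y. (K\<^sup>2 / e ^ 4) * (gauss_prop d e x y * (y i - x i)\<^sup>2))"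
        using c by (simp add: has_bochner_integral_iff)
      show "(\<lambda>y. gauss_prop d e x y * ((y i - x i) / e\<^sup>2 * v y)\<^sup>2) \<in> borel_measurable (lebd d)"
        using that by measurable
      show "AE y in lebd d. norm (gauss_prop d e x y * ((y i - x i) / e\<^sup>2 * v y)\<^sup>2)
          \<le> norm ((K\<^sup>2 / e ^ 4) * (gauss_prop d e x y * (y i - x i)\<^sup>2))"
      proof (rule AE_I2)
        fix y assume "y \<in> space (lebd d)"
        then have "gauss_prop d e x y * (y i - x i)\<^sup>2 / e ^ 4 * (v y)\<^sup>2 \<le> gauss_prop d e x y * (y i - x i)\<^sup>2 / e ^ 4 * K\<^sup>2"
          using e by (intro mult_left_mono sq) auto
        then show "norm (gauss_prop d e x y * ((y i - x i) / e\<^sup>2 * v y)\<^sup>2)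
          \<le> norm ((K\<^sup>2 / e ^ 4) * (gauss_prop d e x y * (y i - x i)\<^sup>2))"
          by (simp add: power_mult_distrib power_divide abs_mult power_mult[symmetric] mult_ac)
      qed
    qed
    moreover have "(\<lambda>y. (y i - x i) / e\<^sup>2 * v y) \<in> borel_measurable (lebd d)"
      using that by measurable
    ultimately show ?thesis
      using gauss_Jensen_sq(1)[OF e _ x, of "\<lambda>y. (y i - x i) / e\<^sup>2 * v y"] by simp
  qed
  have pw: "gauss_prop d e x' y * v y - gauss_prop d e x y * v y
      - (\<Sum>i<d. gauss_prop d e x y * ((y i - x i) / e\<^sup>2 * v y) * (x' i - x i)) = gauss_prop d e x y * (\<rho> y * v y)" for y
  proof -
    have "(\<Sum>i<d. gauss_prop d e x y * ((y i - x i) / e\<^sup>2 * v y) * (x' i - x i))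
        = gauss_prop d e x y * v y * dotd d t (\<lambda>i. y i - x i)"
      unfolding dotd_def sum_distrib_left t_def by (intro sum.cong) auto
    then show ?thesis
      using gauss_prop_pos[OF e, of d x y] by (simp add: \<rho>_def field_simps)
  qed
  have iv: "integrable (lebd d) (\<lambda>y. gauss_prop d e z y * v y)" if "z \<in> Rd d" for z
    by (rule integrable_gauss_bounded[OF e _ that K]) auto
  have "has_bochner_integral (lebd d) (\<lambda>y. gauss_prop d e x' y * v y - gauss_prop d e x y * v y
      - (\<Sum>i<d. gauss_prop d e x y * ((y i - x i) / e\<^sup>2 * v y) * (x' i - x i)))
      (gconv d e v x' - gconv d e v x - (\<Sum>i<d. ggrad d e v x i * (x' i - x i)))"
    unfolding gconv_def ggrad_def using iv[OF x] iv[OF x'] ig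
    by (intro has_bochner_integral_diff has_bochner_integral_sum has_bochner_integral_mult_left
        has_bochner_integral_integrable) auto
  then have "gconv d e v x' - gconv d e v x - (\<Sum>i<d. ggrad d e v x i * (x' i - x i))
      = (\<integral>y. gauss_prop d e x y * (\<rho> y * v y) \<partial>lebd d)"
    unfolding pw by (simp add: has_bochner_integral_iff)
  with bound show ?thesis by simp
qed

lemma gconv_has_grad:
  assumes e: "0 < e" and v: "v \<in> borel_measurable (lebd d)"
    and x: "x \<in> Rd d" and K: "\<And>y. y \<in> Rd d \<Longrightarrow> \<bar>v y\<bar> \<le> K"
  shows "has_grad_at d (gconv d e v) (ggrad d e v x) x"
  unfolding has_grad_at_def
proof (intro allI impI)
  fix \<epsilon> :: real assume \<epsilon>: "\<epsilon> > 0"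
  have K0: "0 \<le> K" using K[OF x] by linarith
  \<comment> \<open>The first entry forces \<tau> \<le> 1, the range of \<open>exp_bound\<close>;
    the second absorbs one factor of the distance into \<epsilon>. Using K + 1 avoids division by
    zero when K = 0.\<close>
  define \<delta> where "\<delta> = min e (\<epsilon> * e\<^sup>2 / (K + 1))"
  have "\<delta> > 0" using e \<epsilon> K0 by (simp add: \<delta>_def)
  moreover have "\<bar>gconv d e v y - gconv d e v x - (\<Sum>i<d. ggrad d e v x i * (y i - x i))\<bar> \<le> \<epsilon> * ddist d y x"
    if y: "y \<in> Rd d" and r: "ddist d y x < \<delta>" for y
  proof -
    define r where "r = ddist d y x"
    define \<tau> where "\<tau> = r\<^sup>2 / e\<^sup>2"
    have r0: "0 \<le> r" by (simp add: r_def)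
    have re: "r < e" "r < \<epsilon> * e\<^sup>2 / (K + 1)" using r by (auto simp: \<delta>_def r_def)
    have \<tau>: "0 \<le> \<tau>" "\<tau> \<le> 1"
      using r0 re e by (auto simp: \<tau>_def power_mono divide_le_eq_1)
    have "exp \<tau> - 1 - \<tau> \<le> \<tau>\<^sup>2" using exp_bound[OF \<tau>] by simp
    then have s: "sqrt (exp \<tau> - 1 - \<tau>) \<le> \<tau>" using \<tau> by (simp add: real_le_lsqrt)
    have "\<tau> \<le> exp \<tau> - 1" using exp_ge_add_one_self[of \<tau>] by linarith
    have "\<bar>gconv d e v y - gconv d e v x - (\<Sum>i<d. ggrad d e v x i * (y i - x i))\<bar> \<le> K * sqrt (exp \<tau> - 1 - \<tau>)"
      using gconv_expansion[OF e v x y K] by (simp add: \<tau>_def r_def)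
    also have "\<dots> \<le> (K + 1) * \<tau>"
      using s K0 \<tau> \<open>\<tau> \<le> exp \<tau> - 1\<close> by (intro mult_mono) auto
    also have "\<dots> = ((K + 1) * r / e\<^sup>2) * r" by (simp add: \<tau>_def power2_eq_square)
    also have "\<dots> \<le> \<epsilon> * r"
      using re(2) K0 e r0 by (intro mult_right_mono) (auto simp: field_simps)
    finally show ?thesis by (simp add: r_def)
  qed
  ultimately show "\<exists>\<delta>>0. \<forall>y\<in>Rd d. ddist d y x < \<delta> \<longrightarrow>
     \<bar>gconv d e v y - gconv d e v x - (\<Sum>i<d. ggrad d e v x i * (y i - x i))\<bar> \<le> \<epsilon> * ddist d y x"
    by blast
qed

section \<open>Hellinger-Lipschitz averaging kernels\<close>

lemma integrable_bounded_mult: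
  fixes f w :: "'a \<Rightarrow> real"
  assumes f: "integrable M f" and w: "w \<in> borel_measurable M"
    and W: "\<And>y. y \<in> space M \<Longrightarrow> \<bar>w y\<bar> \<le> W"
  shows "integrable M (\<lambda>y. w y * f y)"
proof (rule Bochner_Integration.integrable_bound[of _ "\<lambda>y. W * f y"])
  show "integrable M (\<lambda>y. W * f y)" using f by simp
  show "(\<lambda>y. w y * f y) \<in> borel_measurable M" using f w by auto
  show "AE y in M. norm (w y * f y) \<le> norm (W * f y)"
    using W by (intro AE_I2) (auto simp: abs_mult intro!: mult_right_mono order_trans[OF W])
qed

text \<open>Write b^2 - a^2 = (b - a)(b + a) and apply Cauchy-Schwarz: one factor is the Hellinger
  distance, the other a second moment of \<open>w\<close> under both kernels. The first bound keeps
  these moments, which become local variances; the second trades them for the bound on |w| and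
  serves for Lipschitz estimates and error terms.\<close>

lemma Hellinger_compare:
  fixes a b w :: "'a \<Rightarrow> real"
  assumes [measurable]: "a \<in> borel_measurable M" "b \<in> borel_measurable M" "w \<in> borel_measurable M"
    and ia: "integrable M (\<lambda>y. (a y)\<^sup>2)" and ib: "integrable M (\<lambda>y. (b y)\<^sup>2)"
    and W: "\<And>y. y \<in> space M \<Longrightarrow> \<bar>w y\<bar> \<le> W" and W0: "0 \<le> W"
    and H: "(\<integral>y. (b y - a y)\<^sup>2 \<partial>M) \<le> H\<^sup>2" and H0: "0 \<le> H"
  shows "(\<integral>y. w y * ((b y)\<^sup>2 - (a y)\<^sup>2) \<partial>M)\<^sup>2
      \<le> H\<^sup>2 * (2 * ((\<integral>y. (w y)\<^sup>2 * (a y)\<^sup>2 \<partial>M) + (\<integral>y. (w y)\<^sup>2 * (b y)\<^sup>2 \<partial>M)))"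
    and "(\<integral>y. (a y)\<^sup>2 \<partial>M) \<le> 1 \<Longrightarrow> (\<integral>y. (b y)\<^sup>2 \<partial>M) \<le> 1 \<Longrightarrow>
      \<bar>\<integral>y. w y * ((b y)\<^sup>2 - (a y)\<^sup>2) \<partial>M\<bar> \<le> 2 * W * H"
proof -
  have W2: "\<bar>(w y)\<^sup>2\<bar> \<le> W\<^sup>2" if "y \<in> space M" for y
    using W[OF that] W0 by (simp add: abs_le_square_iff[symmetric])
  have iwa: "integrable M (\<lambda>y. (w y)\<^sup>2 * (a y)\<^sup>2)"
    by (rule integrable_bounded_mult[OF ia _ W2]) auto
  have iwb: "integrable M (\<lambda>y. (w y)\<^sup>2 * (b y)\<^sup>2)"
    by (rule integrable_bounded_mult[OF ib _ W2]) auto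
  have iab: "integrable M (\<lambda>y. a y * b y)"
    using integrable_L2_mult[OF _ _ ia ib] by simp
  have "(\<lambda>y. (b y - a y)\<^sup>2) = (\<lambda>y. (b y)\<^sup>2 - 2 * (a y * b y) + (a y)\<^sup>2)"
    by (auto simp: power2_diff)
  then have id: "integrable M (\<lambda>y. (b y - a y)\<^sup>2)"
    using ia ib iab by simp
  have le: "(w y * (a y + b y))\<^sup>2 \<le> 2 * ((w y)\<^sup>2 * (a y)\<^sup>2 + (w y)\<^sup>2 * (b y)\<^sup>2)" for y
  proof -
    have "(a y + b y)\<^sup>2 \<le> 2 * ((a y)\<^sup>2 + (b y)\<^sup>2)"
      using sum_squares_bound[of "a y" "b y"] by (simp add: power2_sum)
    then have "(w y)\<^sup>2 * (a y + b y)\<^sup>2 \<le> (w y)\<^sup>2 * (2 * ((a y)\<^sup>2 + (b y)\<^sup>2))"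
      by (intro mult_left_mono) auto
    then show ?thesis unfolding power_mult_distrib by (simp add: algebra_simps)
  qed
  have isq: "integrable M (\<lambda>y. (w y * (a y + b y))\<^sup>2)"
  proof (rule Bochner_Integration.integrable_bound[of _ "\<lambda>y. 2 * ((w y)\<^sup>2 * (a y)\<^sup>2 + (w y)\<^sup>2 * (b y)\<^sup>2)"])
    show "AE y in M. norm ((w y * (a y + b y))\<^sup>2) \<le> norm (2 * ((w y)\<^sup>2 * (a y)\<^sup>2 + (w y)\<^sup>2 * (b y)\<^sup>2))"
      using le by (intro AE_I2) (simp add: abs_of_nonneg)
  qed (use iwa iwb in auto)
  have "(\<integral>y. (w y * (a y + b y))\<^sup>2 \<partial>M) \<le> (\<integral>y. 2 * ((w y)\<^sup>2 * (a y)\<^sup>2 + (w y)\<^sup>2 * (b y)\<^sup>2) \<partial>M)"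
    using isq iwa iwb le by (intro integral_mono) auto
  also have "\<dots> = 2 * ((\<integral>y. (w y)\<^sup>2 * (a y)\<^sup>2 \<partial>M) + (\<integral>y. (w y)\<^sup>2 * (b y)\<^sup>2 \<partial>M))"
    using iwa iwb by simp
  finally have s: "(\<integral>y. (w y * (a y + b y))\<^sup>2 \<partial>M) \<le> \<dots>" .
  have "(\<lambda>y. w y * ((b y)\<^sup>2 - (a y)\<^sup>2)) = (\<lambda>y. (b y - a y) * (w y * (a y + b y)))"
    by (auto simp: power2_eq_square algebra_simps)
  then have "(\<integral>y. w y * ((b y)\<^sup>2 - (a y)\<^sup>2) \<partial>M)\<^sup>2
      \<le> (\<integral>y. (b y - a y)\<^sup>2 \<partial>M) * (\<integral>y. (w y * (a y + b y))\<^sup>2 \<partial>M)"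
    using Cauchy_Schwarz_integral[OF _ _ id isq] by simp
  also have "\<dots> \<le> H\<^sup>2 * (2 * ((\<integral>y. (w y)\<^sup>2 * (a y)\<^sup>2 \<partial>M) + (\<integral>y. (w y)\<^sup>2 * (b y)\<^sup>2 \<partial>M)))"
    using H s by (intro mult_mono) auto
  finally show main: "(\<integral>y. w y * ((b y)\<^sup>2 - (a y)\<^sup>2) \<partial>M)\<^sup>2
      \<le> H\<^sup>2 * (2 * ((\<integral>y. (w y)\<^sup>2 * (a y)\<^sup>2 \<partial>M) + (\<integral>y. (w y)\<^sup>2 * (b y)\<^sup>2 \<partial>M)))" .
  assume a1: "(\<integral>y. (a y)\<^sup>2 \<partial>M) \<le> 1" and b1: "(\<integral>y. (b y)\<^sup>2 \<partial>M) \<le> 1"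
  have "(\<integral>y. (w y)\<^sup>2 * (a y)\<^sup>2 \<partial>M) \<le> (\<integral>y. W\<^sup>2 * (a y)\<^sup>2 \<partial>M)"
    using iwa ia W2 by (intro integral_mono mult_right_mono) auto
  also have "\<dots> \<le> W\<^sup>2" using mult_left_mono[OF a1, of "W\<^sup>2"] by simp
  finally have wa: "(\<integral>y. (w y)\<^sup>2 * (a y)\<^sup>2 \<partial>M) \<le> W\<^sup>2" .
  have "(\<integral>y. (w y)\<^sup>2 * (b y)\<^sup>2 \<partial>M) \<le> (\<integral>y. W\<^sup>2 * (b y)\<^sup>2 \<partial>M)"
    using iwb ib W2 by (intro integral_mono mult_right_mono) auto
  also have "\<dots> \<le> W\<^sup>2" using mult_left_mono[OF b1, of "W\<^sup>2"] by simp
  finally have wb: "(\<integral>y. (w y)\<^sup>2 * (b y)\<^sup>2 \<partial>M) \<le> W\<^sup>2" .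
  have "(\<integral>y. w y * ((b y)\<^sup>2 - (a y)\<^sup>2) \<partial>M)\<^sup>2 \<le> H\<^sup>2 * (2 * (W\<^sup>2 + W\<^sup>2))"
    by (rule order_trans[OF main]) (intro mult_left_mono add_mono wa wb; simp)
  also have "\<dots> = (2 * W * H)\<^sup>2" by (simp add: power2_eq_square)
  finally show "\<bar>\<integral>y. w y * ((b y)\<^sup>2 - (a y)\<^sup>2) \<partial>M\<bar> \<le> 2 * W * H"
    using W0 H0 by (simp add: abs_le_square_iff[symmetric])
qed

text \<open>\<open>A x\<close> is the square root of an unnormalised averaging density with mass
  between \<open>c0\<close> and 1. \<open>A_diff\<close> is Lipschitz dependence in Hellinger
  distance at scale \<sigma>; the factor 3 is what the half-space kernel below achieves.\<close>

locale smoothing_kernel =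
  fixes d :: nat and A :: "(nat \<Rightarrow> real) \<Rightarrow> (nat \<Rightarrow> real) \<Rightarrow> real" and c0 \<sigma> :: real
    and u :: "(nat \<Rightarrow> real) \<Rightarrow> real" and K :: real
  assumes A_meas: "\<And>x. x \<in> Rd d \<Longrightarrow> A x \<in> borel_measurable (lebd d)"
    and A_int: "\<And>x. x \<in> Rd d \<Longrightarrow> integrable (lebd d) (\<lambda>y. (A x y)\<^sup>2)"
    and A_le: "\<And>x. x \<in> Rd d \<Longrightarrow> (\<integral>y. (A x y)\<^sup>2 \<partial>lebd d) \<le> 1"
    and A_ge: "\<And>x. x \<in> Rd d \<Longrightarrow> c0 \<le> (\<integral>y. (A x y)\<^sup>2 \<partial>lebd d)"
    and A_diff: "\<And>x x'. x \<in> Rd d \<Longrightarrow> x' \<in> Rd d \<Longrightarrow>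
      (\<integral>y. (A x' y - A x y)\<^sup>2 \<partial>lebd d) \<le> (3 * ddist d x' x / \<sigma>)\<^sup>2"
    and c0_pos: "0 < c0" and \<sigma>_pos: "0 < \<sigma>"
    and u_meas [measurable]: "u \<in> borel_measurable (lebd d)"
    and u_bound: "\<And>y. y \<in> Rd d \<Longrightarrow> \<bar>u y\<bar> \<le> K" and K_nonneg: "0 \<le> K"
begin

definition av :: "(nat \<Rightarrow> real) \<Rightarrow> real" where
  "av x = (\<integral>y. u y * (A x y)\<^sup>2 \<partial>lebd d) / (\<integral>y. (A x y)\<^sup>2 \<partial>lebd d)"

text \<open>Left unnormalised, unlike \<open>av\<close>: as a minimum over centres of integrals
  linear in the density, it has a Lipschitz bound without division by the mass.\<close>

definition lvar :: "(nat \<Rightarrow> real) \<Rightarrow> real" where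
  "lvar x = (\<integral>y. (u y - av x)\<^sup>2 * (A x y)\<^sup>2 \<partial>lebd d)"

lemma mass_pos: "x \<in> Rd d \<Longrightarrow> 0 < (\<integral>y. (A x y)\<^sup>2 \<partial>lebd d)"
  using A_ge c0_pos by fastforce

lemma u_int: "x \<in> Rd d \<Longrightarrow> integrable (lebd d) (\<lambda>y. u y * (A x y)\<^sup>2)"
  using integrable_bounded_mult[OF A_int u_meas, of x K] u_bound by simp

lemma u_diff_sq_bound:
  assumes "\<bar>c\<bar> \<le> K" "y \<in> Rd d"
  shows "\<bar>u y - c\<bar> \<le> 2 * K" "\<bar>(u y - c)\<^sup>2\<bar> \<le> 4 * K\<^sup>2"
proof -
  show "\<bar>u y - c\<bar> \<le> 2 * K" using u_bound[OF assms(2)] assms(1) by linarith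
  then have "\<bar>u y - c\<bar>\<^sup>2 \<le> (2 * K)\<^sup>2" by (intro power_mono) auto
  then show "\<bar>(u y - c)\<^sup>2\<bar> \<le> 4 * K\<^sup>2" by (simp add: power_mult_distrib)
qed

lemma u_diff_sq_int:
  assumes "x \<in> Rd d"
  shows "integrable (lebd d) (\<lambda>y. (u y - c)\<^sup>2 * (A x y)\<^sup>2)"
proof (rule integrable_bounded_mult[OF A_int[OF assms]])
  fix y assume "y \<in> space (lebd d)"
  then have "\<bar>u y - c\<bar> \<le> K + \<bar>c\<bar>" using u_bound[of y] by simp
  then have "\<bar>u y - c\<bar>\<^sup>2 \<le> (K + \<bar>c\<bar>)\<^sup>2" by (intro power_mono) auto
  then show "\<bar>(u y - c)\<^sup>2\<bar> \<le> (K + \<bar>c\<bar>)\<^sup>2" by simp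
qed measurable

lemma av_bound:
  assumes x: "x \<in> Rd d"
  shows "\<bar>av x\<bar> \<le> K"
proof -
  have "\<bar>\<integral>y. u y * (A x y)\<^sup>2 \<partial>lebd d\<bar> \<le> (\<integral>y. \<bar>u y * (A x y)\<^sup>2\<bar> \<partial>lebd d)" by simp
  also have "\<dots> \<le> (\<integral>y. K * (A x y)\<^sup>2 \<partial>lebd d)"
    using integrable_abs[OF u_int[OF x]] A_int[OF x] u_bound
    by (intro integral_mono) (auto simp: abs_mult intro!: mult_right_mono)
  finally have "\<bar>\<integral>y. u y * (A x y)\<^sup>2 \<partial>lebd d\<bar> \<le> K * (\<integral>y. (A x y)\<^sup>2 \<partial>lebd d)" by simp
  then show ?thesis
    using mass_pos[OF x] by (simp add: av_def pos_divide_le_eq)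
qed

lemma av_centered:
  assumes x: "x \<in> Rd d"
  shows "(\<integral>y. (u y - av x) * (A x y)\<^sup>2 \<partial>lebd d) = 0"
proof -
  have "(\<integral>y. (u y - av x) * (A x y)\<^sup>2 \<partial>lebd d)
      = (\<integral>y. u y * (A x y)\<^sup>2 \<partial>lebd d) - av x * (\<integral>y. (A x y)\<^sup>2 \<partial>lebd d)"
    using u_int[OF x] A_int[OF x] by (simp add: left_diff_distrib)
  then show ?thesis using mass_pos[OF x] by (simp add: av_def)
qed

lemma lvar_nonneg: "0 \<le> lvar x"
  by (simp add: lvar_def)

text \<open>Bias-variance decomposition around the weighted mean. It yields both the minimality of
  \<open>av x\<close> as a centre and the control of the distance from any centre to
  \<open>av x\<close>.\<close>

lemma lvar_shift:
  assumes x: "x \<in> Rd d"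
  shows "(\<integral>y. (u y - c)\<^sup>2 * (A x y)\<^sup>2 \<partial>lebd d) = lvar x + (av x - c)\<^sup>2 * (\<integral>y. (A x y)\<^sup>2 \<partial>lebd d)"
proof -
  have i: "integrable (lebd d) (\<lambda>y. (u y - av x) * (A x y)\<^sup>2)"
    using u_int[OF x] A_int[OF x] by (simp add: left_diff_distrib)
  have "(\<lambda>y. (u y - c)\<^sup>2 * (A x y)\<^sup>2) = (\<lambda>y. (u y - av x)\<^sup>2 * (A x y)\<^sup>2
      + (2 * (av x - c)) * ((u y - av x) * (A x y)\<^sup>2) + (av x - c)\<^sup>2 * (A x y)\<^sup>2)"
    by (rule ext, algebra)
  then show ?thesis
    using u_diff_sq_int[OF x] i A_int[OF x] av_centered[OF x] by (simp add: lvar_def)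
qed

lemma lvar_le:
  assumes x: "x \<in> Rd d"
  shows "lvar x \<le> (\<integral>y. (u y - c)\<^sup>2 * (A x y)\<^sup>2 \<partial>lebd d)"
  using lvar_shift[OF x, of c] mass_pos[OF x] by simp

lemma av_deviation:
  assumes x: "x \<in> Rd d"
  shows "(c - av x)\<^sup>2 \<le> (\<integral>y. (u y - c)\<^sup>2 * (A x y)\<^sup>2 \<partial>lebd d) / c0"
proof -
  have "(av x - c)\<^sup>2 * c0 \<le> (av x - c)\<^sup>2 * (\<integral>y. (A x y)\<^sup>2 \<partial>lebd d)"
    using A_ge[OF x] by (intro mult_left_mono) auto
  then show ?thesis
    using lvar_shift[OF x, of c] lvar_nonneg[of x] c0_pos
    by (simp add: pos_le_divide_eq power2_commute)
qed

text \<open>The centre stays at \<open>av x\<close> while the kernel moves to \<open>x'\<close>. The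
  price is linear in the distance, so it disappears when increments are turned into
  derivatives.\<close>

lemma transfer_sq:
  assumes x: "x \<in> Rd d" and x': "x' \<in> Rd d"
  shows "(\<integral>y. (u y - av x)\<^sup>2 * (A x' y)\<^sup>2 \<partial>lebd d) \<le> lvar x + 24 * K\<^sup>2 * ddist d x' x / \<sigma>"
proof -
  note [measurable] = A_meas[OF x] A_meas[OF x']
  have "\<bar>\<integral>y. (u y - av x)\<^sup>2 * ((A x' y)\<^sup>2 - (A x y)\<^sup>2) \<partial>lebd d\<bar> \<le> 2 * (4 * K\<^sup>2) * (3 * ddist d x' x / \<sigma>)"
    using u_diff_sq_bound[OF av_bound[OF x]] A_diff[OF x x'] \<sigma>_pos A_le[OF x] A_le[OF x']
    by (intro Hellinger_compare(2) A_int x x') auto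
  moreover have "(\<integral>y. (u y - av x)\<^sup>2 * ((A x' y)\<^sup>2 - (A x y)\<^sup>2) \<partial>lebd d)
      = (\<integral>y. (u y - av x)\<^sup>2 * (A x' y)\<^sup>2 \<partial>lebd d) - lvar x"
    using u_diff_sq_int[OF x] u_diff_sq_int[OF x'] by (simp add: right_diff_distrib lvar_def)
  ultimately show ?thesis by (simp add: algebra_simps)
qed

text \<open>Recentring is free because \<open>av\<close> is the minimising centre at each point, so
  \<open>transfer_sq\<close> in both directions suffices.\<close>

lemma lvar_Lipschitz:
  assumes x: "x \<in> Rd d" and x': "x' \<in> Rd d"
  shows "\<bar>lvar x' - lvar x\<bar> \<le> 24 * K\<^sup>2 / \<sigma> * ddist d x' x"
  using transfer_sq[OF x x'] transfer_sq[OF x' x] lvar_le[OF x, of "av x'"] lvar_le[OF x', of "av x"]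
  by (simp add: ddist_commute abs_le_iff)

text \<open>Centring at \<open>av x\<close> kills the integral against the density at
  \<open>x\<close>, so the increment of a quotient becomes one integral against the difference of
  densities, with the mass at \<open>x'\<close> as a factor.\<close>

lemma av_diff_eq:
  assumes x: "x \<in> Rd d" and x': "x' \<in> Rd d"
  shows "(av x' - av x) * (\<integral>y. (A x' y)\<^sup>2 \<partial>lebd d) = (\<integral>y. (u y - av x) * ((A x' y)\<^sup>2 - (A x y)\<^sup>2) \<partial>lebd d)"
proof -
  have i: "integrable (lebd d) (\<lambda>y. (u y - av x) * (A z y)\<^sup>2)" if "z \<in> Rd d" for z
    using u_int[OF that] A_int[OF that] by (simp add: left_diff_distrib)
  have "(\<integral>y. (u y - av x) * ((A x' y)\<^sup>2 - (A x y)\<^sup>2) \<partial>lebd d)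
      = (\<integral>y. (u y - av x) * (A x' y)\<^sup>2 \<partial>lebd d) - (\<integral>y. (u y - av x) * (A x y)\<^sup>2 \<partial>lebd d)"
    using i[OF x] i[OF x'] by (simp add: right_diff_distrib)
  also have "\<dots> = (\<integral>y. u y * (A x' y)\<^sup>2 \<partial>lebd d) - av x * (\<integral>y. (A x' y)\<^sup>2 \<partial>lebd d)"
    using av_centered[OF x] u_int[OF x'] A_int[OF x'] by (simp add: left_diff_distrib)
  finally show ?thesis
    using mass_pos[OF x'] by (simp add: av_def[of x'] left_diff_distrib)
qed

lemma av_Lipschitz:
  assumes x: "x \<in> Rd d" and x': "x' \<in> Rd d"
  shows "\<bar>av x' - av x\<bar> \<le> 12 * K / (c0 * \<sigma>) * ddist d x' x"
proof -
  note [measurable] = A_meas[OF x] A_meas[OF x']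
  have "\<bar>\<integral>y. (u y - av x) * ((A x' y)\<^sup>2 - (A x y)\<^sup>2) \<partial>lebd d\<bar> \<le> 2 * (2 * K) * (3 * ddist d x' x / \<sigma>)"
    using u_diff_sq_bound[OF av_bound[OF x]] A_diff[OF x x'] \<sigma>_pos A_le[OF x] A_le[OF x'] K_nonneg
    by (intro Hellinger_compare(2) A_int x x') auto
  then have "\<bar>av x' - av x\<bar> * (\<integral>y. (A x' y)\<^sup>2 \<partial>lebd d) \<le> 12 * K * ddist d x' x / \<sigma>"
    unfolding av_diff_eq[OF x x', symmetric] abs_mult using mass_pos[OF x'] by simp
  moreover have "\<bar>av x' - av x\<bar> * c0 \<le> \<bar>av x' - av x\<bar> * (\<integral>y. (A x' y)\<^sup>2 \<partial>lebd d)"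
    using A_ge[OF x'] by (intro mult_left_mono) auto
  ultimately have "\<bar>av x' - av x\<bar> * c0 \<le> 12 * K * ddist d x' x / \<sigma>" by linarith
  then show ?thesis using c0_pos \<sigma>_pos by (simp add: field_simps)
qed

text \<open>The heart of the gradient estimate: to leading order the increment is controlled by the
  local variance instead of \<open>K\<close>. The second moments under the two kernels give two
  copies of \<open>lvar x\<close> plus the transfer error; 18 is 3^2 times the 2 of
  \<open>Hellinger_compare\<close>.\<close>

lemma av_diff_sq:
  assumes x: "x \<in> Rd d" and x': "x' \<in> Rd d"
  shows "(av x' - av x)\<^sup>2 \<le> 18 * (ddist d x' x)\<^sup>2 / (c0\<^sup>2 * \<sigma>\<^sup>2) * (2 * lvar x + 24 * K\<^sup>2 * ddist d x' x / \<sigma>)"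
proof -
  note [measurable] = A_meas[OF x] A_meas[OF x']
  let ?r = "ddist d x' x"
  have "(\<integral>y. (u y - av x) * ((A x' y)\<^sup>2 - (A x y)\<^sup>2) \<partial>lebd d)\<^sup>2
     \<le> (3 * ?r / \<sigma>)\<^sup>2 * (2 * ((\<integral>y. (u y - av x)\<^sup>2 * (A x y)\<^sup>2 \<partial>lebd d) + (\<integral>y. (u y - av x)\<^sup>2 * (A x' y)\<^sup>2 \<partial>lebd d)))"
    using u_diff_sq_bound[OF av_bound[OF x]] A_diff[OF x x'] \<sigma>_pos K_nonneg
    by (intro Hellinger_compare(1)[where W = "2 * K"] A_int x x') auto
  also have "\<dots> \<le> (3 * ?r / \<sigma>)\<^sup>2 * (2 * (2 * lvar x + 24 * K\<^sup>2 * ?r / \<sigma>))"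
    using transfer_sq[OF x x'] by (intro mult_left_mono) (auto simp: lvar_def)
  finally have 1: "((av x' - av x) * (\<integral>y. (A x' y)\<^sup>2 \<partial>lebd d))\<^sup>2 \<le> \<dots>"
    unfolding av_diff_eq[OF x x'] .
  have "(av x' - av x)\<^sup>2 * c0\<^sup>2 \<le> (av x' - av x)\<^sup>2 * (\<integral>y. (A x' y)\<^sup>2 \<partial>lebd d)\<^sup>2"
    using A_ge[OF x'] c0_pos by (intro mult_left_mono power_mono) auto
  with 1 have "(av x' - av x)\<^sup>2 * c0\<^sup>2 \<le> (3 * ?r / \<sigma>)\<^sup>2 * (2 * (2 * lvar x + 24 * K\<^sup>2 * ?r / \<sigma>))"
    by (simp add: power_mult_distrib)
  then have "(av x' - av x)\<^sup>2 \<le> (3 * ?r / \<sigma>)\<^sup>2 * (2 * (2 * lvar x + 24 * K\<^sup>2 * ?r / \<sigma>)) / c0\<^sup>2"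
    using c0_pos by (simp add: pos_le_divide_eq)
  also have "\<dots> = 18 * ?r\<^sup>2 / (c0\<^sup>2 * \<sigma>\<^sup>2) * (2 * lvar x + 24 * K\<^sup>2 * ?r / \<sigma>)"
    using c0_pos \<sigma>_pos by (simp add: power_mult_distrib power_divide field_simps)
  finally show ?thesis .
qed

lemma av_meas [measurable]: "av \<in> borel_measurable (lebd d)"
  by (rule Lipschitz_measurable[of _ _ "12 * K / (c0 * \<sigma>)"]) (use av_Lipschitz in blast)

lemma lvar_meas [measurable]: "lvar \<in> borel_measurable (lebd d)"
  by (rule Lipschitz_measurable[of _ _ "24 * K\<^sup>2 / \<sigma>"]) (use lvar_Lipschitz in blast)

lemma lvar_bound:
  assumes x: "x \<in> Rd d"
  shows "\<bar>lvar x\<bar> \<le> 4 * K\<^sup>2"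
proof -
  have "lvar x \<le> (\<integral>y. 4 * K\<^sup>2 * (A x y)\<^sup>2 \<partial>lebd d)"
    unfolding lvar_def using u_diff_sq_int[OF x] A_int[OF x] u_diff_sq_bound(2)[OF av_bound[OF x]]
    by (intro integral_mono mult_right_mono) auto
  also have "\<dots> \<le> 4 * K\<^sup>2"
    using mult_left_mono[OF A_le[OF x], of "4 * K\<^sup>2"] by simp
  finally show ?thesis using lvar_nonneg[of x] by simp
qed

end

section \<open>Gradient bound for the mollified average\<close>

lemma translate_in_Rd [simp]: "(\<lambda>i\<in>{..<d}. y i + t i) \<in> Rd d"
  by (simp add: Rd_def)

lemma ddist_translate: "ddist d (\<lambda>i\<in>{..<d}. y i + t i) y = dnorm d t"
  by (simp add: ddist_def dnorm_def)

lemma gauss_prop_translate: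
  "gauss_prop d e (\<lambda>i\<in>{..<d}. x i + t i) (\<lambda>i\<in>{..<d}. y i + t i) = gauss_prop d e x y"
  by (simp add: gauss_prop_def ddist_def)

text \<open>Translation invariance moves the displacement from the Gaussian to \<open>v\<close>, so
  increments of the mollification are Gaussian averages of increments of \<open>v\<close>.\<close>

lemma gconv_translate:
  assumes [measurable]: "v \<in> borel_measurable (lebd d)" and x: "x \<in> Rd d"
  shows "gconv d e v (\<lambda>i\<in>{..<d}. x i + t i) = (\<integral>y. gauss_prop d e x y * v (\<lambda>i\<in>{..<d}. y i + t i) \<partial>lebd d)"
proof -
  have [measurable]: "(\<lambda>i\<in>{..<d}. x i + t i) \<in> space (lebd d)" by simp
  show ?thesis
    unfolding gconv_def by (subst integral_translate[symmetric, where t = t]) (simp_all add: gauss_prop_translate)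
qed

lemma gconv_Lipschitz_close:
  assumes e: "0 < e" and x: "x \<in> Rd d"
    and lip: "\<And>x y. x \<in> Rd d \<Longrightarrow> y \<in> Rd d \<Longrightarrow> \<bar>v x - v y\<bar> \<le> J * ddist d x y" and J: "0 \<le> J"
    and bd: "\<And>y. y \<in> Rd d \<Longrightarrow> \<bar>v y\<bar> \<le> B"
  shows "\<bar>gconv d e v x - v x\<bar> \<le> J * (e * (1 + real d) / 2)"
proof -
  have v[measurable]: "v \<in> borel_measurable (lebd d)" by (rule Lipschitz_measurable[OF lip])
  have [measurable]: "x \<in> space (lebd d)" using x by simp
  have iv: "integrable (lebd d) (\<lambda>y. gauss_prop d e x y * v y)"
    by (rule integrable_gauss_bounded[OF e v x bd])
  have g: "integrable (lebd d) (\<lambda>y. gauss_prop d e x y * v x)" "(\<integral>y. gauss_prop d e x y * v x \<partial>lebd d) = v x"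
    using has_gauss_total[OF e, of d x] by (auto simp: has_bochner_integral_iff)
  have hb: "has_bochner_integral (lebd d)
      (\<lambda>y. J / 2 * (e * gauss_prop d e x y + 1 / e * (gauss_prop d e x y * (ddist d y x)\<^sup>2)))
      (J / 2 * (e * 1 + 1 / e * (e\<^sup>2 * real d)))"
    by (intro has_bochner_integral_add has_bochner_integral_mult_right has_gauss_total has_gauss_ddist_sq e)
  have pw: "\<bar>gauss_prop d e x y * v y - gauss_prop d e x y * v x\<bar>
      \<le> J / 2 * (e * gauss_prop d e x y + 1 / e * (gauss_prop d e x y * (ddist d y x)\<^sup>2))" if y: "y \<in> Rd d" for y
  proof -
    \<comment> \<open>Arithmetic-geometric mean, so that the second moment e^2 d of the Gaussian
      suffices. The dependence on \<open>d\<close> is harmless because \<open>e\<close> will tend to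
      0.\<close>
    have "2 * e * ddist d y x \<le> e\<^sup>2 + (ddist d y x)\<^sup>2" by (rule sum_squares_bound)
    then have "ddist d y x \<le> (e + (ddist d y x)\<^sup>2 / e) / 2"
      using e by (simp add: field_simps power2_eq_square)
    then have "\<bar>v y - v x\<bar> \<le> J * ((e + (ddist d y x)\<^sup>2 / e) / 2)"
      by (rule order_trans[OF lip[OF y x] mult_left_mono[OF _ J]])
    then have "gauss_prop d e x y * \<bar>v y - v x\<bar> \<le> gauss_prop d e x y * (J * ((e + (ddist d y x)\<^sup>2 / e) / 2))"
      by (intro mult_left_mono) auto
    moreover have "\<bar>gauss_prop d e x y * v y - gauss_prop d e x y * v x\<bar> = gauss_prop d e x y * \<bar>v y - v x\<bar>"
      by (simp add: right_diff_distrib[symmetric] abs_mult)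
    ultimately show ?thesis by (simp add: algebra_simps)
  qed
  have "gconv d e v x - v x = (\<integral>y. gauss_prop d e x y * v y - gauss_prop d e x y * v x \<partial>lebd d)"
    unfolding gconv_def using iv g by simp
  also have "\<bar>\<dots>\<bar> \<le> (\<integral>y. \<bar>gauss_prop d e x y * v y - gauss_prop d e x y * v x\<bar> \<partial>lebd d)" by simp
  also have "\<dots> \<le> (\<integral>y. J / 2 * (e * gauss_prop d e x y + 1 / e * (gauss_prop d e x y * (ddist d y x)\<^sup>2)) \<partial>lebd d)"
    using iv g hb pw by (intro integral_mono integrable_abs Bochner_Integration.integrable_diff) (auto simp: has_bochner_integral_iff)
  also have "\<dots> = J / 2 * (e * 1 + 1 / e * (e\<^sup>2 * real d))"
    using hb by (simp add: has_bochner_integral_iff)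
  also have "\<dots> = J * (e * (1 + real d) / 2)" using e by (simp add: power2_eq_square field_simps)
  finally show ?thesis .
qed

lemma gconv_bound:
  assumes e: "0 < e" and v: "v \<in> borel_measurable (lebd d)" and x: "x \<in> Rd d"
    and bd: "\<And>y. y \<in> Rd d \<Longrightarrow> \<bar>v y\<bar> \<le> B"
  shows "\<bar>gconv d e v x\<bar> \<le> B"
proof -
  have iv: "integrable (lebd d) (\<lambda>y. gauss_prop d e x y * v y)"
    by (rule integrable_gauss_bounded[OF e v x bd])
  have g: "integrable (lebd d) (\<lambda>y. gauss_prop d e x y * B)" "(\<integral>y. gauss_prop d e x y * B \<partial>lebd d) = B"
    using has_gauss_total[OF e, of d x] by (auto simp: has_bochner_integral_iff)
  have "\<bar>gconv d e v x\<bar> \<le> (\<integral>y. \<bar>gauss_prop d e x y * v y\<bar> \<partial>lebd d)" unfolding gconv_def by simp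
  also have "\<dots> \<le> (\<integral>y. gauss_prop d e x y * B \<partial>lebd d)"
    using integrable_abs[OF iv] g(1) bd by (intro integral_mono) (auto simp: abs_mult intro!: mult_left_mono)
  finally show ?thesis unfolding g(2) .
qed

lemma gconv_Lipschitz:
  assumes e: "0 < e" and x: "x \<in> Rd d" and x': "x' \<in> Rd d"
    and lip: "\<And>x y. x \<in> Rd d \<Longrightarrow> y \<in> Rd d \<Longrightarrow> \<bar>v x - v y\<bar> \<le> J * ddist d x y"
    and bd: "\<And>y. y \<in> Rd d \<Longrightarrow> \<bar>v y\<bar> \<le> B"
  shows "\<bar>gconv d e v x' - gconv d e v x\<bar> \<le> J * ddist d x' x"
proof -
  have v[measurable]: "v \<in> borel_measurable (lebd d)" by (rule Lipschitz_measurable[OF lip])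
  define t where "t i = x' i - x i" for i
  have x't: "x' = (\<lambda>i\<in>{..<d}. x i + t i)"
    using x' by (auto simp: t_def Rd_def PiE_iff extensional_def restrict_def)
  have dt: "ddist d x' x = dnorm d t" by (simp add: t_def[abs_def] ddist_eq_dnorm)
  have vt[measurable]: "(\<lambda>y. v (\<lambda>i\<in>{..<d}. y i + t i)) \<in> borel_measurable (lebd d)" by measurable
  have 1: "integrable (lebd d) (\<lambda>y. gauss_prop d e x y * v (\<lambda>i\<in>{..<d}. y i + t i))"
    "integrable (lebd d) (\<lambda>y. gauss_prop d e x y * v y)"
    using integrable_gauss_bounded[OF e vt x, of B] integrable_gauss_bounded[OF e v x, of B] bd by auto
  have "gconv d e v x' - gconv d e v x = gconv d e (\<lambda>y. v (\<lambda>i\<in>{..<d}. y i + t i) - v y) x"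
    unfolding x't gconv_translate[OF v x] unfolding gconv_def using 1 by (simp add: right_diff_distrib)
  also have "\<bar>\<dots>\<bar> \<le> J * dnorm d t"
  proof (rule gconv_bound[OF e _ x])
    show "(\<lambda>y. v (\<lambda>i\<in>{..<d}. y i + t i) - v y) \<in> borel_measurable (lebd d)"
      using vt v by (rule borel_measurable_diff)
    show "\<bar>v (\<lambda>i\<in>{..<d}. y i + t i) - v y\<bar> \<le> J * dnorm d t" if "y \<in> Rd d" for y
      using lip[OF translate_in_Rd that, of y t] by (simp add: ddist_translate)
  qed
  finally show ?thesis by (simp add: dt)
qed

context smoothing_kernel
begin

text \<open>Follow the mollification along its own gradient \<open>G\<close>: the difference
  quotient tends to |G|^2, while Jensen and \<open>av_diff_sq\<close> bound its square by C |G|^2 (2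
  S + O(t)). Cancelling |G|^2 leaves |G|^2 \<le> 2 C S, whence 36 = 2 * 18. No derivative of
  \<open>av\<close> itself is taken.\<close>

lemma gconv_av_grad_bound:
  assumes e: "0 < e" and x: "x \<in> Rd d"
  shows "(dnorm d (ggrad d e av x))\<^sup>2 \<le> 36 / (c0\<^sup>2 * \<sigma>\<^sup>2) * gconv d e lvar x"
proof -
  define G where "G = ggrad d e av x"
  define N where "N = dnorm d G"
  define C where "C = 18 / (c0\<^sup>2 * \<sigma>\<^sup>2)"
  define S where "S = gconv d e lvar x"
  define z where "z t = (\<lambda>i\<in>{..<d}. x i + t * G i)" for t
  have [measurable]: "x \<in> space (lebd d)" using x by simp
  have N0: "0 \<le> N" by (simp add: N_def)
  have C0: "0 \<le> C" by (simp add: C_def)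
  have dz: "ddist d (\<lambda>i\<in>{..<d}. y i + t * G i) y = \<bar>t\<bar> * N" for t y
    by (simp add: ddist_translate dnorm_scale N_def)
  have S0: "0 \<le> S" unfolding S_def gconv_def by (intro integral_nonneg_AE AE_I2) (simp add: lvar_nonneg)
  have upper: "(gconv d e av (z t) - gconv d e av x)\<^sup>2 \<le> C * t\<^sup>2 * N\<^sup>2 * (2 * S + 24 * K\<^sup>2 * (t * N) / \<sigma>)"
    if t: "0 < t" for t
  proof -
    define w where "w y = av (\<lambda>i\<in>{..<d}. y i + t * G i) - av y" for y
    have wm[measurable]: "w \<in> borel_measurable (lebd d)" unfolding w_def[abs_def] by measurable
    have wb: "\<bar>w y\<bar> \<le> 2 * K" if "y \<in> Rd d" for y
      using av_bound[OF translate_in_Rd, of y "\<lambda>i. t * G i"] av_bound[OF that] by (simp add: w_def)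
    have wsq: "(w y)\<^sup>2 \<le> C * t\<^sup>2 * N\<^sup>2 * (2 * lvar y + 24 * K\<^sup>2 * (t * N) / \<sigma>)" if "y \<in> Rd d" for y
      using av_diff_sq[OF that translate_in_Rd, of y "\<lambda>i. t * G i"] t
      by (simp add: w_def dz C_def power_mult_distrib mult.assoc)
    have "\<bar>(w y)\<^sup>2\<bar> \<le> 4 * K\<^sup>2" if "y \<in> Rd d" for y
      using power_mono[OF wb[OF that], of 2] by (simp add: power_mult_distrib)
    then have iw2: "integrable (lebd d) (\<lambda>y. gauss_prop d e x y * (w y)\<^sup>2)"
      by (intro integrable_gauss_bounded[OF e _ x]) auto
    have avt: "(\<lambda>y. av (\<lambda>i\<in>{..<d}. y i + t * G i)) \<in> borel_measurable (lebd d)" by measurable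
    have iwa: "integrable (lebd d) (\<lambda>y. gauss_prop d e x y * av (\<lambda>i\<in>{..<d}. y i + t * G i))"
      "integrable (lebd d) (\<lambda>y. gauss_prop d e x y * av y)"
      using integrable_gauss_bounded[OF e avt x av_bound] integrable_gauss_bounded[OF e av_meas x av_bound]
      by auto
    have il: "integrable (lebd d) (\<lambda>y. gauss_prop d e x y * lvar y)"
      using integrable_gauss_bounded[OF e lvar_meas x lvar_bound] .
    have "gconv d e av (z t) - gconv d e av x = (\<integral>y. gauss_prop d e x y * w y \<partial>lebd d)"
      unfolding z_def gconv_translate[OF av_meas x] unfolding gconv_def using iwa
      by (simp add: w_def right_diff_distrib)
    then have "(gconv d e av (z t) - gconv d e av x)\<^sup>2 \<le> (\<integral>y. gauss_prop d e x y * (w y)\<^sup>2 \<partial>lebd d)"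
      using gauss_Jensen_sq(2)[OF e wm x iw2] by simp
    also have "\<dots> \<le> (\<integral>y. (C * t\<^sup>2 * N\<^sup>2) * (2 * (gauss_prop d e x y * lvar y)
        + 24 * K\<^sup>2 * (t * N) / \<sigma> * gauss_prop d e x y) \<partial>lebd d)"
    proof (rule integral_mono[OF iw2])
      show "integrable (lebd d) (\<lambda>y. (C * t\<^sup>2 * N\<^sup>2) * (2 * (gauss_prop d e x y * lvar y)
        + 24 * K\<^sup>2 * (t * N) / \<sigma> * gauss_prop d e x y))"
        using il has_gauss_total[OF e, of d x] unfolding has_bochner_integral_iff
        by (intro integrable_mult_right Bochner_Integration.integrable_add) auto
      fix y assume "y \<in> space (lebd d)"
      then have "gauss_prop d e x y * (w y)\<^sup>2
          \<le> gauss_prop d e x y * (C * t\<^sup>2 * N\<^sup>2 * (2 * lvar y + 24 * K\<^sup>2 * (t * N) / \<sigma>))"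
        by (intro mult_left_mono wsq) auto
      then show "gauss_prop d e x y * (w y)\<^sup>2 \<le> (C * t\<^sup>2 * N\<^sup>2) * (2 * (gauss_prop d e x y * lvar y)
        + 24 * K\<^sup>2 * (t * N) / \<sigma> * gauss_prop d e x y)"
        by (simp add: algebra_simps)
    qed
    also have "\<dots> = (C * t\<^sup>2 * N\<^sup>2) * (2 * S + 24 * K\<^sup>2 * (t * N) / \<sigma> * 1)"
      using il has_gauss_total[OF e, of d x] unfolding has_bochner_integral_iff S_def gconv_def
      by (subst integral_mult_right integral_mult_right_zero Bochner_Integration.integral_add; simp)
    finally show ?thesis by simp
  qed
  have grad: "has_grad_at d (gconv d e av) G x"
    unfolding G_def by (rule gconv_has_grad[OF e av_meas x av_bound])
  have lim: "((\<lambda>t. (gconv d e av (z t) - gconv d e av x) / t) \<longlongrightarrow> N\<^sup>2) (at_right 0)"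
  proof (rule tendstoI)
    fix \<eta> :: real assume \<eta>: "\<eta> > 0"
    define \<epsilon> where "\<epsilon> = \<eta> / (N + 1)"
    have \<epsilon>: "\<epsilon> > 0" using \<eta> N0 by (simp add: \<epsilon>_def)
    obtain \<delta> where \<delta>: "\<delta> > 0" and D: "\<And>y. y \<in> Rd d \<Longrightarrow> ddist d y x < \<delta> \<Longrightarrow>
        \<bar>gconv d e av y - gconv d e av x - (\<Sum>i<d. G i * (y i - x i))\<bar> \<le> \<epsilon> * ddist d y x"
      using grad \<epsilon> unfolding has_grad_at_def by blast
    have "dist ((gconv d e av (z t) - gconv d e av x) / t) (N\<^sup>2) < \<eta>" if t: "0 < t" "t < \<delta> / (N + 1)" for t
    proof -
      have "t * N \<le> t * (N + 1)" using t by simp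
      also have "\<dots> < \<delta>" using t N0 by (simp add: field_simps)
      finally have tN: "t * N < \<delta>" .
      have "(\<Sum>i<d. G i * (z t i - x i)) = (\<Sum>i<d. t * (G i)\<^sup>2)"
        by (intro sum.cong) (auto simp: z_def power2_eq_square)
      also have "\<dots> = t * N\<^sup>2" by (simp add: N_def dnorm_sq sum_distrib_left)
      finally have "\<bar>gconv d e av (z t) - gconv d e av x - t * N\<^sup>2\<bar> \<le> \<epsilon> * (t * N)"
        using D[of "z t"] tN dz[of x t] t by (simp add: z_def)
      then have "\<bar>gconv d e av (z t) - gconv d e av x - t * N\<^sup>2\<bar> / t \<le> \<epsilon> * N"
        using t by (simp add: field_simps)
      also have "\<bar>gconv d e av (z t) - gconv d e av x - t * N\<^sup>2\<bar> / t = \<bar>(gconv d e av (z t) - gconv d e av x) / t - N\<^sup>2\<bar>"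
        using t by (subst abs_of_pos[OF t(1), symmetric], subst abs_divide[symmetric]) (simp add: field_simps)
      also have "\<epsilon> * N < \<eta>" using \<eta> N0 by (simp add: \<epsilon>_def field_simps)
      finally show ?thesis by (simp add: dist_real_def)
    qed
    moreover have "0 < \<delta> / (N + 1)" using \<delta> N0 by simp
    ultimately show "\<forall>\<^sub>F t in at_right 0. dist ((gconv d e av (z t) - gconv d e av x) / t) (N\<^sup>2) < \<eta>"
      unfolding eventually_at_right_field by blast
  qed
  have "(N\<^sup>2)\<^sup>2 \<le> C * N\<^sup>2 * (2 * S + 24 * K\<^sup>2 * (0 * N) / \<sigma>)"
  proof (rule tendsto_le[OF trivial_limit_at_right_real])
    show "((\<lambda>t. ((gconv d e av (z t) - gconv d e av x) / t)\<^sup>2) \<longlongrightarrow> (N\<^sup>2)\<^sup>2) (at_right 0)"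
      by (intro tendsto_intros lim)
    show "((\<lambda>t. C * N\<^sup>2 * (2 * S + 24 * K\<^sup>2 * (t * N) / \<sigma>)) \<longlongrightarrow> C * N\<^sup>2 * (2 * S + 24 * K\<^sup>2 * (0 * N) / \<sigma>)) (at_right 0)"
      using \<sigma>_pos by (intro tendsto_intros) auto
    show "\<forall>\<^sub>F t in at_right 0. ((gconv d e av (z t) - gconv d e av x) / t)\<^sup>2 \<le> C * N\<^sup>2 * (2 * S + 24 * K\<^sup>2 * (t * N) / \<sigma>)"
      unfolding eventually_at_right_field
    proof (intro exI[of _ 1] conjI allI impI)
      fix t :: real assume t: "0 < t" "t < 1"
      then show "((gconv d e av (z t) - gconv d e av x) / t)\<^sup>2 \<le> C * N\<^sup>2 * (2 * S + 24 * K\<^sup>2 * (t * N) / \<sigma>)"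
        using upper[OF t(1)] by (simp add: power_divide pos_divide_le_eq mult_ac)
    qed simp
  qed
  then have le: "N\<^sup>2 * N\<^sup>2 \<le> (2 * C * S) * N\<^sup>2" by (simp add: power2_eq_square[of "N\<^sup>2"] mult_ac)
  have "N\<^sup>2 \<le> 2 * C * S"
  proof (cases "N = 0")
    case False
    then show ?thesis by (intro mult_right_le_imp_le[OF le]) simp
  qed (simp add: S0 C0)
  then show ?thesis by (simp add: N_def G_def C_def S_def)
qed

end

section \<open>The Dirichlet form of random-walk Metropolis\<close>

text \<open>The density of accepted stationary moves, \<pi>(x) \<alpha>(x, y) Q(x, y), with respect
  to product Lebesgue measure. Its symmetry is detailed balance.\<close>

definition mker :: "nat \<Rightarrow> ((nat \<Rightarrow> real) \<Rightarrow> real) \<Rightarrow> real \<Rightarrow> (nat \<Rightarrow> real) \<Rightarrow> (nat \<Rightarrow> real) \<Rightarrow> real" where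
  "mker d p h x y = min (p x) (p y) * gauss_prop d h x y"

lemma mker_commute: "mker d p h x y = mker d p h y x"
  by (simp add: mker_def min.commute gauss_prop_commute)

lemma sets_target [measurable_cong, simp]: "sets (target d p) = sets (lebd d)"
  by (simp add: target_def)

lemma space_target [simp]: "space (target d p) = Rd d"
  by (simp add: target_def)

locale rwm_target =
  fixes d :: nat and p :: "(nat \<Rightarrow> real) \<Rightarrow> real" and h :: real
  assumes p_meas [measurable]: "p \<in> borel_measurable (lebd d)"
    and p_pos: "\<And>x. x \<in> Rd d \<Longrightarrow> 0 < p x"
    and prob: "prob_space (target d p)"
    and h_pos: "0 < h"
begin

lemma AE_p_nonneg: "AE x in lebd d. 0 \<le> p x"
  using p_pos by (intro AE_I2) (simp add: less_imp_le)

lemma integrable_target: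
  fixes f :: "(nat \<Rightarrow> real) \<Rightarrow> real"
  assumes "f \<in> borel_measurable (lebd d)"
  shows "integrable (target d p) f \<longleftrightarrow> integrable (lebd d) (\<lambda>x. p x * f x)"
  unfolding target_def
  using integrable_density[OF assms p_meas AE_p_nonneg] by simp

lemma integral_target:
  fixes f :: "(nat \<Rightarrow> real) \<Rightarrow> real"
  assumes "f \<in> borel_measurable (lebd d)"
  shows "(\<integral>x. f x \<partial>target d p) = (\<integral>x. p x * f x \<partial>lebd d)"
  unfolding target_def
  using integral_density[OF assms p_meas AE_p_nonneg] by simp

lemma integrable_target_bounded:
  fixes f :: "(nat \<Rightarrow> real) \<Rightarrow> real"
  assumes "f \<in> borel_measurable (lebd d)" and "\<And>x. x \<in> Rd d \<Longrightarrow> \<bar>f x\<bar> \<le> B"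
  shows "integrable (target d p) f"
proof -
  interpret prob_space "target d p" by (rule prob)
  show ?thesis
    using assms by (intro integrable_const_bound[of _ B] AE_I2) auto
qed

lemma mker_meas [measurable]: "(\<lambda>z. mker d p h (fst z) (snd z)) \<in> borel_measurable (lebd d \<Otimes>\<^sub>M lebd d)"
  unfolding mker_def by measurable

lemma mker_meas' [measurable]:
  assumes x: "x \<in> Rd d"
  shows "(\<lambda>y. mker d p h x y) \<in> borel_measurable (lebd d)"
proof -
  have [measurable]: "x \<in> space (lebd d)" using x by simp
  show ?thesis unfolding mker_def by measurable
qed

lemma mker_nonneg: "x \<in> Rd d \<Longrightarrow> y \<in> Rd d \<Longrightarrow> 0 \<le> mker d p h x y"
  using p_pos by (simp add: mker_def less_imp_le)

lemma mker_le: "x \<in> Rd d \<Longrightarrow> y \<in> Rd d \<Longrightarrow> mker d p h x y \<le> p x * gauss_prop d h x y"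
  by (simp add: mker_def mult_right_mono)

lemma mker_int:
  assumes x: "x \<in> Rd d"
  shows "integrable (lebd d) (\<lambda>y. mker d p h x y)"
    and "0 \<le> (\<integral>y. mker d p h x y \<partial>lebd d)" and "(\<integral>y. mker d p h x y \<partial>lebd d) \<le> p x"
proof -
  have g: "has_bochner_integral (lebd d) (\<lambda>y. p x * gauss_prop d h x y) (p x * 1)"
    by (intro has_bochner_integral_mult_right has_gauss_total h_pos)
  then have gi: "integrable (lebd d) (\<lambda>y. p x * gauss_prop d h x y)" by (simp only: has_bochner_integral_iff)
  show i: "integrable (lebd d) (\<lambda>y. mker d p h x y)"
  proof (rule Bochner_Integration.integrable_bound[OF gi mker_meas'[OF x]])
    show "AE y in lebd d. norm (mker d p h x y) \<le> norm (p x * gauss_prop d h x y)"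
      using mker_le[OF x] mker_nonneg[OF x] p_pos[OF x] by (intro AE_I2) (simp add: abs_of_nonneg)
  qed
  show "0 \<le> (\<integral>y. mker d p h x y \<partial>lebd d)"
    using mker_nonneg[OF x] by (intro integral_nonneg_AE AE_I2) auto
  have "(\<integral>y. mker d p h x y \<partial>lebd d) \<le> (\<integral>y. p x * gauss_prop d h x y \<partial>lebd d)"
    using mker_le[OF x] by (intro integral_mono i gi) auto
  then show "(\<integral>y. mker d p h x y \<partial>lebd d) \<le> p x"
    using g unfolding has_bochner_integral_iff by (metis mult.right_neutral)
qed

text \<open>For fixed \<open>x\<close> the mass of accepted moves is at most \<open>p x\<close>, so
  by Tonelli the double integral is dominated by the second moment of \<open>u\<close>.\<close>

lemma pair_integrable_fst:
  assumes [measurable]: "u \<in> borel_measurable (lebd d)" and u2: "integrable (target d p) (\<lambda>x. (u x)\<^sup>2)"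
  shows "integrable (lebd d \<Otimes>\<^sub>M lebd d) (\<lambda>z. mker d p h (fst z) (snd z) * (u (fst z))\<^sup>2)"
proof (rule lebd_pair.Fubini_integrable)
  have pu2: "integrable (lebd d) (\<lambda>x. p x * (u x)\<^sup>2)" using u2 by (simp add: integrable_target)
  have eq: "(\<integral>y. norm (mker d p h (fst (x, y)) (snd (x, y)) * (u (fst (x, y)))\<^sup>2) \<partial>lebd d)
      = (\<integral>y. mker d p h x y \<partial>lebd d) * (u x)\<^sup>2" if "x \<in> Rd d" for x
  proof -
    have "(\<integral>y. norm (mker d p h (fst (x, y)) (snd (x, y)) * (u (fst (x, y)))\<^sup>2) \<partial>lebd d)
       = (\<integral>y. mker d p h x y * (u x)\<^sup>2 \<partial>lebd d)"
      using mker_nonneg[OF that] by (intro Bochner_Integration.integral_cong) (auto simp: abs_mult)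
    then show ?thesis by simp
  qed
  show "integrable (lebd d) (\<lambda>x. \<integral>y. norm (mker d p h (fst (x, y)) (snd (x, y)) * (u (fst (x, y)))\<^sup>2) \<partial>lebd d)"
  proof (rule Bochner_Integration.integrable_bound[OF pu2])
    show "AE x in lebd d. norm (\<integral>y. norm (mker d p h (fst (x, y)) (snd (x, y)) * (u (fst (x, y)))\<^sup>2) \<partial>lebd d)
        \<le> norm (p x * (u x)\<^sup>2)"
    proof (rule AE_I2)
      fix x assume "x \<in> space (lebd d)"
      then have x: "x \<in> Rd d" by simp
      show "norm (\<integral>y. norm (mker d p h (fst (x, y)) (snd (x, y)) * (u (fst (x, y)))\<^sup>2) \<partial>lebd d) \<le> norm (p x * (u x)\<^sup>2)"
        unfolding eq[OF x] using mker_int[OF x] p_pos[OF x] by (simp add: abs_mult mult_right_mono)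
    qed
  qed measurable
  show "AE x in lebd d. integrable (lebd d) (\<lambda>y. mker d p h (fst (x, y)) (snd (x, y)) * (u (fst (x, y)))\<^sup>2)"
    using mker_int(1) by (intro AE_I2) simp
qed measurable

lemma pair_swap:
  assumes [measurable]: "u \<in> borel_measurable (lebd d)"
  shows "integrable (lebd d \<Otimes>\<^sub>M lebd d) (\<lambda>z. mker d p h (fst z) (snd z) * (u (snd z))\<^sup>2)
      \<longleftrightarrow> integrable (lebd d \<Otimes>\<^sub>M lebd d) (\<lambda>z. mker d p h (fst z) (snd z) * (u (fst z))\<^sup>2)"
    and "(\<integral>z. mker d p h (fst z) (snd z) * (u (snd z))\<^sup>2 \<partial>(lebd d \<Otimes>\<^sub>M lebd d))
      = (\<integral>z. mker d p h (fst z) (snd z) * (u (fst z))\<^sup>2 \<partial>(lebd d \<Otimes>\<^sub>M lebd d))"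
proof -
  let ?f = "\<lambda>z. mker d p h (fst z) (snd z) * (u (fst z))\<^sup>2"
  have m: "?f \<in> borel_measurable (lebd d \<Otimes>\<^sub>M lebd d)" by measurable
  have eq: "(\<lambda>(x, y). ?f (y, x)) = (\<lambda>z. mker d p h (fst z) (snd z) * (u (snd z))\<^sup>2)"
    by (auto simp: mker_commute)
  show "integrable (lebd d \<Otimes>\<^sub>M lebd d) (\<lambda>z. mker d p h (fst z) (snd z) * (u (snd z))\<^sup>2)
      \<longleftrightarrow> integrable (lebd d \<Otimes>\<^sub>M lebd d) ?f"
    using lebd_pair.integrable_product_swap_iff[of d ?f] unfolding eq .
  show "(\<integral>z. mker d p h (fst z) (snd z) * (u (snd z))\<^sup>2 \<partial>(lebd d \<Otimes>\<^sub>M lebd d)) = integral\<^sup>L (lebd d \<Otimes>\<^sub>M lebd d) ?f"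
    using lebd_pair.integral_product_swap[OF m] unfolding eq .
qed

lemma pair_integrable_mult:
  assumes [measurable]: "u \<in> borel_measurable (lebd d)" and u2: "integrable (target d p) (\<lambda>x. (u x)\<^sup>2)"
  shows "integrable (lebd d \<Otimes>\<^sub>M lebd d) (\<lambda>z. mker d p h (fst z) (snd z) * (u (fst z) * u (snd z)))"
proof (rule Bochner_Integration.integrable_bound)
  show "integrable (lebd d \<Otimes>\<^sub>M lebd d) (\<lambda>z. mker d p h (fst z) (snd z) * (u (fst z))\<^sup>2 + mker d p h (fst z) (snd z) * (u (snd z))\<^sup>2)"
    using pair_integrable_fst[OF assms] pair_swap(1)[OF assms(1)] by simp
  show "AE z in lebd d \<Otimes>\<^sub>M lebd d. norm (mker d p h (fst z) (snd z) * (u (fst z) * u (snd z)))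
     \<le> norm (mker d p h (fst z) (snd z) * (u (fst z))\<^sup>2 + mker d p h (fst z) (snd z) * (u (snd z))\<^sup>2)"
  proof (rule AE_I2)
    fix z assume "z \<in> space (lebd d \<Otimes>\<^sub>M lebd d)"
    then have m: "0 \<le> mker d p h (fst z) (snd z)" by (auto simp: space_pair_measure intro: mker_nonneg)
    have "2 * \<bar>u (fst z)\<bar> * \<bar>u (snd z)\<bar> \<le> (u (fst z))\<^sup>2 + (u (snd z))\<^sup>2"
      using sum_squares_bound[of "\<bar>u (fst z)\<bar>" "\<bar>u (snd z)\<bar>"] by simp
    moreover have "0 \<le> \<bar>u (fst z)\<bar> * \<bar>u (snd z)\<bar>" by simp
    ultimately have "\<bar>u (fst z)\<bar> * \<bar>u (snd z)\<bar> \<le> (u (fst z))\<^sup>2 + (u (snd z))\<^sup>2" by linarith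
    from mult_left_mono[OF this m]
    show "norm (mker d p h (fst z) (snd z) * (u (fst z) * u (snd z)))
     \<le> norm (mker d p h (fst z) (snd z) * (u (fst z))\<^sup>2 + mker d p h (fst z) (snd z) * (u (snd z))\<^sup>2)"
      using m by (simp add: abs_mult distrib_left[symmetric])
  qed
qed measurable

text \<open>Twice the Dirichlet form, since the usual factor 1/2 is omitted; hence the 2 in
  \<open>rwm_gap_ge\<close>.\<close>

definition energy :: "((nat \<Rightarrow> real) \<Rightarrow> real) \<Rightarrow> real" where
  "energy u = (\<integral>z. mker d p h (fst z) (snd z) * (u (fst z) - u (snd z))\<^sup>2 \<partial>(lebd d \<Otimes>\<^sub>M lebd d))"

lemma energy_expand:
  assumes u: "u \<in> borel_measurable (lebd d)" and u2: "integrable (target d p) (\<lambda>x. (u x)\<^sup>2)"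
  shows "integrable (lebd d \<Otimes>\<^sub>M lebd d) (\<lambda>z. mker d p h (fst z) (snd z) * (u (fst z) - u (snd z))\<^sup>2)"
    and "energy u = 2 * (\<integral>z. mker d p h (fst z) (snd z) * (u (fst z))\<^sup>2 \<partial>(lebd d \<Otimes>\<^sub>M lebd d))
       - 2 * (\<integral>z. mker d p h (fst z) (snd z) * (u (fst z) * u (snd z)) \<partial>(lebd d \<Otimes>\<^sub>M lebd d))"
proof -
  have eq: "(\<lambda>z. mker d p h (fst z) (snd z) * (u (fst z) - u (snd z))\<^sup>2)
    = (\<lambda>z. mker d p h (fst z) (snd z) * (u (fst z))\<^sup>2 + mker d p h (fst z) (snd z) * (u (snd z))\<^sup>2
         - 2 * (mker d p h (fst z) (snd z) * (u (fst z) * u (snd z))))"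
    by (rule ext) (simp add: power2_diff algebra_simps)
  note i = pair_integrable_fst[OF assms] pair_swap(1)[OF u, THEN iffD2, OF pair_integrable_fst[OF assms]]
    pair_integrable_mult[OF assms]
  show "integrable (lebd d \<Otimes>\<^sub>M lebd d) (\<lambda>z. mker d p h (fst z) (snd z) * (u (fst z) - u (snd z))\<^sup>2)"
    unfolding eq by (intro Bochner_Integration.integrable_diff Bochner_Integration.integrable_add integrable_mult_right i)
  show "energy u = 2 * (\<integral>z. mker d p h (fst z) (snd z) * (u (fst z))\<^sup>2 \<partial>(lebd d \<Otimes>\<^sub>M lebd d))
       - 2 * (\<integral>z. mker d p h (fst z) (snd z) * (u (fst z) * u (snd z)) \<partial>(lebd d \<Otimes>\<^sub>M lebd d))"
    unfolding energy_def eq using i pair_swap(2)[OF u]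
    by (simp add: Bochner_Integration.integral_diff Bochner_Integration.integral_add)
qed

lemma energy_mono:
  assumes u: "u \<in> borel_measurable (lebd d)" and u2: "integrable (target d p) (\<lambda>x. (u x)\<^sup>2)"
    and w: "w \<in> borel_measurable (lebd d)" and w2: "integrable (target d p) (\<lambda>x. (w x)\<^sup>2)"
    and le: "\<And>x y. x \<in> Rd d \<Longrightarrow> y \<in> Rd d \<Longrightarrow> \<bar>w x - w y\<bar> \<le> \<bar>u x - u y\<bar>"
  shows "energy w \<le> energy u"
  unfolding energy_def
proof (rule integral_mono[OF energy_expand(1)[OF w w2] energy_expand(1)[OF u u2]])
  fix z assume "z \<in> space (lebd d \<Otimes>\<^sub>M lebd d)"
  then have "fst z \<in> Rd d" "snd z \<in> Rd d" by (auto simp: space_pair_measure)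
  then show "mker d p h (fst z) (snd z) * (w (fst z) - w (snd z))\<^sup>2 \<le> mker d p h (fst z) (snd z) * (u (fst z) - u (snd z))\<^sup>2"
    using le by (intro mult_left_mono mker_nonneg) (auto simp: abs_le_square_iff[symmetric])
qed

text \<open>Multiplying by \<open>p x\<close> clears the quotient in the acceptance ratio; the
  proposal is symmetric, so the minimum of the two densities remains.\<close>

lemma metropolis_op_eq:
  assumes x: "x \<in> Rd d"
  shows "p x * metropolis_op d p (gauss_prop d h) u x
    = (\<integral>y. mker d p h x y * u y \<partial>lebd d) + (p x - (\<integral>y. mker d p h x y \<partial>lebd d)) * u x"
proof -
  have a: "p x * (accept p (gauss_prop d h) x y * gauss_prop d h x y) = mker d p h x y" if y: "y \<in> Rd d" for y
    using p_pos[OF x] p_pos[OF y] gauss_prop_pos[OF h_pos, of d x y]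
    by (simp add: accept_def mker_def gauss_prop_commute[of d h y x] min_def field_simps)
  have "p x * (\<integral>y. accept p (gauss_prop d h) x y * gauss_prop d h x y * u y \<partial>lebd d)
      = (\<integral>y. p x * (accept p (gauss_prop d h) x y * gauss_prop d h x y * u y) \<partial>lebd d)" by simp
  also have "\<dots> = (\<integral>y. mker d p h x y * u y \<partial>lebd d)"
    using a by (intro Bochner_Integration.integral_cong) (auto simp: mult.assoc[symmetric])
  finally have 1: "p x * (\<integral>y. accept p (gauss_prop d h) x y * gauss_prop d h x y * u y \<partial>lebd d)
      = (\<integral>y. mker d p h x y * u y \<partial>lebd d)" .
  have "p x * (\<integral>y. accept p (gauss_prop d h) x y * gauss_prop d h x y \<partial>lebd d)
      = (\<integral>y. p x * (accept p (gauss_prop d h) x y * gauss_prop d h x y) \<partial>lebd d)" by simp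
  also have "\<dots> = (\<integral>y. mker d p h x y \<partial>lebd d)"
    using a by (intro Bochner_Integration.integral_cong) auto
  finally have 2: "p x * (\<integral>y. accept p (gauss_prop d h) x y * gauss_prop d h x y \<partial>lebd d)
      = (\<integral>y. mker d p h x y \<partial>lebd d)" .
  show ?thesis
    unfolding metropolis_op_def distrib_left 1 mult.assoc[symmetric] right_diff_distrib 2 by simp
qed

lemma metropolis_op_meas [measurable]:
  assumes [measurable]: "u \<in> borel_measurable (lebd d)"
  shows "metropolis_op d p (gauss_prop d h) u \<in> borel_measurable (lebd d)"
  unfolding metropolis_op_def[abs_def] accept_def by measurable

lemma Dirichlet_identity:
  assumes u: "u \<in> borel_measurable (lebd d)" and u2: "integrable (target d p) (\<lambda>x. (u x)\<^sup>2)"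
  shows "(\<integral>x. (u x)\<^sup>2 \<partial>target d p) - (\<integral>x. u x * metropolis_op d p (gauss_prop d h) u x \<partial>target d p) = energy u / 2"
proof -
  note [measurable] = u
  have pu2: "integrable (lebd d) (\<lambda>x. p x * (u x)\<^sup>2)" using u2 by (simp add: integrable_target)
  let ?f1 = "\<lambda>x y. mker d p h x y * (u x)\<^sup>2" and ?f2 = "\<lambda>x y. mker d p h x y * (u x * u y)"
  have i1: "integrable (lebd d \<Otimes>\<^sub>M lebd d) (\<lambda>(x, y). ?f1 x y)"
    using pair_integrable_fst[OF assms] by (simp add: case_prod_beta')
  have i2: "integrable (lebd d \<Otimes>\<^sub>M lebd d) (\<lambda>(x, y). ?f2 x y)"
    using pair_integrable_mult[OF assms] by (simp add: case_prod_beta')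
  note j1 = lebd_pair.integrable_fst[OF i1] lebd_pair.integral_fst[OF i1]
  note j2 = lebd_pair.integrable_fst[OF i2] lebd_pair.integral_fst[OF i2]
  have "(\<integral>x. u x * metropolis_op d p (gauss_prop d h) u x \<partial>target d p)
     = (\<integral>x. p x * (u x * metropolis_op d p (gauss_prop d h) u x) \<partial>lebd d)"
    by (rule integral_target) measurable
  \<comment> \<open>Accepted moves contribute \<open>?f2\<close>; rejection contributes p u^2 minus
    the accepted part \<open>?f1\<close>.\<close>
  also have "\<dots> = (\<integral>x. (\<integral>y. ?f2 x y \<partial>lebd d) + p x * (u x)\<^sup>2 - (\<integral>y. ?f1 x y \<partial>lebd d) \<partial>lebd d)"
  proof (rule Bochner_Integration.integral_cong[OF refl])
    fix x assume "x \<in> space (lebd d)"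
    then have x: "x \<in> Rd d" by simp
    have "p x * (u x * metropolis_op d p (gauss_prop d h) u x) = u x * (p x * metropolis_op d p (gauss_prop d h) u x)"
      by simp
    also have "\<dots> = u x * (\<integral>y. mker d p h x y * u y \<partial>lebd d) + p x * (u x)\<^sup>2 - (\<integral>y. mker d p h x y \<partial>lebd d) * (u x)\<^sup>2"
      unfolding metropolis_op_eq[OF x] by (simp add: power2_eq_square algebra_simps)
    also have "u x * (\<integral>y. mker d p h x y * u y \<partial>lebd d) = (\<integral>y. ?f2 x y \<partial>lebd d)"
      by (subst integral_mult_right_zero[symmetric]) (simp add: mult_ac)
    finally show "p x * (u x * metropolis_op d p (gauss_prop d h) u x)
        = (\<integral>y. ?f2 x y \<partial>lebd d) + p x * (u x)\<^sup>2 - (\<integral>y. ?f1 x y \<partial>lebd d)" by simp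
  qed
  also have "\<dots> = (\<integral>z. (\<lambda>(x, y). ?f2 x y) z \<partial>(lebd d \<Otimes>\<^sub>M lebd d)) + (\<integral>x. p x * (u x)\<^sup>2 \<partial>lebd d)
      - (\<integral>z. (\<lambda>(x, y). ?f1 x y) z \<partial>(lebd d \<Otimes>\<^sub>M lebd d))"
    unfolding j1(2)[symmetric] j2(2)[symmetric] using pu2 j1(1) j2(1)
    by (subst Bochner_Integration.integral_diff) (auto simp: Bochner_Integration.integral_add)
  finally show ?thesis
    using energy_expand(2)[OF assms] integral_target[of "\<lambda>x. (u x)\<^sup>2"] by (simp add: case_prod_beta')
qed

end

section \<open>From a functional inequality to the energy\<close>

text \<open>The common consequence of the two functional inequalities that gets applied. Its test
  functions match the mollified averages: bounded, globally Lipschitz and differentiable everywhere,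
  so admissibility is immediate.\<close>

definition Lipschitz_PI :: "nat \<Rightarrow> ((nat \<Rightarrow> real) \<Rightarrow> real) \<Rightarrow> real \<Rightarrow> bool" where
  "Lipschitz_PI d p C \<longleftrightarrow>
     (\<forall>u G J B. (\<forall>x\<in>Rd d. \<forall>y\<in>Rd d. \<bar>u x - u y\<bar> \<le> J * ddist d x y) \<longrightarrow>
        (\<forall>x\<in>Rd d. \<bar>u x\<bar> \<le> B) \<longrightarrow> (\<forall>x\<in>Rd d. has_grad_at d u (G x) x) \<longrightarrow>
        integrable (target d p) (\<lambda>x. (dnorm d (G x))\<^sup>2) \<longrightarrow>
        (\<integral>x. (u x - (\<integral>y. u y \<partial>target d p))\<^sup>2 \<partial>target d p)
          \<le> C * (\<integral>x. (dnorm d (G x))\<^sup>2 \<partial>target d p))"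

lemma (in prob_space) variance_le_deviation:
  fixes X :: "'a \<Rightarrow> real"
  assumes X: "integrable M X" and X2: "integrable M (\<lambda>x. (X x)\<^sup>2)"
  shows "(\<integral>x. (X x - (\<integral>y. X y \<partial>M))\<^sup>2 \<partial>M) \<le> (\<integral>x. (X x - c)\<^sup>2 \<partial>M)"
proof -
  have dev: "(\<integral>x. (X x - c)\<^sup>2 \<partial>M) = (\<integral>x. (X x)\<^sup>2 \<partial>M) - 2 * c * (\<integral>x. X x \<partial>M) + c\<^sup>2" for c
  proof -
    have "(\<lambda>x. (X x - c)\<^sup>2) = (\<lambda>x. (X x)\<^sup>2 - (2 * c) * X x + c\<^sup>2)"
      by (simp add: power2_diff algebra_simps)
    then show ?thesis using X X2 by (simp add: prob_space)
  qed
  have "0 \<le> ((\<integral>x. X x \<partial>M) - c)\<^sup>2" by simp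
  then show ?thesis
    unfolding dev by (simp add: power2_eq_square algebra_simps)
qed

context rwm_target
begin

lemma Lipschitz_bounded_admissible:
  assumes lip: "\<And>x y. x \<in> Rd d \<Longrightarrow> y \<in> Rd d \<Longrightarrow> \<bar>u x - u y\<bar> \<le> J * ddist d x y"
    and bd: "\<And>x. x \<in> Rd d \<Longrightarrow> \<bar>u x\<bar> \<le> B"
    and grad: "\<And>x. x \<in> Rd d \<Longrightarrow> has_grad_at d u (G x) x"
    and G: "integrable (target d p) (\<lambda>x. (dnorm d (G x))\<^sup>2)"
  shows "admissible d p u G"
  unfolding admissible_def
proof (intro conjI G)
  show "locally_lipschitz_d d u"
    unfolding locally_lipschitz_d_def using lip by (meson zero_less_one)
  show "AE x in lebd d. has_grad_at d u (G x) x"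
    using grad by (intro AE_I2) simp
  have "u \<in> borel_measurable (lebd d)" by (rule Lipschitz_measurable[OF lip])
  moreover have "\<bar>(u x)\<^sup>2\<bar> \<le> B\<^sup>2" if "x \<in> Rd d" for x
    using power_mono[OF bd[OF that], of 2] by simp
  ultimately show "integrable (target d p) (\<lambda>x. (u x)\<^sup>2)"
    by (intro integrable_target_bounded) auto
qed

lemma PI_imp_Lipschitz_PI: "PI d p C \<Longrightarrow> Lipschitz_PI d p C"
  unfolding PI_def Lipschitz_PI_def using Lipschitz_bounded_admissible by metis

text \<open>Adding a large constant to \<open>u\<close> makes it positive without changing its variance or gradient; for
  \<open>w > 0\<close> and \<open>m = E[w\<^sup>2]\<close> the entropy of \<open>w\<^sup>2\<close> dominates \<open>E[(w - sqrt m)\<^sup>2]\<close>, by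
  \<open>a ln (a / b) - a + b \<ge> (sqrt a - sqrt b)\<^sup>2\<close>.\<close>

lemma LSI_imp_Lipschitz_PI:
  assumes "LSI d p C"
  shows "Lipschitz_PI d p C"
  unfolding Lipschitz_PI_def
proof (intro allI impI)
  fix u G J B
  assume lip: "\<forall>x\<in>Rd d. \<forall>y\<in>Rd d. \<bar>u x - u y\<bar> \<le> J * ddist d x y"
    and bd: "\<forall>x\<in>Rd d. \<bar>u x\<bar> \<le> B" and grad: "\<forall>x\<in>Rd d. has_grad_at d u (G x) x"
    and G: "integrable (target d p) (\<lambda>x. (dnorm d (G x))\<^sup>2)"
  interpret prob_space "target d p" by (rule prob)
  \<comment> \<open>The shift makes w \<ge> 1, so \<open>ln\<close> only sees positive arguments and
    m \<ge> 1.\<close>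
  define w where "w x = u x + (\<bar>B\<bar> + 1)" for x
  have w_lip: "\<bar>w x - w y\<bar> \<le> J * ddist d x y" if "x \<in> Rd d" "y \<in> Rd d" for x y
    using lip that by (simp add: w_def)
  have w_meas[measurable]: "w \<in> borel_measurable (lebd d)" by (rule Lipschitz_measurable[OF w_lip])
  have u_meas[measurable]: "u \<in> borel_measurable (lebd d)" by (rule Lipschitz_measurable) (use lip in auto)
  have w_ge: "1 \<le> w x" and w_le: "\<bar>w x\<bar> \<le> 2 * \<bar>B\<bar> + 1" if "x \<in> Rd d" for x
    using bd that by (fastforce simp: w_def)+
  have adm: "admissible d p w G"
    by (rule Lipschitz_bounded_admissible[OF w_lip w_le]) (use grad G in \<open>auto simp: has_grad_at_def w_def\<close>)
  define m where "m = (\<integral>y. (w y)\<^sup>2 \<partial>target d p)"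
  define s where "s = sqrt m"
  define ent where "ent x = (w x)\<^sup>2 * ln ((w x)\<^sup>2 / m)" for x
  have ent_int: "integrable (target d p) ent" and
    ent_le: "(\<integral>x. ent x \<partial>target d p) \<le> C * (\<integral>x. (dnorm d (G x))\<^sup>2 \<partial>target d p)"
    using assms adm unfolding LSI_def Let_def m_def ent_def[abs_def] by simp_all
  have w_int: "integrable (target d p) w" by (rule integrable_target_bounded[OF w_meas w_le])
  have u_int: "integrable (target d p) u" by (rule integrable_target_bounded[OF u_meas]) (use bd in auto)
  have w2_int: "integrable (target d p) (\<lambda>x. (w x)\<^sup>2)" using adm by (simp add: admissible_def)
  have "(\<integral>x. (1::real) \<partial>target d p) \<le> m"
    unfolding m_def using w_ge by (intro integral_mono w2_int) (auto intro: one_le_power)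
  then have m1: "1 \<le> m" using prob_space by simp
  then have s0: "0 < s" and s2: "s\<^sup>2 = m" by (auto simp: s_def)
  have pw: "(w x - s)\<^sup>2 + ((w x)\<^sup>2 - m) \<le> ent x" if x: "x \<in> Rd d" for x
  proof -
    have w0: "0 < w x" using w_ge[OF x] by simp
    have "ln ((w x)\<^sup>2 / m) = - (2 * ln (s / w x))"
      using w0 s0 by (simp add: s2[symmetric] ln_div ln_realpow)
    moreover have "ln (s / w x) \<le> s / w x - 1" using w0 s0 by (intro ln_le_minus_one) simp
    ultimately have "2 * (1 - s / w x) \<le> ln ((w x)\<^sup>2 / m)" by simp
    then have "(w x)\<^sup>2 * (2 * (1 - s / w x)) \<le> ent x"
      unfolding ent_def by (intro mult_left_mono) auto
    moreover have "(w x)\<^sup>2 * (2 * (1 - s / w x)) = (w x - s)\<^sup>2 + ((w x)\<^sup>2 - m)"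
      using w0 s2[symmetric] by (simp add: power2_eq_square field_simps)
    ultimately show ?thesis by simp
  qed
  have ws: "integrable (target d p) (\<lambda>x. (w x - s)\<^sup>2)"
    using w_int w2_int by (simp add: power2_diff)
  \<comment> \<open>\<open>w\<^sup>2 - m\<close> has mean zero, so adding it costs nothing and
    brings in the pointwise entropy bound.\<close>
  have "(\<integral>x. (w x - s)\<^sup>2 \<partial>target d p) = (\<integral>x. (w x - s)\<^sup>2 + ((w x)\<^sup>2 - m) \<partial>target d p)"
    using ws w2_int prob_space by (simp add: m_def[symmetric])
  also have "\<dots> \<le> (\<integral>x. ent x \<partial>target d p)"
    using ws w2_int ent_int pw by (intro integral_mono) auto
  finally have "(\<integral>x. (w x - s)\<^sup>2 \<partial>target d p) \<le> C * (\<integral>x. (dnorm d (G x))\<^sup>2 \<partial>target d p)"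
    using ent_le by simp
  moreover have "(\<integral>x. (w x - (\<integral>y. w y \<partial>target d p))\<^sup>2 \<partial>target d p) \<le> (\<integral>x. (w x - s)\<^sup>2 \<partial>target d p)"
    by (rule variance_le_deviation[OF w_int w2_int])
  moreover have "(\<integral>y. w y \<partial>target d p) = (\<integral>y. u y \<partial>target d p) + (\<bar>B\<bar> + 1)"
    unfolding w_def using u_int prob_space by simp
  ultimately show "(\<integral>x. (u x - (\<integral>y. u y \<partial>target d p))\<^sup>2 \<partial>target d p)
          \<le> C * (\<integral>x. (dnorm d (G x))\<^sup>2 \<partial>target d p)"
    by (simp add: w_def)
qed

end

locale smoothed_rwm = rwm_target d p h + smoothing_kernel d A c0 \<sigma> u K
  for d p h A c0 \<sigma> u K
begin

lemma ggrad_meas: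
  assumes [measurable]: "v \<in> borel_measurable (lebd d)"
  shows "(\<lambda>x. (dnorm d (ggrad d e v x))\<^sup>2) \<in> borel_measurable (lebd d)"
proof -
  have "(\<lambda>x. (ggrad d e v x i)\<^sup>2) \<in> borel_measurable (lebd d)" if i[measurable]: "i < d" for i
    unfolding ggrad_def by measurable
  then show ?thesis
    unfolding dnorm_sq by (intro borel_measurable_sum) auto
qed

text \<open>The Poincare inequality is applied to \<open>gconv d e av\<close>, whose squared
  gradient is bounded by a mollified \<open>lvar\<close>. Both mollifications are undone at a cost
  linear in \<open>e\<close>, and \<open>e\<close> tends to 0.\<close>

lemma variance_av:
  assumes PI: "Lipschitz_PI d p C" and C: "0 \<le> C"
  shows "(\<integral>x. (av x - (\<integral>y. av y \<partial>target d p))\<^sup>2 \<partial>target d p)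
    \<le> C * (36 / (c0\<^sup>2 * \<sigma>\<^sup>2)) * (\<integral>x. lvar x \<partial>target d p)"
proof -
  interpret prob_space "target d p" by (rule prob)
  define J where "J = 12 * K / (c0 * \<sigma>)"
  define J' where "J' = 24 * K\<^sup>2 / \<sigma>"
  define \<kappa> where "\<kappa> = 36 / (c0\<^sup>2 * \<sigma>\<^sup>2)"
  have pos: "0 \<le> J" "0 \<le> J'" "0 \<le> \<kappa>"
    using c0_pos \<sigma>_pos K_nonneg by (auto simp: J_def J'_def \<kappa>_def)
  have lip: "\<bar>av x - av y\<bar> \<le> J * ddist d x y" if "x \<in> Rd d" "y \<in> Rd d" for x y
    using av_Lipschitz that by (simp add: J_def)
  have lip': "\<bar>lvar x - lvar y\<bar> \<le> J' * ddist d x y" if "x \<in> Rd d" "y \<in> Rd d" for x y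
    using lvar_Lipschitz that by (simp add: J'_def)
  have av_int: "integrable (target d p) av"
    by (rule integrable_target_bounded[OF av_meas av_bound])
  have av2_int: "integrable (target d p) (\<lambda>x. (av x)\<^sup>2)"
  proof (rule integrable_target_bounded)
    show "\<bar>(av x)\<^sup>2\<bar> \<le> K\<^sup>2" if "x \<in> Rd d" for x
      using power_mono[OF av_bound[OF that], of 2] by simp
  qed measurable
  have lvar_int: "integrable (target d p) lvar"
    by (rule integrable_target_bounded[OF lvar_meas lvar_bound])
  define Va where "Va = (\<integral>x. (av x - (\<integral>y. av y \<partial>target d p))\<^sup>2 \<partial>target d p)"
  \<comment> \<open>First summand: replacing the mollified \<open>lvar\<close> by
    \<open>lvar\<close>. Second summand: replacing the variance of the mollified average by that of
    \<open>av\<close>.\<close>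
  define c where "c = C * \<kappa> * J' * (1 + real d) / 2 + 4 * K * (J * (1 + real d) / 2)"
  have c0: "0 \<le> c" using pos C K_nonneg by (simp add: c_def)
  have step: "Va \<le> C * \<kappa> * (\<integral>x. lvar x \<partial>target d p) + c * e" if e: "0 < e" for e
  proof -
    define v where "v = gconv d e av"
    define G where "G = ggrad d e av"
    define m where "m = (\<integral>y. v y \<partial>target d p)"
    have v_lip: "\<bar>v x - v y\<bar> \<le> J * ddist d x y" if "x \<in> Rd d" "y \<in> Rd d" for x y
      unfolding v_def by (rule gconv_Lipschitz[OF e that(2) that(1) lip av_bound])
    have v_bd: "\<bar>v x\<bar> \<le> K" if "x \<in> Rd d" for x
      unfolding v_def by (rule gconv_bound[OF e av_meas that av_bound])
    have v_meas[measurable]: "v \<in> borel_measurable (lebd d)" by (rule Lipschitz_measurable[OF v_lip])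
    have v_grad: "has_grad_at d v (G x) x" if "x \<in> Rd d" for x
      unfolding v_def G_def by (rule gconv_has_grad[OF e av_meas that av_bound])
    have G_le: "(dnorm d (G x))\<^sup>2 \<le> \<kappa> * (lvar x + J' * (e * (1 + real d) / 2))" if x: "x \<in> Rd d" for x
    proof -
      have "gconv d e lvar x \<le> lvar x + J' * (e * (1 + real d) / 2)"
        using gconv_Lipschitz_close[OF e x lip' pos(2) lvar_bound] by linarith
      from mult_left_mono[OF this pos(3)] show ?thesis
        using gconv_av_grad_bound[OF e x] by (simp add: G_def \<kappa>_def)
    qed
    have G_bd: "\<bar>(dnorm d (G x))\<^sup>2\<bar> \<le> \<kappa> * (4 * K\<^sup>2 + J' * (e * (1 + real d) / 2))" if x: "x \<in> Rd d" for x
    proof -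
      have "\<kappa> * (lvar x + J' * (e * (1 + real d) / 2)) \<le> \<kappa> * (4 * K\<^sup>2 + J' * (e * (1 + real d) / 2))"
        using lvar_bound[OF x] pos by (intro mult_left_mono) auto
      then show ?thesis using G_le[OF x] by simp
    qed
    have G_int: "integrable (target d p) (\<lambda>x. (dnorm d (G x))\<^sup>2)"
      by (rule integrable_target_bounded[OF _ G_bd]) (auto simp: G_def intro!: ggrad_meas)
    have v_int: "integrable (target d p) v" by (rule integrable_target_bounded[OF v_meas v_bd])
    have m_le: "\<bar>m\<bar> \<le> K"
    proof -
      have "\<bar>m\<bar> \<le> (\<integral>x. \<bar>v x\<bar> \<partial>target d p)" unfolding m_def by simp
      also have "\<dots> \<le> (\<integral>x. K \<partial>target d p)"
        using v_int v_bd by (intro integral_mono integrable_abs) auto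
      finally show ?thesis using prob_space by simp
    qed
    have "(\<integral>x. (v x - m)\<^sup>2 \<partial>target d p) \<le> C * (\<integral>x. (dnorm d (G x))\<^sup>2 \<partial>target d p)"
      using PI v_lip v_bd v_grad G_int unfolding Lipschitz_PI_def m_def by blast
    also have "\<dots> \<le> C * (\<integral>x. \<kappa> * (lvar x + J' * (e * (1 + real d) / 2)) \<partial>target d p)"
      using G_int lvar_int G_le C by (intro mult_left_mono integral_mono) auto
    also have "\<dots> = C * \<kappa> * (\<integral>x. lvar x \<partial>target d p) + C * \<kappa> * J' * (1 + real d) / 2 * e"
      using lvar_int prob_space by (simp add: algebra_simps)
    finally have var_v: "(\<integral>x. (v x - m)\<^sup>2 \<partial>target d p)
      \<le> C * \<kappa> * (\<integral>x. lvar x \<partial>target d p) + C * \<kappa> * J' * (1 + real d) / 2 * e" .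
    have vm_int: "integrable (target d p) (\<lambda>x. (v x - m)\<^sup>2)"
    proof (rule integrable_target_bounded)
      show "\<bar>(v x - m)\<^sup>2\<bar> \<le> (2 * K)\<^sup>2" if "x \<in> Rd d" for x
        using power_mono[of "\<bar>v x - m\<bar>" "2 * K" 2] v_bd[OF that] m_le by simp
    qed measurable
    have cmp: "(av x - m)\<^sup>2 \<le> (v x - m)\<^sup>2 + 4 * K * (J * (e * (1 + real d) / 2))" if x: "x \<in> Rd d" for x
    proof -
      have 1: "\<bar>av x - v x\<bar> \<le> J * (e * (1 + real d) / 2)"
        using gconv_Lipschitz_close[OF e x lip pos(1) av_bound] by (simp add: v_def abs_minus_commute)
      have 2: "\<bar>av x + v x - 2 * m\<bar> \<le> 4 * K"
        using av_bound[OF x] v_bd[OF x] m_le by linarith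
      have "(av x - m)\<^sup>2 - (v x - m)\<^sup>2 = (av x + v x - 2 * m) * (av x - v x)"
        by (simp add: power2_eq_square algebra_simps)
      also have "\<dots> \<le> \<bar>av x + v x - 2 * m\<bar> * \<bar>av x - v x\<bar>"
        by (simp add: abs_mult[symmetric])
      also have "\<dots> \<le> 4 * K * (J * (e * (1 + real d) / 2))"
        using 1 2 K_nonneg by (intro mult_mono) auto
      finally show ?thesis by simp
    qed
    \<comment> \<open>The mean of \<open>v\<close> acts as a comparison centre for
      \<open>av\<close>.\<close>
    have "Va \<le> (\<integral>x. (av x - m)\<^sup>2 \<partial>target d p)"
      unfolding Va_def by (rule variance_le_deviation[OF av_int av2_int])
    also have "\<dots> \<le> (\<integral>x. (v x - m)\<^sup>2 + 4 * K * (J * (e * (1 + real d) / 2)) \<partial>target d p)"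
      using vm_int cmp av_int av2_int by (intro integral_mono) (auto simp: power2_diff)
    also have "\<dots> = (\<integral>x. (v x - m)\<^sup>2 \<partial>target d p) + 4 * K * (J * (1 + real d) / 2) * e"
      using vm_int prob_space by simp
    finally show ?thesis using var_v by (simp add: c_def algebra_simps)
  qed
  have "Va \<le> C * \<kappa> * (\<integral>x. lvar x \<partial>target d p)"
  proof (rule field_le_epsilon)
    fix \<eta> :: real assume \<eta>: "0 < \<eta>"
    have "c * (\<eta> / (c + 1)) \<le> \<eta>" using c0 \<eta> by (simp add: field_simps)
    then show "Va \<le> C * \<kappa> * (\<integral>x. lvar x \<partial>target d p) + \<eta>"
      using step[of "\<eta> / (c + 1)"] c0 \<eta> by simp
  qed
  then show ?thesis by (simp add: Va_def \<kappa>_def)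
qed

lemma u_sq_int: "integrable (target d p) (\<lambda>x. (u x)\<^sup>2)"
proof (rule integrable_target_bounded)
  show "\<bar>(u x)\<^sup>2\<bar> \<le> K\<^sup>2" if "x \<in> Rd d" for x
    using power_mono[OF u_bound[OF that], of 2] by simp
qed measurable

text \<open>Split u - m = (u - av) + (av - m) with \<open>m\<close> the mean of \<open>av\<close>.
  Domination by \<open>mker\<close> turns both the local displacement and the local variance into
  energy; 54 is 27 times the 2 of (a + b)^2 \<le> 2 a^2 + 2 b^2.\<close>

lemma variance_u:
  assumes dom: "\<And>x y. x \<in> Rd d \<Longrightarrow> y \<in> Rd d \<Longrightarrow> p x * (A x y)\<^sup>2 \<le> 27 * mker d p h x y"
    and PI: "Lipschitz_PI d p C" and C: "0 \<le> C"
  shows "(\<integral>x. (u x - (\<integral>y. u y \<partial>target d p))\<^sup>2 \<partial>target d p)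
    \<le> (54 / c0 + 54 * 36 * C / (c0\<^sup>2 * \<sigma>\<^sup>2)) * energy u"
proof -
  interpret prob_space "target d p" by (rule prob)
  let ?f = "\<lambda>x y. mker d p h x y * (u x - u y)\<^sup>2"
  have pair: "integrable (lebd d \<Otimes>\<^sub>M lebd d) (\<lambda>(x, y). ?f x y)"
    using energy_expand(1)[OF u_meas u_sq_int] by (simp add: case_prod_beta')
  have int_x: "integrable (lebd d) (\<lambda>x. \<integral>y. ?f x y \<partial>lebd d)"
    by (rule lebd_pair.integrable_fst[OF pair])
  have energy_eq: "(\<integral>x. (\<integral>y. ?f x y \<partial>lebd d) \<partial>lebd d) = energy u"
    using lebd_pair.integral_fst[OF pair] by (simp add: energy_def case_prod_beta')
  have local: "p x * (\<integral>y. (u y - u x)\<^sup>2 * (A x y)\<^sup>2 \<partial>lebd d) \<le> 27 * (\<integral>y. ?f x y \<partial>lebd d)" if x: "x \<in> Rd d" for x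
  proof -
    have i: "integrable (lebd d) (\<lambda>y. (u x - u y)\<^sup>2 * mker d p h x y)"
    proof (rule integrable_bounded_mult[OF mker_int(1)[OF x]])
      show "\<bar>(u x - u y)\<^sup>2\<bar> \<le> 4 * K\<^sup>2" if "y \<in> space (lebd d)" for y
        using u_diff_sq_bound(2)[OF u_bound[OF x], of y] that by (simp add: power2_commute)
    qed measurable
    have "p x * (\<integral>y. (u y - u x)\<^sup>2 * (A x y)\<^sup>2 \<partial>lebd d) = (\<integral>y. p x * ((u y - u x)\<^sup>2 * (A x y)\<^sup>2) \<partial>lebd d)"
      by simp
    also have "\<dots> \<le> (\<integral>y. 27 * ?f x y \<partial>lebd d)"
    proof (rule integral_mono)
      show "integrable (lebd d) (\<lambda>y. p x * ((u y - u x)\<^sup>2 * (A x y)\<^sup>2))"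
        using u_diff_sq_int[OF x] by simp
      show "integrable (lebd d) (\<lambda>y. 27 * ?f x y)" using i by (simp add: mult.commute)
      fix y assume "y \<in> space (lebd d)"
      then have "(u x - u y)\<^sup>2 * (p x * (A x y)\<^sup>2) \<le> (u x - u y)\<^sup>2 * (27 * mker d p h x y)"
        by (intro mult_left_mono dom x) auto
      then show "p x * ((u y - u x)\<^sup>2 * (A x y)\<^sup>2) \<le> 27 * ?f x y"
        by (simp add: power2_commute[of "u y"] mult_ac)
    qed
    finally show ?thesis by simp
  qed
  have lvar_le: "(\<integral>x. lvar x \<partial>target d p) \<le> 27 * energy u"
  proof -
    have "(\<integral>x. lvar x \<partial>target d p) = (\<integral>x. p x * lvar x \<partial>lebd d)" by (rule integral_target) measurable
    also have "\<dots> \<le> (\<integral>x. 27 * (\<integral>y. ?f x y \<partial>lebd d) \<partial>lebd d)"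
    proof (rule integral_mono)
      show "integrable (lebd d) (\<lambda>x. p x * lvar x)"
        using integrable_target_bounded[OF lvar_meas lvar_bound] by (simp add: integrable_target)
      fix x assume "x \<in> space (lebd d)"
      then have x: "x \<in> Rd d" by simp
      \<comment> \<open>Taking \<open>u x\<close> as the competing centre compares the local
        variance with squared jumps out of \<open>x\<close>.\<close>
      show "p x * lvar x \<le> 27 * (\<integral>y. ?f x y \<partial>lebd d)"
        using mult_left_mono[OF lvar_le[OF x, of "u x"], of "p x"] local[OF x] p_pos[OF x] by linarith
    qed (use int_x in simp)
    finally show ?thesis using energy_eq by simp
  qed
  have dev_sq: "\<bar>(u x - av x)\<^sup>2\<bar> \<le> 4 * K\<^sup>2" if x: "x \<in> Rd d" for x
    using u_diff_sq_bound(2)[OF av_bound[OF x] x] .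
  have dev_int: "integrable (target d p) (\<lambda>x. (u x - av x)\<^sup>2)"
    by (rule integrable_target_bounded[OF _ dev_sq]) measurable
  have dev_le: "(\<integral>x. (u x - av x)\<^sup>2 \<partial>target d p) \<le> 27 / c0 * energy u"
  proof -
    have "(\<integral>x. (u x - av x)\<^sup>2 \<partial>target d p) = (\<integral>x. p x * (u x - av x)\<^sup>2 \<partial>lebd d)" by (rule integral_target) measurable
    also have "\<dots> \<le> (\<integral>x. 27 / c0 * (\<integral>y. ?f x y \<partial>lebd d) \<partial>lebd d)"
    proof (rule integral_mono)
      show "integrable (lebd d) (\<lambda>x. p x * (u x - av x)\<^sup>2)"
        using dev_int by (simp add: integrable_target)
      fix x assume "x \<in> space (lebd d)"
      then have x: "x \<in> Rd d" by simp
      have "p x * (u x - av x)\<^sup>2 \<le> p x * ((\<integral>y. (u y - u x)\<^sup>2 * (A x y)\<^sup>2 \<partial>lebd d) / c0)"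
        using p_pos[OF x] by (intro mult_left_mono av_deviation x) simp
      also have "\<dots> \<le> 27 * (\<integral>y. ?f x y \<partial>lebd d) / c0"
        using divide_right_mono[OF local[OF x], of c0] c0_pos by simp
      finally show "p x * (u x - av x)\<^sup>2 \<le> 27 / c0 * (\<integral>y. ?f x y \<partial>lebd d)" by simp
    qed (use int_x in simp)
    finally show ?thesis using energy_eq by simp
  qed
  define m where "m = (\<integral>y. av y \<partial>target d p)"
  have av_int: "integrable (target d p) av"
    by (rule integrable_target_bounded[OF av_meas av_bound])
  have av2_int: "integrable (target d p) (\<lambda>x. (av x)\<^sup>2)"
  proof (rule integrable_target_bounded)
    show "\<bar>(av x)\<^sup>2\<bar> \<le> K\<^sup>2" if "x \<in> Rd d" for x
      using power_mono[OF av_bound[OF that], of 2] by simp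
  qed measurable
  have avm_int: "integrable (target d p) (\<lambda>x. (av x - m)\<^sup>2)"
    using av_int av2_int by (simp add: power2_diff)
  have u_int: "integrable (target d p) u" by (rule integrable_target_bounded[OF u_meas u_bound])
  have "(\<integral>x. (av x - m)\<^sup>2 \<partial>target d p) \<le> C * (36 / (c0\<^sup>2 * \<sigma>\<^sup>2)) * (\<integral>x. lvar x \<partial>target d p)"
    unfolding m_def by (rule variance_av[OF PI C])
  also have "\<dots> \<le> C * (36 / (c0\<^sup>2 * \<sigma>\<^sup>2)) * (27 * energy u)"
    using lvar_le C by (intro mult_left_mono) auto
  finally have avm: "(\<integral>x. (av x - m)\<^sup>2 \<partial>target d p) \<le> \<dots>" .
  have "(\<integral>x. (u x - (\<integral>y. u y \<partial>target d p))\<^sup>2 \<partial>target d p) \<le> (\<integral>x. (u x - m)\<^sup>2 \<partial>target d p)"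
    by (rule variance_le_deviation[OF u_int u_sq_int])
  also have "\<dots> \<le> (\<integral>x. 2 * (u x - av x)\<^sup>2 + 2 * (av x - m)\<^sup>2 \<partial>target d p)"
  proof (rule integral_mono)
    show "integrable (target d p) (\<lambda>x. (u x - m)\<^sup>2)" using u_int u_sq_int by (simp add: power2_diff)
    show "integrable (target d p) (\<lambda>x. 2 * (u x - av x)\<^sup>2 + 2 * (av x - m)\<^sup>2)" using dev_int avm_int by simp
    fix x
    have "0 \<le> ((u x - av x) - (av x - m))\<^sup>2" by simp
    then show "(u x - m)\<^sup>2 \<le> 2 * (u x - av x)\<^sup>2 + 2 * (av x - m)\<^sup>2"
      by (simp add: power2_eq_square algebra_simps)
  qed
  also have "\<dots> = 2 * (\<integral>x. (u x - av x)\<^sup>2 \<partial>target d p) + 2 * (\<integral>x. (av x - m)\<^sup>2 \<partial>target d p)"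
    using dev_int avm_int by simp
  also have "\<dots> \<le> 2 * (27 / c0 * energy u) + 2 * (C * (36 / (c0\<^sup>2 * \<sigma>\<^sup>2)) * (27 * energy u))"
    using dev_le avm by simp
  also have "\<dots> = (54 / c0 + 54 * 36 * C / (c0\<^sup>2 * \<sigma>\<^sup>2)) * energy u"
    by (simp add: algebra_simps)
  finally show ?thesis .
qed

end

section \<open>A Gaussian kernel cut off to a half-space\<close>

definition clamp01 :: "real \<Rightarrow> real" where
  "clamp01 r = max 0 (min 1 r)"

lemma clamp01_bounds: "0 \<le> clamp01 r" "clamp01 r \<le> 1" "(clamp01 r)\<^sup>2 \<le> 1"
  by (auto simp: clamp01_def power_le_one)

lemma clamp01_Lipschitz: "\<bar>clamp01 r - clamp01 s\<bar> \<le> \<bar>r - s\<bar>"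
  by (auto simp: clamp01_def)

lemma clamp01_mono: "r \<le> s \<Longrightarrow> clamp01 r \<le> clamp01 s"
  by (auto simp: clamp01_def)

lemma clamp01_meas [measurable]: "clamp01 \<in> borel_measurable borel"
  unfolding clamp01_def[abs_def] by measurable

text \<open>The offset \<open>1 / (1 + \<sigma> |F|)\<close> makes the cut-off vanish exactly where \<open>F x \<bullet> (y - x) \<le> -1\<close>.\<close>

definition halfspace_kernel ::
  "nat \<Rightarrow> real \<Rightarrow> ((nat \<Rightarrow> real) \<Rightarrow> nat \<Rightarrow> real) \<Rightarrow> (nat \<Rightarrow> real) \<Rightarrow> (nat \<Rightarrow> real) \<Rightarrow> real" where
  "halfspace_kernel d \<sigma> F x y = sqrt (gauss_prop d \<sigma> x y) *
     clamp01 ((1 + dotd d (F x) (\<lambda>i. y i - x i)) / (1 + \<sigma> * dnorm d (F x)))"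

lemma halfspace_kernel_sq_le: "(halfspace_kernel d \<sigma> F x y)\<^sup>2 \<le> gauss_prop d \<sigma> x y"
  using mult_left_mono[OF clamp01_bounds(3), of "gauss_prop d \<sigma> x y"]
  by (simp add: halfspace_kernel_def power_mult_distrib)

lemma halfspace_kernel_meas:
  assumes x: "x \<in> Rd d"
  shows "halfspace_kernel d \<sigma> F x \<in> borel_measurable (lebd d)"
proof -
  have [measurable]: "x \<in> space (lebd d)" using x by simp
  have [measurable]: "(\<lambda>y. dotd d (F x) (\<lambda>i. y i - x i)) \<in> borel_measurable (lebd d)"
    by (intro measurable_dotd) measurable
  show ?thesis unfolding halfspace_kernel_def[abs_def] by measurable
qed

lemma halfspace_kernel_int:
  assumes \<sigma>: "0 < \<sigma>" and x: "x \<in> Rd d"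
  shows "integrable (lebd d) (\<lambda>y. (halfspace_kernel d \<sigma> F x y)\<^sup>2)"
    and "(\<integral>y. (halfspace_kernel d \<sigma> F x y)\<^sup>2 \<partial>lebd d) \<le> 1"
proof -
  note [measurable] = halfspace_kernel_meas[OF x]
  have g: "integrable (lebd d) (\<lambda>y. gauss_prop d \<sigma> x y)" "(\<integral>y. gauss_prop d \<sigma> x y \<partial>lebd d) = 1"
    using has_gauss_total[OF \<sigma>, of d x] by (auto simp: has_bochner_integral_iff)
  show i: "integrable (lebd d) (\<lambda>y. (halfspace_kernel d \<sigma> F x y)\<^sup>2)"
    by (rule Bochner_Integration.integrable_bound[OF g(1)]) (auto simp: halfspace_kernel_sq_le)
  have "(\<integral>y. (halfspace_kernel d \<sigma> F x y)\<^sup>2 \<partial>lebd d) \<le> (\<integral>y. gauss_prop d \<sigma> x y \<partial>lebd d)"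
    by (intro integral_mono i g halfspace_kernel_sq_le)
  then show "(\<integral>y. (halfspace_kernel d \<sigma> F x y)\<^sup>2 \<partial>lebd d) \<le> 1" using g by simp
qed

text \<open>A vanishing vector gets an arbitrary unit direction, which exists because d \<ge> 1; the
  mass estimate then has no separate case for a zero gradient.\<close>

lemma unit_direction:
  assumes "1 \<le> d"
  obtains e where "dnorm d e = 1" "\<And>i. i < d \<Longrightarrow> v i = dnorm d v * e i"
proof (cases "dnorm d v = 0")
  case True
  define e :: "nat \<Rightarrow> real" where "e i = (if i = 0 then 1 else 0)" for i
  have "dnorm d e = 1" using assms by (simp add: dnorm_def e_def if_distrib[of "\<lambda>t. t\<^sup>2"] cong: if_cong)
  moreover have "v i = dnorm d v * e i" if "i < d" for i
    using coord_le_dnorm[OF that, of v] True by simp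
  ultimately show thesis by (rule that)
next
  case False
  define e where "e i = (1 / dnorm d v) * v i" for i
  have "dnorm d e = 1" unfolding e_def[abs_def] dnorm_scale using False by simp
  moreover have "v i = dnorm d v * e i" if "i < d" for i using False by (simp add: e_def)
  ultimately show thesis by (rule that)
qed

text \<open>Tilting: with \<open>x' = x + \<sigma> e\<close> the first two moments of \<open>\<zeta> = e \<bullet> (y - x) / \<sigma>\<close> under \<open>N(x', \<sigma>\<^sup>2 I)\<close>
  bound the integral of \<open>clamp01 \<zeta> \<ge> \<zeta> - \<zeta>\<^sup>2 / 4\<close> from below, and Cauchy-Schwarz
  transfers the bound to \<open>N(x, \<sigma>\<^sup>2 I)\<close>.\<close>

lemma gauss_clamp_mass:
  assumes \<sigma>: "0 < \<sigma>" and x: "x \<in> Rd d" and e: "dnorm d e = 1"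
  shows "1 / 12 \<le> (\<integral>y. gauss_prop d \<sigma> x y * (clamp01 (dotd d e (\<lambda>i. y i - x i) / \<sigma>))\<^sup>2 \<partial>lebd d)"
proof -
  define x' where "x' = (\<lambda>i\<in>{..<d}. x i + \<sigma> * e i)"
  define x'' where "x'' = (\<lambda>i. 2 * x' i - x i)"
  have x': "x' \<in> Rd d" by (simp add: x'_def)
  have [measurable]: "x \<in> space (lebd d)" "x' \<in> space (lebd d)" using x x' by auto
  define w where "w y = clamp01 (dotd d e (\<lambda>i. y i - x i) / \<sigma>)" for y
  have mD[measurable]: "(\<lambda>y. dotd d e (\<lambda>i. y i - x i)) \<in> borel_measurable (lebd d)"
    by (intro measurable_dotd) measurable
  have w_meas[measurable]: "w \<in> borel_measurable (lebd d)"
    unfolding w_def[abs_def] by measurable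
  have wb: "\<bar>w y\<bar> \<le> 1" "\<bar>(w y)\<^sup>2\<bar> \<le> 1" for y using clamp01_bounds by (auto simp: w_def)
  let ?g = "\<lambda>y. gauss_prop d \<sigma> x y" and ?g' = "\<lambda>y. gauss_prop d \<sigma> x' y"
  let ?Y = "\<lambda>y. dotd d e (\<lambda>i. y i - x' i)"
  have dx: "ddist d x' x = \<sigma>"
    unfolding x'_def ddist_translate dnorm_scale using \<sigma> e by simp
  have refl: "?g' y * ?g' y = ?g y * (gauss_prop d \<sigma> x'' y * exp 1)" for y
    using gauss_reflect[OF \<sigma>, of d x' y x] \<sigma> by (simp add: dx x''_def power2_eq_square)
  have ratio: "(?g' y / sqrt (?g y))\<^sup>2 = gauss_prop d \<sigma> x'' y * exp 1" for y
    using refl[of y] gauss_prop_pos[OF \<sigma>, of d x y]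
    by (simp add: power_divide power2_eq_square[of "?g' y"])
  have hb: "has_bochner_integral (lebd d) (\<lambda>y. gauss_prop d \<sigma> x'' y * exp 1) (1 * exp 1)"
    by (intro has_bochner_integral_mult_left has_gauss_total \<sigma>)
  have sq2: "(sqrt (?g y) * w y)\<^sup>2 = ?g y * (w y)\<^sup>2" for y by (simp add: power_mult_distrib)
  have gw2: "integrable (lebd d) (\<lambda>y. ?g y * (w y)\<^sup>2)"
    using integrable_gauss_bounded[OF \<sigma> _ x wb(2)] by simp
  have prod_eq: "?g' y / sqrt (?g y) * (sqrt (?g y) * w y) = ?g' y * w y" for y
    using gauss_prop_pos[OF \<sigma>, of d x y] by simp
  have CS: "(\<integral>y. ?g' y * w y \<partial>lebd d)\<^sup>2 \<le> exp 1 * (\<integral>y. ?g y * (w y)\<^sup>2 \<partial>lebd d)"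
    using Cauchy_Schwarz_integral[of "\<lambda>y. ?g' y / sqrt (?g y)" "lebd d" "\<lambda>y. sqrt (?g y) * w y"] hb gw2
    unfolding ratio sq2 prod_eq has_bochner_integral_iff by simp
  have lower: "?g' y * (3 / 4) + 1 / (2 * \<sigma>) * (?g' y * ?Y y) - 1 / (4 * \<sigma>\<^sup>2) * (?g' y * (?Y y)\<^sup>2) \<le> ?g' y * w y" for y
  proof -
    define \<zeta> where "\<zeta> = dotd d e (\<lambda>i. y i - x i) / \<sigma>"
    have "dotd d e (\<lambda>i. x' i - x i) = dotd d e (\<lambda>i. \<sigma> * e i)"
      unfolding dotd_def by (intro sum.cong) (auto simp: x'_def)
    also have "\<dots> = \<sigma>" unfolding dotd_scale_right dotd_self e by simp
    finally have "dotd d e (\<lambda>i. y i - x i) = ?Y y + \<sigma>"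
      using dotd_add_right[of d e "\<lambda>i. y i - x' i" "\<lambda>i. x' i - x i"] by simp
    then have \<zeta>: "\<zeta> = ?Y y / \<sigma> + 1" using \<sigma> by (simp add: \<zeta>_def field_simps)
    \<comment> \<open>The parabola is 1 - (\<zeta>/2 - 1)^2: it touches the identity at 0 and the
      constant 1 at 2, and two moments integrate it exactly.\<close>
    have "\<zeta> - \<zeta>\<^sup>2 / 4 \<le> clamp01 \<zeta>"
    proof -
      have "0 \<le> (\<zeta> / 2 - 1)\<^sup>2" by simp
      then have "\<zeta> - \<zeta>\<^sup>2 / 4 \<le> 1" by (simp add: power2_eq_square algebra_simps)
      moreover have "\<zeta> - \<zeta>\<^sup>2 / 4 \<le> \<zeta>" by simp
      ultimately have "\<zeta> - \<zeta>\<^sup>2 / 4 \<le> min 1 \<zeta>" by (rule min.boundedI)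
      then show ?thesis unfolding clamp01_def by (rule max.coboundedI2)
    qed
    then have "?g' y * (\<zeta> - \<zeta>\<^sup>2 / 4) \<le> ?g' y * w y"
      unfolding w_def \<zeta>_def[symmetric] by (intro mult_left_mono) auto
    moreover have "\<zeta> - \<zeta>\<^sup>2 / 4 = 3 / 4 + ?Y y / (2 * \<sigma>) - (?Y y)\<^sup>2 / (4 * \<sigma>\<^sup>2)"
      unfolding \<zeta> using \<sigma> by (simp add: power2_eq_square field_simps)
    ultimately show ?thesis by (simp add: algebra_simps)
  qed
  \<comment> \<open>Under the tilted Gaussian, \<zeta> - 1 has mean 0 and variance 1, so the
    expectation is 3/4 + 0 - 1/4 = 1/2.\<close>
  have low: "has_bochner_integral (lebd d)
      (\<lambda>y. ?g' y * (3 / 4) + 1 / (2 * \<sigma>) * (?g' y * ?Y y) - 1 / (4 * \<sigma>\<^sup>2) * (?g' y * (?Y y)\<^sup>2))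
      (1 * (3 / 4) + 1 / (2 * \<sigma>) * 0 - 1 / (4 * \<sigma>\<^sup>2) * (\<sigma>\<^sup>2 * (dnorm d e)\<^sup>2))"
    by (intro has_bochner_integral_add has_bochner_integral_diff has_bochner_integral_mult_right
        has_bochner_integral_mult_left has_gauss_total has_gauss_dotd has_gauss_dotd_sq \<sigma>)
  have "1 / 2 \<le> (\<integral>y. ?g' y * w y \<partial>lebd d)"
  proof -
    have "1 / 2 = (\<integral>y. ?g' y * (3 / 4) + 1 / (2 * \<sigma>) * (?g' y * ?Y y) - 1 / (4 * \<sigma>\<^sup>2) * (?g' y * (?Y y)\<^sup>2) \<partial>lebd d)"
      using has_bochner_integral_integral_eq[OF low] \<sigma> e by simp
    also have "\<dots> \<le> (\<integral>y. ?g' y * w y \<partial>lebd d)"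
      using low integrable_gauss_bounded[OF \<sigma> w_meas x' wb(1)] lower
      by (intro integral_mono) (auto simp only: has_bochner_integral_iff)
    finally show ?thesis .
  qed
  \<comment> \<open>The constant is (1/2)^2 / 3 = 1/12, where 3 bounds the second moment exp 1 of
    the likelihood ratio.\<close>
  then have "(1 / 2)\<^sup>2 \<le> (\<integral>y. ?g' y * w y \<partial>lebd d)\<^sup>2" by (intro power_mono) auto
  also note CS
  also have "exp 1 * (\<integral>y. ?g y * (w y)\<^sup>2 \<partial>lebd d) \<le> 3 * (\<integral>y. ?g y * (w y)\<^sup>2 \<partial>lebd d)"
    using exp_le by (intro mult_right_mono integral_nonneg_AE AE_I2) auto
  finally show ?thesis by (simp add: w_def power2_eq_square)
qed

text \<open>With b = \<sigma> |F x| the cut-off argument is (1 + b \<zeta>) / (1 + b), a weighted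
  mean of 1 and \<zeta>, hence at least their minimum. So \<open>gauss_clamp_mass\<close> applies
  uniformly in the size of the gradient.\<close>

lemma halfspace_kernel_mass:
  assumes \<sigma>: "0 < \<sigma>" and x: "x \<in> Rd d" and d: "1 \<le> d"
  shows "1 / 12 \<le> (\<integral>y. (halfspace_kernel d \<sigma> F x y)\<^sup>2 \<partial>lebd d)"
proof -
  obtain e where e: "dnorm d e = 1" and Fe: "\<And>i. i < d \<Longrightarrow> F x i = dnorm d (F x) * e i"
    using unit_direction[OF d, of "F x"] by blast
  define b where "b = \<sigma> * dnorm d (F x)"
  have b: "0 \<le> b" using \<sigma> by (simp add: b_def)
  have [measurable]: "x \<in> space (lebd d)" using x by simp
  have mD[measurable]: "(\<lambda>y. dotd d e (\<lambda>i. y i - x i)) \<in> borel_measurable (lebd d)"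
    by (intro measurable_dotd) measurable
  have le: "gauss_prop d \<sigma> x y * (clamp01 (dotd d e (\<lambda>i. y i - x i) / \<sigma>))\<^sup>2 \<le> (halfspace_kernel d \<sigma> F x y)\<^sup>2" for y
  proof -
    define \<zeta> where "\<zeta> = dotd d e (\<lambda>i. y i - x i) / \<sigma>"
    have "dotd d (F x) (\<lambda>i. y i - x i) = dotd d (\<lambda>i. dnorm d (F x) * e i) (\<lambda>i. y i - x i)"
      unfolding dotd_def using Fe by (intro sum.cong) auto
    also have "\<dots> = b * \<zeta>" unfolding dotd_scale_left using \<sigma> by (simp add: b_def \<zeta>_def)
    finally have F: "dotd d (F x) (\<lambda>i. y i - x i) = b * \<zeta>" .
    have "clamp01 \<zeta> \<le> clamp01 ((1 + b * \<zeta>) / (1 + b))"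
    proof (cases "\<zeta> \<le> 1")
      case True
      then have "\<zeta> \<le> (1 + b * \<zeta>) / (1 + b)" using b by (simp add: pos_le_divide_eq algebra_simps)
      then show ?thesis by (rule clamp01_mono)
    next
      case False
      then have "b \<le> b * \<zeta>" using b by (simp add: mult_le_cancel_left1)
      then have "1 \<le> (1 + b * \<zeta>) / (1 + b)" using b by (simp add: pos_le_divide_eq)
      then show ?thesis using clamp01_bounds(2)[of \<zeta>] by (simp add: clamp01_def)
    qed
    then have "(clamp01 \<zeta>)\<^sup>2 \<le> (clamp01 ((1 + b * \<zeta>) / (1 + b)))\<^sup>2"
      by (intro power_mono clamp01_bounds)
    then show ?thesis
      unfolding halfspace_kernel_def power_mult_distrib F b_def[symmetric] \<zeta>_def[symmetric]
      by (simp add: mult_left_mono)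
  qed
  have "integrable (lebd d) (\<lambda>y. gauss_prop d \<sigma> x y * (clamp01 (dotd d e (\<lambda>i. y i - x i) / \<sigma>))\<^sup>2)"
    by (rule integrable_gauss_bounded[OF \<sigma> _ x, of _ 1]) (measurable, simp add: clamp01_bounds)
  then have "(\<integral>y. gauss_prop d \<sigma> x y * (clamp01 (dotd d e (\<lambda>i. y i - x i) / \<sigma>))\<^sup>2 \<partial>lebd d)
      \<le> (\<integral>y. (halfspace_kernel d \<sigma> F x y)\<^sup>2 \<partial>lebd d)"
    using halfspace_kernel_int(1)[OF \<sigma> x] le by (intro integral_mono) auto
  with gauss_clamp_mass[OF \<sigma> x e] show ?thesis by linarith
qed

text \<open>The change splits into that of the square-root Gaussian, covered by
  \<open>gauss_Hellinger\<close>, and that of the cut-off argument. Normalising by \<open>B\<close>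
  keeps the normal vector \<open>n\<close> no longer than 1/\<sigma>, and the condition on
  \<open>M\<close> gives \<sigma> |n x' - n x| \<le> r / (2 \<sigma>), however long the gradients
  are.\<close>

lemma halfspace_kernel_diff:
  assumes \<sigma>: "0 < \<sigma>" and x: "x \<in> Rd d" and x': "x' \<in> Rd d"
    and M: "ddist d (F x') (F x) \<le> M * ddist d x' x" and M\<sigma>: "M * \<sigma>\<^sup>2 \<le> 1 / 4"
  shows "(\<integral>y. (halfspace_kernel d \<sigma> F x' y - halfspace_kernel d \<sigma> F x y)\<^sup>2 \<partial>lebd d) \<le> (3 * ddist d x' x / \<sigma>)\<^sup>2"
proof -
  define r where "r = ddist d x' x"
  define D where "D = ddist d (F x') (F x)"
  have r0: "0 \<le> r" and D0: "0 \<le> D" by (auto simp: r_def D_def)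
  have D_le: "\<sigma> * D \<le> r / (4 * \<sigma>)"
  proof -
    have "\<sigma>\<^sup>2 * D \<le> \<sigma>\<^sup>2 * (M * r)" using M by (intro mult_left_mono) (auto simp: D_def r_def)
    also have "\<dots> \<le> r / 4" using mult_right_mono[OF M\<sigma> r0] by (simp add: mult_ac)
    finally show ?thesis using \<sigma> by (simp add: field_simps power2_eq_square)
  qed
  define B where "B z = 1 + \<sigma> * dnorm d (F z)" for z
  define n where "n z = (\<lambda>i. (1 / B z) * F z i)" for z
  have B1: "1 \<le> B z" for z using \<sigma> by (simp add: B_def)
  have bounded: "\<sigma> * dnorm d (F z) / B z \<le> 1" for z
    using B1[of z] by (subst pos_divide_le_eq) (auto simp: B_def)
  have n_le: "dnorm d (n z) \<le> 1 / \<sigma>" for z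
    unfolding n_def dnorm_scale using \<sigma> B1[of z] bounded[of z] by (simp add: field_simps)
  have B_diff: "\<bar>B x' - B x\<bar> \<le> \<sigma> * D"
    using dnorm_triangle_diff[of d "F x'" "F x"] \<sigma>
    by (simp add: B_def D_def right_diff_distrib[symmetric] abs_mult)
  have inv_diff: "\<bar>1 / B x' - 1 / B x\<bar> \<le> \<sigma> * D / B x"
  proof -
    have "1 / B x' - 1 / B x = - ((B x' - B x) / (B x' * B x))"
      using B1[of x] B1[of x'] by (simp add: field_simps)
    then have "\<bar>1 / B x' - 1 / B x\<bar> = \<bar>B x' - B x\<bar> / (B x' * B x)"
      using B1[of x] B1[of x'] by (simp add: abs_mult)
    also have "\<dots> \<le> (\<sigma> * D) / (1 * B x)"
      using B1[of x] B1[of x'] B_diff by (intro frac_le mult_right_mono) (auto simp: \<sigma> D0 less_imp_le)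
    finally show ?thesis by simp
  qed
  have n_diff: "\<sigma> * dnorm d (\<lambda>i. n x' i - n x i) \<le> r / (2 * \<sigma>)"
  proof -
    have "(\<lambda>i. n x' i - n x i) = (\<lambda>i. (1 / B x') * (F x' i - F x i) + (1 / B x' - 1 / B x) * F x i)"
      by (simp add: n_def algebra_simps)
    then have "dnorm d (\<lambda>i. n x' i - n x i) \<le> \<bar>1 / B x'\<bar> * D + \<bar>1 / B x' - 1 / B x\<bar> * dnorm d (F x)"
      using dnorm_triangle[of d "\<lambda>i. (1 / B x') * (F x' i - F x i)" "\<lambda>i. (1 / B x' - 1 / B x) * F x i"]
      by (simp only: dnorm_scale D_def ddist_eq_dnorm)
    also have "\<dots> \<le> 1 * D + \<sigma> * D / B x * dnorm d (F x)"
      using B1[of x'] inv_diff by (intro add_mono mult_right_mono D0) auto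
    also have "\<dots> \<le> D + D"
    proof -
      from mult_left_mono[OF bounded[of x] D0] show ?thesis by (simp add: mult_ac)
    qed
    finally have "\<sigma> * dnorm d (\<lambda>i. n x' i - n x i) \<le> \<sigma> * (2 * D)" using \<sigma> by simp
    also have "\<dots> \<le> r / (2 * \<sigma>)" using D_le by simp
    finally show ?thesis .
  qed
  \<comment> \<open>The difference of the cut-off arguments is affine in \<open>y\<close>; expanded
    at \<open>x'\<close>, it is \<open>c\<close> plus a linear part of mean zero under the Gaussian
    at \<open>x'\<close>. In the bound 5/4 on \<open>c\<close>, 1 comes from moving the base point
    and 1/4 from the change of \<open>1 / B\<close>.\<close>
  define c where "c = (1 / B x' - 1 / B x) - dotd d (n x) (\<lambda>i. x' i - x i)"
  have c_le: "\<bar>c\<bar> \<le> 5 / 4 * (r / \<sigma>)"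
  proof -
    have "\<bar>dotd d (n x) (\<lambda>i. x' i - x i)\<bar> \<le> dnorm d (n x) * r"
      using dotd_le[of d "n x"] by (simp add: r_def ddist_eq_dnorm)
    also have "\<dots> \<le> 1 / \<sigma> * r" using n_le r0 by (intro mult_right_mono)
    finally have "\<bar>dotd d (n x) (\<lambda>i. x' i - x i)\<bar> \<le> r / \<sigma>" by simp
    moreover have "\<sigma> * D / B x \<le> \<sigma> * D"
      using B1[of x] D0 \<sigma> mult_left_mono[OF B1[of x], of "\<sigma> * D"] by (simp add: pos_divide_le_eq)
    moreover have "r / (4 * \<sigma>) = (r / \<sigma>) / 4" by simp
    ultimately show ?thesis using inv_diff D_le unfolding c_def by linarith
  qed
  define \<psi> where "\<psi> z y = (1 + dotd d (F z) (\<lambda>i. y i - z i)) / B z" for z y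
  let ?Y = "\<lambda>y. dotd d (\<lambda>i. n x' i - n x i) (\<lambda>i. y i - x' i)"
  have \<psi>_diff: "\<psi> x' y - \<psi> x y = c + ?Y y" for y
  proof -
    have \<psi>_n: "\<psi> z y = 1 / B z + dotd d (n z) (\<lambda>i. y i - z i)" for z
      unfolding n_def dotd_scale_left by (simp add: \<psi>_def add_divide_distrib)
    have "dotd d (n x) (\<lambda>i. y i - x i) = dotd d (n x) (\<lambda>i. y i - x' i) + dotd d (n x) (\<lambda>i. x' i - x i)"
      using dotd_add_right[of d "n x" "\<lambda>i. y i - x' i" "\<lambda>i. x' i - x i"] by simp
    then show ?thesis unfolding \<psi>_n dotd_diff_left c_def by simp
  qed
  let ?g = "\<lambda>y. gauss_prop d \<sigma> x y" and ?g' = "\<lambda>y. gauss_prop d \<sigma> x' y"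
  have kernel: "halfspace_kernel d \<sigma> F z y = sqrt (gauss_prop d \<sigma> z y) * clamp01 (\<psi> z y)" for z y
    by (simp add: halfspace_kernel_def \<psi>_def B_def)
  \<comment> \<open>\<open>P\<close> carries the change of the Gaussian, under a cut-off of at most
    1; \<open>Q\<close> carries the change of the cut-off, which the 1-Lipschitz
    \<open>clamp01\<close> reduces to the affine difference.\<close>
  have pw: "(halfspace_kernel d \<sigma> F x' y - halfspace_kernel d \<sigma> F x y)\<^sup>2
      \<le> 2 * (sqrt (?g' y) - sqrt (?g y))\<^sup>2
        + 2 * (?g' y * c\<^sup>2 + (2 * c) * (?g' y * ?Y y) + ?g' y * (?Y y)\<^sup>2)" for y
  proof -
    define P where "P = (sqrt (?g' y) - sqrt (?g y)) * clamp01 (\<psi> x y)"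
    define Q where "Q = sqrt (?g' y) * (clamp01 (\<psi> x' y) - clamp01 (\<psi> x y))"
    have "halfspace_kernel d \<sigma> F x' y - halfspace_kernel d \<sigma> F x y = P + Q"
      by (simp add: kernel P_def Q_def algebra_simps)
    moreover have "(P + Q)\<^sup>2 \<le> 2 * P\<^sup>2 + 2 * Q\<^sup>2"
      using sum_squares_bound[of P Q] by (simp add: power2_sum)
    moreover have "P\<^sup>2 \<le> (sqrt (?g' y) - sqrt (?g y))\<^sup>2"
      using mult_left_mono[OF clamp01_bounds(3), of "(sqrt (?g' y) - sqrt (?g y))\<^sup>2" "\<psi> x y"]
      by (simp add: P_def power_mult_distrib)
    moreover have "Q\<^sup>2 \<le> ?g' y * (c + ?Y y)\<^sup>2"
    proof -
      have "(clamp01 (\<psi> x' y) - clamp01 (\<psi> x y))\<^sup>2 \<le> (c + ?Y y)\<^sup>2"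
        using clamp01_Lipschitz[of "\<psi> x' y" "\<psi> x y"] unfolding \<psi>_diff by (simp add: abs_le_square_iff)
      then show ?thesis by (simp add: Q_def power_mult_distrib mult_left_mono)
    qed
    ultimately show ?thesis by (simp add: power2_sum algebra_simps)
  qed
  have hb: "has_bochner_integral (lebd d) (\<lambda>y. 2 * (?g' y * c\<^sup>2 + (2 * c) * (?g' y * ?Y y) + ?g' y * (?Y y)\<^sup>2))
      (2 * (1 * c\<^sup>2 + (2 * c) * 0 + \<sigma>\<^sup>2 * (dnorm d (\<lambda>i. n x' i - n x i))\<^sup>2))"
    by (intro has_bochner_integral_add has_bochner_integral_mult_right
        has_bochner_integral_mult_left has_gauss_total has_gauss_dotd has_gauss_dotd_sq \<sigma>)
  note H = gauss_Hellinger[OF \<sigma>, of d x' x]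
  note total = has_bochner_integral_add[OF has_bochner_integral_integrable[OF integrable_mult_right[OF H(1), of 2]] hb]
  have int: "integrable (lebd d) (\<lambda>y. 2 * (sqrt (?g' y) - sqrt (?g y))\<^sup>2
        + 2 * (?g' y * c\<^sup>2 + (2 * c) * (?g' y * ?Y y) + ?g' y * (?Y y)\<^sup>2))"
    using total by (rule integrable.intros)
  note [measurable] = halfspace_kernel_meas[OF x] halfspace_kernel_meas[OF x']
  have "integrable (lebd d) (\<lambda>y. (halfspace_kernel d \<sigma> F x' y - halfspace_kernel d \<sigma> F x y)\<^sup>2)"
    by (rule Bochner_Integration.integrable_bound[OF int]) (use pw in \<open>auto intro: order_trans[OF _ abs_ge_self]\<close>)
  then have "(\<integral>y. (halfspace_kernel d \<sigma> F x' y - halfspace_kernel d \<sigma> F x y)\<^sup>2 \<partial>lebd d)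
     \<le> (\<integral>y. 2 * (sqrt (?g' y) - sqrt (?g y))\<^sup>2
        + 2 * (?g' y * c\<^sup>2 + (2 * c) * (?g' y * ?Y y) + ?g' y * (?Y y)\<^sup>2) \<partial>lebd d)"
    using int pw by (intro integral_mono)
  also have "\<dots> = (\<integral>y. 2 * (sqrt (?g' y) - sqrt (?g y))\<^sup>2 \<partial>lebd d)
      + 2 * (1 * c\<^sup>2 + (2 * c) * 0 + \<sigma>\<^sup>2 * (dnorm d (\<lambda>i. n x' i - n x i))\<^sup>2)"
    using total by (rule has_bochner_integral_integral_eq)
  also have "\<dots> \<le> 2 * (r\<^sup>2 / (4 * \<sigma>\<^sup>2)) + 2 * ((5 / 4 * (r / \<sigma>))\<^sup>2 + (r / (2 * \<sigma>))\<^sup>2)"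
  proof -
    have "c\<^sup>2 \<le> (5 / 4 * (r / \<sigma>))\<^sup>2" using power_mono[OF c_le, of 2] by simp
    moreover have "(\<sigma> * dnorm d (\<lambda>i. n x' i - n x i))\<^sup>2 \<le> (r / (2 * \<sigma>))\<^sup>2"
      using n_diff \<sigma> by (intro power_mono) auto
    ultimately show ?thesis using H(2) by (simp add: power_mult_distrib r_def)
  qed
  \<comment> \<open>The left side equals 33/8 times (r / \<sigma>)^2.\<close>
  also have "\<dots> \<le> (3 * r / \<sigma>)\<^sup>2"
    using \<sigma> by (simp add: power_mult_distrib power_divide field_simps)
  finally show ?thesis by (simp add: r_def)
qed

text \<open>The mean value theorem on the segment compares the gradient at one intermediate point
  with that at \<open>x\<close>; this gives the constant \<open>M\<close> where integration along
  the segment would give M/2.\<close>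

lemma gradient_lower_bound:
  assumes x: "x \<in> Rd d" and y: "y \<in> Rd d"
    and grad: "\<And>z. z \<in> Rd d \<Longrightarrow> has_grad_at d f (F z) z"
    and lip: "\<And>z. z \<in> Rd d \<Longrightarrow> ddist d (F z) (F x) \<le> M * ddist d z x" and M: "0 \<le> M"
  shows "f x + dotd d (F x) (\<lambda>i. y i - x i) - M * (ddist d y x)\<^sup>2 \<le> f y"
proof -
  define \<rho> where "\<rho> = ddist d y x"
  have \<rho>0: "0 \<le> \<rho>" by (simp add: \<rho>_def)
  define \<gamma> where "\<gamma> t = (\<lambda>i\<in>{..<d}. x i + t * (y i - x i))" for t
  have \<gamma>_in: "\<gamma> t \<in> Rd d" for t by (simp add: \<gamma>_def)
  have \<gamma>_dist: "ddist d (\<gamma> s) (\<gamma> t) = \<bar>s - t\<bar> * \<rho>" for s t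
  proof -
    have "ddist d (\<gamma> s) (\<gamma> t) = dnorm d (\<lambda>i. (s - t) * (y i - x i))"
      unfolding ddist_def dnorm_def by (intro arg_cong[of _ _ sqrt] sum.cong) (auto simp: \<gamma>_def algebra_simps)
    then show ?thesis by (simp add: dnorm_scale \<rho>_def ddist_eq_dnorm)
  qed
  have \<gamma>01: "\<gamma> 0 = x" "\<gamma> 1 = y"
    using x y by (auto simp: \<gamma>_def Rd_def PiE_iff extensional_def restrict_def)
  have deriv: "DERIV (\<lambda>t. f (\<gamma> t)) t :> dotd d (F (\<gamma> t)) (\<lambda>i. y i - x i)" for t
    unfolding DERIV_def LIM_eq
  proof (intro allI impI)
    fix \<eta> :: real assume \<eta>: "0 < \<eta>"
    define \<epsilon> where "\<epsilon> = \<eta> / (2 * (\<rho> + 1))"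
    have \<epsilon>: "0 < \<epsilon>" using \<eta> \<rho>0 by (simp add: \<epsilon>_def)
    obtain \<delta> where \<delta>: "0 < \<delta>" and D: "\<And>z. z \<in> Rd d \<Longrightarrow> ddist d z (\<gamma> t) < \<delta> \<Longrightarrow>
        \<bar>f z - f (\<gamma> t) - (\<Sum>i<d. F (\<gamma> t) i * (z i - \<gamma> t i))\<bar> \<le> \<epsilon> * ddist d z (\<gamma> t)"
      using grad[OF \<gamma>_in, of t] \<epsilon> unfolding has_grad_at_def by blast
    show "\<exists>s>0. \<forall>k. k \<noteq> 0 \<and> norm (k - 0) < s \<longrightarrow>
       norm ((f (\<gamma> (t + k)) - f (\<gamma> t)) / k - dotd d (F (\<gamma> t)) (\<lambda>i. y i - x i)) < \<eta>"
    proof (intro exI[of _ "\<delta> / (\<rho> + 1)"] conjI allI impI)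
      show "0 < \<delta> / (\<rho> + 1)" using \<delta> \<rho>0 by simp
      fix k :: real assume k: "k \<noteq> 0 \<and> norm (k - 0) < \<delta> / (\<rho> + 1)"
      then have "\<bar>k\<bar> * \<rho> \<le> \<bar>k\<bar> * (\<rho> + 1)" "\<bar>k\<bar> * (\<rho> + 1) < \<delta>"
        using \<rho>0 by (auto simp: pos_less_divide_eq intro: mult_left_mono)
      then have "\<bar>f (\<gamma> (t + k)) - f (\<gamma> t) - (\<Sum>i<d. F (\<gamma> t) i * (\<gamma> (t + k) i - \<gamma> t i))\<bar> \<le> \<epsilon> * (\<bar>k\<bar> * \<rho>)"
        using D[OF \<gamma>_in, of "t + k"] by (simp add: \<gamma>_dist)
      also have "(\<Sum>i<d. F (\<gamma> t) i * (\<gamma> (t + k) i - \<gamma> t i)) = k * dotd d (F (\<gamma> t)) (\<lambda>i. y i - x i)"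
        unfolding dotd_def sum_distrib_left by (intro sum.cong) (auto simp: \<gamma>_def algebra_simps)
      finally have "\<bar>f (\<gamma> (t + k)) - f (\<gamma> t) - k * dotd d (F (\<gamma> t)) (\<lambda>i. y i - x i)\<bar> / \<bar>k\<bar> \<le> \<epsilon> * \<rho>"
        using k by (simp add: pos_divide_le_eq mult_ac)
      also have "\<bar>f (\<gamma> (t + k)) - f (\<gamma> t) - k * dotd d (F (\<gamma> t)) (\<lambda>i. y i - x i)\<bar> / \<bar>k\<bar>
         = \<bar>(f (\<gamma> (t + k)) - f (\<gamma> t)) / k - dotd d (F (\<gamma> t)) (\<lambda>i. y i - x i)\<bar>"
        using k by (subst abs_divide[symmetric]) (simp add: diff_divide_distrib)
      also have "\<epsilon> * \<rho> < \<eta>" using \<eta> \<rho>0 by (simp add: \<epsilon>_def field_simps add_nonneg_pos)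
      finally show "norm ((f (\<gamma> (t + k)) - f (\<gamma> t)) / k - dotd d (F (\<gamma> t)) (\<lambda>i. y i - x i)) < \<eta>" by simp
    qed
  qed
  have "\<exists>t::real>0. t < 1 \<and> f (\<gamma> 1) - f (\<gamma> 0) = (1 - 0) * dotd d (F (\<gamma> t)) (\<lambda>i. y i - x i)"
    by (rule MVT2[OF zero_less_one deriv])
  then obtain t where t: "0 < t" "t < 1"
    and ft: "f (\<gamma> 1) - f (\<gamma> 0) = (1 - 0) * dotd d (F (\<gamma> t)) (\<lambda>i. y i - x i)"
    by blast
  have "\<bar>dotd d (F (\<gamma> t)) (\<lambda>i. y i - x i) - dotd d (F x) (\<lambda>i. y i - x i)\<bar> \<le> ddist d (F (\<gamma> t)) (F x) * \<rho>"
    unfolding dotd_diff_left[symmetric] using dotd_le by (simp add: \<rho>_def ddist_eq_dnorm)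
  also have "\<dots> \<le> (M * (t * \<rho>)) * \<rho>"
    using lip[OF \<gamma>_in, of t] \<gamma>_dist[of t 0] t \<rho>0 \<gamma>01 by (intro mult_right_mono) auto
  also have "\<dots> \<le> M * \<rho>\<^sup>2"
  proof -
    have "t * (M * \<rho>\<^sup>2) \<le> 1 * (M * \<rho>\<^sup>2)" using t M by (intro mult_right_mono) auto
    then show ?thesis by (simp add: power2_eq_square mult_ac)
  qed
  finally show ?thesis using ft unfolding \<gamma>01 \<rho>_def by simp
qed

section \<open>The spectral gap\<close>

text \<open>The factor \<open>1 + 1 / d\<close> in \<open>1 / \<sigma>\<^sup>2\<close> turns the quadratic loss in the acceptance ratio into a
  change of Gaussian normalisation by at most \<open>exp (1 / 2)\<close>.\<close>

lemma gauss_prop_shrink: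
  assumes h: "0 < h" and d: "1 \<le> d"
  defines "\<sigma> \<equiv> h * sqrt (real d / (real d + 1))"
  shows "gauss_prop d \<sigma> x y \<le> exp (1 / 2) * (gauss_prop d h x y * exp (- (ddist d y x)\<^sup>2 / (2 * real d * h\<^sup>2)))"
proof -
  define q where "q = real d / (real d + 1)"
  have q: "0 < q" using d by (simp add: q_def)
  have \<sigma>2: "\<sigma>\<^sup>2 = h\<^sup>2 * q" using q by (simp add: \<sigma>_def q_def[symmetric] power_mult_distrib)
  have "(2 * pi * \<sigma>\<^sup>2) powr (- real d / 2) = (2 * pi * h\<^sup>2) powr (- real d / 2) * q powr (- real d / 2)"
    unfolding \<sigma>2 using q h by (simp add: powr_mult mult.assoc[symmetric])
  \<comment> \<open>Here 1/q = 1 + 1/d \<le> exp (1/d), and raising to the power d/2 gives exp (1/2)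
    in every dimension.\<close>
  moreover have "q powr (- real d / 2) \<le> exp (1 / 2)"
  proof -
    have "1 / q \<le> exp (1 / real d)"
      using exp_ge_add_one_self[of "1 / real d"] d by (simp add: q_def field_simps)
    then have "ln (1 / q) \<le> 1 / real d" using q ln_le_cancel_iff[of "1 / q" "exp (1 / real d)"] by simp
    then have "- real d / 2 * ln q \<le> 1 / 2" using q d by (simp add: ln_div field_simps)
    then show ?thesis using q by (simp add: powr_def)
  qed
  then have "q powr (- real d / 2) * ((2 * pi * h\<^sup>2) powr (- real d / 2) * exp (- (ddist d y x)\<^sup>2 / (2 * h\<^sup>2))
        * exp (- (ddist d y x)\<^sup>2 / (2 * real d * h\<^sup>2)))
      \<le> exp (1 / 2) * ((2 * pi * h\<^sup>2) powr (- real d / 2) * exp (- (ddist d y x)\<^sup>2 / (2 * h\<^sup>2))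
        * exp (- (ddist d y x)\<^sup>2 / (2 * real d * h\<^sup>2)))"
    by (rule mult_right_mono) simp
  moreover have "- (ddist d y x)\<^sup>2 / (2 * \<sigma>\<^sup>2) = - (ddist d y x)\<^sup>2 / (2 * h\<^sup>2) + - (ddist d y x)\<^sup>2 / (2 * real d * h\<^sup>2)"
    unfolding \<sigma>2 q_def using h d by (simp add: field_simps)
  ultimately show ?thesis
    unfolding gauss_prop_def by (simp only: exp_add mult_ac)
qed

text \<open>Inside the half-space the logarithmic loss is at most 1 + M \<rho>^2 + L \<rho>, and the
  step-size conditions bound it by 2 + E, with E the extra exponent of the shrunken Gaussian. So exp
  (-E) pays for the acceptance ratio; what remains is exp 2 times the normalisation loss exp (1/2),
  and exp (5/2) \<le> 27.\<close>

lemma halfspace_kernel_dominated: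
  assumes h: "0 < h" and d: "1 \<le> d"
    and step_M: "M * (real d * h\<^sup>2) \<le> 1 / 4" and step_L: "16 * L * sqrt (real d) * h \<le> 1"
    and x: "x \<in> Rd d" and y: "y \<in> Rd d" and px: "0 < p x" and py: "0 < p y"
    and log_p: "ln (p x) + dotd d (F x) (\<lambda>i. y i - x i) - M * (ddist d y x)\<^sup>2 - L * ddist d y x \<le> ln (p y)"
  defines "\<sigma> \<equiv> h * sqrt (real d / (real d + 1))"
  shows "p x * (halfspace_kernel d \<sigma> F x y)\<^sup>2 \<le> 27 * mker d p h x y"
proof (cases "dotd d (F x) (\<lambda>i. y i - x i) \<le> -1")
  case True
  have "0 < \<sigma>" using h d by (simp add: \<sigma>_def)
  then have "(1 + dotd d (F x) (\<lambda>i. y i - x i)) / (1 + \<sigma> * dnorm d (F x)) \<le> 0"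
    using True by (intro divide_nonpos_nonneg) auto
  then have "halfspace_kernel d \<sigma> F x y = 0" by (simp add: halfspace_kernel_def clamp01_def)
  then show ?thesis using px py by (simp add: mker_def)
next
  case False
  define \<rho> where "\<rho> = ddist d y x"
  define E where "E = \<rho>\<^sup>2 / (2 * real d * h\<^sup>2)"
  have \<rho>0: "0 \<le> \<rho>" by (simp add: \<rho>_def)
  define s where "s = sqrt (real d) * h"
  have s0: "0 < s" and s2: "s\<^sup>2 = real d * h\<^sup>2" using h d by (auto simp: s_def power_mult_distrib)
  have E_s: "E = \<rho>\<^sup>2 / s\<^sup>2 / 2" unfolding E_def s2 by simp
  have E0: "0 \<le> E" by (simp add: E_s)
  have quad: "M * \<rho>\<^sup>2 \<le> E / 2"
  proof -
    have "M \<le> 1 / (4 * s\<^sup>2)" using step_M s0 by (simp add: s2[symmetric] field_simps)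
    from mult_right_mono[OF this, of "\<rho>\<^sup>2"] show ?thesis by (simp add: E_s)
  qed
  have lin: "L * \<rho> \<le> 1 / 32 + E / 16"
  proof -
    have "L \<le> 1 / (16 * s)" using step_L s0 by (simp add: s_def field_simps)
    from mult_right_mono[OF this \<rho>0] have "L * \<rho> \<le> \<rho> / s / 16" by simp
    moreover have "2 * 1 * (\<rho> / s) \<le> 1\<^sup>2 + (\<rho> / s)\<^sup>2" by (rule sum_squares_bound)
    ultimately show ?thesis by (simp add: E_s power_divide)
  qed
  \<comment> \<open>The loss is at most 1 from the half-space, E/2 from \<open>quad\<close> and 1/32
    + E/16 from \<open>lin\<close>.\<close>
  have "ln (p x) - 2 - E \<le> ln (p y)"
    using log_p False quad lin E0 unfolding \<rho>_def[symmetric] by linarith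
  then have "exp (ln (p x) - 2 - E) \<le> exp (ln (p y))" by (rule iffD2[OF exp_le_cancel_iff])
  then have py_ge: "p x * exp (- 2 - E) \<le> p y"
    using px py by (simp add: exp_diff exp_minus field_simps exp_add)
  have "p x * exp (- 2 - E) \<le> p x" using px E0 by (simp add: mult_le_cancel_left1)
  with py_ge have min_ge: "p x * exp (- 2 - E) \<le> min (p x) (p y)" by simp
  have "(halfspace_kernel d \<sigma> F x y)\<^sup>2 \<le> exp (1 / 2) * (gauss_prop d h x y * exp (- E))"
    using order_trans[OF halfspace_kernel_sq_le gauss_prop_shrink[OF h d, of x y, folded \<sigma>_def]]
    by (simp add: E_def \<rho>_def)
  then have "p x * (halfspace_kernel d \<sigma> F x y)\<^sup>2 \<le> p x * (exp (1 / 2) * (gauss_prop d h x y * exp (- E)))"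
    using px by (intro mult_left_mono) auto
  also have "\<dots> = exp (5 / 2) * (p x * exp (- 2 - E)) * gauss_prop d h x y"
  proof -
    have "exp (1 / 2) * exp (- E) = exp (5 / 2) * exp (- 2 - E)" by (simp add: exp_add[symmetric])
    then show ?thesis by (simp add: mult_ac)
  qed
  also have "\<dots> \<le> 27 * min (p x) (p y) * gauss_prop d h x y"
  proof -
    have "exp (5 / 2) \<le> exp (3::real)" by simp
    also have "\<dots> = exp 1 ^ 3" by (simp add: exp_of_nat_mult[symmetric])
    also have "\<dots> \<le> 3 ^ 3" by (intro power_mono exp_le) simp
    finally have "exp (5 / 2) \<le> (27::real)" by simp
    then show ?thesis using min_ge px py by (intro mult_right_mono mult_mono) auto
  qed
  finally show ?thesis by (simp add: mker_def)
qed

section \<open>From bounded functions to the infimum defining the gap\<close>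

context rwm_target
begin

text \<open>Truncation is 1-Lipschitz in the value, so it does not raise the energy, and
  \<open>Q\<close> is the same for all levels; dominated convergence carries the variance to the
  limit.\<close>

lemma Poincare_energy_unbounded:
  assumes bounded: "\<And>w K. w \<in> borel_measurable (lebd d) \<Longrightarrow> (\<And>x. x \<in> Rd d \<Longrightarrow> \<bar>w x\<bar> \<le> K) \<Longrightarrow> 0 \<le> K \<Longrightarrow>
      (\<integral>x. (w x - (\<integral>y. w y \<partial>target d p))\<^sup>2 \<partial>target d p) \<le> Q * energy w"
    and Q: "0 \<le> Q"
    and u[measurable]: "u \<in> borel_measurable (lebd d)" and u2: "integrable (target d p) (\<lambda>x. (u x)\<^sup>2)"
    and mean: "(\<integral>x. u x \<partial>target d p) = 0"
  shows "(\<integral>x. (u x)\<^sup>2 \<partial>target d p) \<le> Q * energy u"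
proof -
  interpret prob_space "target d p" by (rule prob)
  define w where "w n x = max (- real n) (min (real n) (u x))" for n x
  have w_meas[measurable]: "w n \<in> borel_measurable (lebd d)" for n
    unfolding w_def[abs_def] by measurable
  have w_bd: "\<bar>w n x\<bar> \<le> real n" for n x by (auto simp: w_def)
  have w_le: "\<bar>w n x\<bar> \<le> \<bar>u x\<bar>" for n x by (auto simp: w_def)
  have w_lim: "(\<lambda>n. w n x) \<longlonglongrightarrow> u x" for x
  proof (rule tendsto_eventually, rule eventually_sequentiallyI)
    fix n assume "nat \<lceil>\<bar>u x\<bar>\<rceil> \<le> n"
    then have "\<bar>u x\<bar> \<le> real n" by (simp add: nat_le_iff ceiling_le_iff)
    then show "w n x = u x" by (auto simp: w_def)
  qed
  have u1: "integrable (target d p) u"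
    by (rule square_integrable_imp_integrable[OF _ u2]) measurable
  have w1: "integrable (target d p) (w n)" for n
    by (rule integrable_target_bounded[OF w_meas w_bd])
  have w2: "integrable (target d p) (\<lambda>x. (w n x)\<^sup>2)" for n
  proof (rule integrable_target_bounded)
    show "\<bar>(w n x)\<^sup>2\<bar> \<le> (real n)\<^sup>2" for x using power_mono[OF w_bd[of n x], of 2] by simp
  qed measurable
  have lim1: "(\<lambda>n. \<integral>x. w n x \<partial>target d p) \<longlonglongrightarrow> (\<integral>x. u x \<partial>target d p)"
    by (rule integral_dominated_convergence[of _ _ _ "\<lambda>x. \<bar>u x\<bar>"])
       (use w_lim w_le u1 in \<open>auto intro!: AE_I2\<close>)
  have lim2: "(\<lambda>n. \<integral>x. (w n x)\<^sup>2 \<partial>target d p) \<longlonglongrightarrow> (\<integral>x. (u x)\<^sup>2 \<partial>target d p)"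
  proof (rule integral_dominated_convergence[of _ _ _ "\<lambda>x. (u x)\<^sup>2"])
    show "AE x in target d p. (\<lambda>n. (w n x)\<^sup>2) \<longlonglongrightarrow> (u x)\<^sup>2"
      by (intro AE_I2 tendsto_intros w_lim)
    show "AE x in target d p. norm ((w n x)\<^sup>2) \<le> (u x)\<^sup>2" for n
      using w_le by (intro AE_I2) (simp add: abs_le_square_iff)
  qed (use u2 in auto)
  have "(\<lambda>n. (\<integral>x. (w n x)\<^sup>2 \<partial>target d p) - (\<integral>x. w n x \<partial>target d p)\<^sup>2) \<longlonglongrightarrow>
      (\<integral>x. (u x)\<^sup>2 \<partial>target d p) - (\<integral>x. u x \<partial>target d p)\<^sup>2"
    by (intro tendsto_intros lim1 lim2)
  moreover have "(\<integral>x. (w n x)\<^sup>2 \<partial>target d p) - (\<integral>x. w n x \<partial>target d p)\<^sup>2 \<le> Q * energy u" for n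
  proof -
    have "(\<integral>x. (w n x - (\<integral>y. w n y \<partial>target d p))\<^sup>2 \<partial>target d p)
        = (\<integral>x. (w n x)\<^sup>2 \<partial>target d p) - (\<integral>x. w n x \<partial>target d p)\<^sup>2"
      by (rule variance_eq[OF w1 w2])
    moreover have "Q * energy (w n) \<le> Q * energy u"
      using Q by (intro mult_left_mono energy_mono[OF u u2 w_meas w2]) (auto simp: w_def)
    ultimately show ?thesis
      using bounded[OF w_meas w_bd, of n] by simp
  qed
  ultimately show ?thesis
    using mean by (intro LIMSEQ_le_const2) auto
qed

text \<open>A lower bound of a set of reals passes to \<open>Inf\<close> once the set is nonempty.
  The witness is a centred box indicator: its values on two disjoint boxes differ by 1, so it cannot
  vanish almost everywhere.\<close>

lemma spectral_gap_nonempty: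
  assumes d: "1 \<le> d"
  shows "\<exists>u :: (nat \<Rightarrow> real) \<Rightarrow> real. u \<in> borel_measurable (lebd d) \<and> integrable (target d p) (\<lambda>x. (u x)\<^sup>2) \<and>
        (\<integral>x. (u x)\<^sup>2 \<partial>target d p) \<noteq> 0 \<and> (\<integral>x. u x \<partial>target d p) = 0"
proof -
  interpret prob_space "target d p" by (rule prob)
  define B1 B2 :: "(nat \<Rightarrow> real) set" where "B1 = PiE {..<d} (\<lambda>_. {0<..<1})" and "B2 = PiE {..<d} (\<lambda>_. {-1<..<0})"
  have sets[measurable]: "B1 \<in> sets (lebd d)" "B2 \<in> sets (lebd d)"
    unfolding B1_def B2_def lebd_def by (auto intro!: sets_PiM_I_finite)
  have em: "emeasure (lebd d) B1 = 1" "emeasure (lebd d) B2 = 1"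
    unfolding B1_def B2_def lebd_def by (subst lborel_prod.emeasure_PiM; simp)+
  have disj: "B1 \<inter> B2 = {}"
  proof -
    have False if "y \<in> B1" "y \<in> B2" for y
      using that d by (force simp: B1_def B2_def PiE_iff dest!: bspec[of _ _ 0])
    then show ?thesis by blast
  qed
  define m where "m = (\<integral>x. indicator B1 x \<partial>target d p :: real)"
  define u where "u x = indicator B1 x - m" for x :: "nat \<Rightarrow> real"
  have [measurable]: "u \<in> borel_measurable (lebd d)" unfolding u_def[abs_def] by measurable
  have "\<bar>(u x)\<^sup>2\<bar> \<le> (1 + \<bar>m\<bar>)\<^sup>2" for x
    using power_mono[of "\<bar>u x\<bar>" "1 + \<bar>m\<bar>" 2] by (auto simp: u_def indicator_def)
  then have u2: "integrable (target d p) (\<lambda>x. (u x)\<^sup>2)" by (intro integrable_target_bounded) auto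
  have "integrable (target d p) (\<lambda>x. indicator B1 x :: real)"
    by (rule integrable_target_bounded[of _ 1]) auto
  then have mean: "(\<integral>x. u x \<partial>target d p) = 0"
    unfolding u_def using prob_space by (simp add: m_def[symmetric] del: Bochner_Integration.integral_indicator)
  have "(\<integral>x. (u x)\<^sup>2 \<partial>target d p) \<noteq> 0"
  proof
    assume "(\<integral>x. (u x)\<^sup>2 \<partial>target d p) = 0"
    then have "AE x in target d p. (u x)\<^sup>2 = 0"
      using integral_nonneg_eq_0_iff_AE[OF u2] by auto
    then have AE: "AE x in lebd d. u x = 0"
      unfolding target_def using p_pos by (subst (asm) AE_density) auto
    \<comment> \<open>A set of positive measure meets every set of full measure; applied to both
      boxes this forces 1 - m = 0 and m = 0.\<close>
    have "\<exists>x\<in>B. u x = 0" if B: "B \<in> sets (lebd d)" "emeasure (lebd d) B = 1" for B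
    proof (rule ccontr)
      assume "\<not> (\<exists>x\<in>B. u x = 0)"
      with AE have "AE x in lebd d. x \<notin> B" by (auto elim!: eventually_mono)
      then have "emeasure (lebd d) B = 0" using B by (simp add: AE_iff_measurable[OF _ refl] AE_iff_null_sets null_setsD1)
      with B show False by simp
    qed
    from this[OF sets(1) em(1)] this[OF sets(2) em(2)] disj show False
      by (auto simp: u_def indicator_def)
  qed
  with u2 mean \<open>u \<in> borel_measurable (lebd d)\<close> show ?thesis by blast
qed

lemma rwm_gap_ge:
  assumes d: "1 \<le> d" and Q: "0 < Q"
    and poincare: "\<And>u. u \<in> borel_measurable (lebd d) \<Longrightarrow> integrable (target d p) (\<lambda>x. (u x)\<^sup>2) \<Longrightarrow>
      (\<integral>x. u x \<partial>target d p) = 0 \<Longrightarrow> (\<integral>x. (u x)\<^sup>2 \<partial>target d p) \<le> Q * energy u"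
  shows "1 / (2 * Q) \<le> rwm_gap d p h"
  unfolding rwm_gap_def spectral_gap_def
proof (rule cInf_greatest)
  show "{1 - (\<integral>x. u x * metropolis_op d p (gauss_prop d h) u x \<partial>target d p) / (\<integral>x. (u x)\<^sup>2 \<partial>target d p) | u.
        u \<in> borel_measurable (lebd d) \<and> integrable (target d p) (\<lambda>x. (u x)\<^sup>2) \<and>
        (\<integral>x. (u x)\<^sup>2 \<partial>target d p) \<noteq> 0 \<and> (\<integral>x. u x \<partial>target d p) = 0} \<noteq> {}"
    using spectral_gap_nonempty[OF d] by blast
next
  fix g
  assume "g \<in> {1 - (\<integral>x. u x * metropolis_op d p (gauss_prop d h) u x \<partial>target d p) / (\<integral>x. (u x)\<^sup>2 \<partial>target d p) | u.
        u \<in> borel_measurable (lebd d) \<and> integrable (target d p) (\<lambda>x. (u x)\<^sup>2) \<and>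
        (\<integral>x. (u x)\<^sup>2 \<partial>target d p) \<noteq> 0 \<and> (\<integral>x. u x \<partial>target d p) = 0}"
  then obtain u where g: "g = 1 - (\<integral>x. u x * metropolis_op d p (gauss_prop d h) u x \<partial>target d p) / (\<integral>x. (u x)\<^sup>2 \<partial>target d p)"
    and u: "u \<in> borel_measurable (lebd d)" and u2: "integrable (target d p) (\<lambda>x. (u x)\<^sup>2)"
    and nz: "(\<integral>x. (u x)\<^sup>2 \<partial>target d p) \<noteq> 0" and mean: "(\<integral>x. u x \<partial>target d p) = 0"
    by blast
  define S where "S = (\<integral>x. (u x)\<^sup>2 \<partial>target d p)"
  have "0 \<le> S" by (simp add: S_def)
  with nz have S: "0 < S" by (simp add: S_def less_le)
  have P_eq: "(\<integral>x. u x * metropolis_op d p (gauss_prop d h) u x \<partial>target d p) = S - energy u / 2"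
    using Dirichlet_identity[OF u u2] by (simp add: S_def)
  then have "g = energy u / (2 * S)" 
    unfolding g S_def[symmetric] P_eq using S by (simp add: field_simps)
  moreover have "S \<le> Q * energy u" using poincare[OF u u2 mean] by (simp add: S_def)
  ultimately have "S * 1 \<le> S * (2 * Q * g)" using S by (simp add: mult_ac)
  then have "1 \<le> 2 * Q * g" using S by (simp only: mult_le_cancel_left_pos)
  then show "1 / (2 * Q) \<le> g" using Q by (simp add: field_simps)
qed

lemma rwm_gap_Lipschitz_PI:
  assumes d: "1 \<le> d"
    and decomp: "decomposition_assumption d p f g M L"
    and step_M: "2 * sqrt M * sqrt (real d) * h \<le> 1" and step_L: "16 * L * sqrt (real d) * h \<le> 1"
    and C: "0 < C" and PI: "Lipschitz_PI d p C"
  shows "h\<^sup>2 / (1119744 * (C + h\<^sup>2)) \<le> rwm_gap d p h"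
proof -
  obtain F where F: "\<And>x. x \<in> Rd d \<Longrightarrow> has_grad_at d f (F x) x"
    and F_lip: "\<And>x y. x \<in> Rd d \<Longrightarrow> y \<in> Rd d \<Longrightarrow> ddist d (F x) (F y) \<le> M * ddist d x y"
    using decomp unfolding decomposition_assumption_def by blast
  have lnp: "\<And>x. x \<in> Rd d \<Longrightarrow> ln (p x) = f x + g x"
    and g_lip: "\<And>x y. x \<in> Rd d \<Longrightarrow> y \<in> Rd d \<Longrightarrow> \<bar>g x - g y\<bar> \<le> L * ddist d x y"
    using decomp unfolding decomposition_assumption_def by auto
  define \<sigma> where "\<sigma> = h * sqrt (real d / (real d + 1))"
  have \<sigma>: "0 < \<sigma>" using h_pos d by (simp add: \<sigma>_def)
  have \<sigma>2: "\<sigma>\<^sup>2 = h\<^sup>2 * (real d / (real d + 1))" by (simp add: \<sigma>_def power_mult_distrib)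
  have \<sigma>2_le: "\<sigma>\<^sup>2 \<le> real d * h\<^sup>2" and \<sigma>2_ge: "h\<^sup>2 / 2 \<le> \<sigma>\<^sup>2"
    unfolding \<sigma>2 using d h_pos by (auto simp: field_simps)
  \<comment> \<open>Since d \<ge> 1, two points at positive distance exist and fix the sign.
    Squaring the step-size condition relies on it: \<open>sqrt\<close> is negative at negative
    arguments.\<close>
  have M: "0 \<le> M"
  proof -
    define z where "z c = (\<lambda>i\<in>{..<d}. c)" for c :: real
    have z: "z c \<in> Rd d" for c by (simp add: z_def Rd_def)
    have "ddist d (z 1) (z 0) = sqrt (real d)" by (simp add: ddist_def z_def)
    then have "0 \<le> M * sqrt (real d)" using order_trans[OF ddist_nonneg F_lip[OF z z], of 1 0] by simp
    then show ?thesis using d by (simp add: zero_le_mult_iff)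
  qed
  have step_M': "M * (real d * h\<^sup>2) \<le> 1 / 4"
  proof -
    have "(2 * sqrt M * sqrt (real d) * h)\<^sup>2 \<le> 1\<^sup>2"
      using step_M M h_pos by (intro power_mono) auto
    then show ?thesis using M by (simp add: power_mult_distrib mult_ac)
  qed
  have M\<sigma>: "M * \<sigma>\<^sup>2 \<le> 1 / 4"
    using mult_left_mono[OF \<sigma>2_le M] step_M' by linarith
  have log_p: "ln (p x) + dotd d (F x) (\<lambda>i. y i - x i) - M * (ddist d y x)\<^sup>2 - L * ddist d y x \<le> ln (p y)"
    if x: "x \<in> Rd d" and y: "y \<in> Rd d" for x y
  proof -
    have "f x + dotd d (F x) (\<lambda>i. y i - x i) - M * (ddist d y x)\<^sup>2 \<le> f y"
      by (rule gradient_lower_bound[OF x y F F_lip[OF _ x] M])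
    then show ?thesis using g_lip[OF y x] by (simp add: lnp[OF x] lnp[OF y])
  qed
  \<comment> \<open>559872 = 2 * 54 * 36 * 12^2, with the kernel mass 1/12 and a factor 2 from
    \<sigma>^2 \<ge> h^2 / 2. The summand without \<open>C\<close> is only 54 * 12.\<close>
  define Q where "Q = 559872 * (C + h\<^sup>2) / h\<^sup>2"
  have Q: "0 < Q" using C h_pos by (simp add: Q_def add_pos_pos)
  have bounded: "(\<integral>x. (w x - (\<integral>y. w y \<partial>target d p))\<^sup>2 \<partial>target d p) \<le> Q * energy w"
    if w: "w \<in> borel_measurable (lebd d)" and K: "\<And>x. x \<in> Rd d \<Longrightarrow> \<bar>w x\<bar> \<le> K" "0 \<le> K" for w K
  proof -
    have "smoothing_kernel d (halfspace_kernel d \<sigma> F) (1 / 12) \<sigma> w K"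
    proof
      fix x x' assume x: "x \<in> Rd d" and x': "x' \<in> Rd d"
      show "(\<integral>y. (halfspace_kernel d \<sigma> F x' y - halfspace_kernel d \<sigma> F x y)\<^sup>2 \<partial>lebd d)
          \<le> (3 * ddist d x' x / \<sigma>)\<^sup>2"
        by (rule halfspace_kernel_diff[OF \<sigma> x x' F_lip[OF x' x] M\<sigma>])
    qed (fact w K(2) \<sigma> | rule halfspace_kernel_meas halfspace_kernel_int[OF \<sigma>] halfspace_kernel_mass[OF \<sigma> _ d] K(1)
      | assumption | simp)+
    then interpret smoothed_rwm d p h "halfspace_kernel d \<sigma> F" "1 / 12" \<sigma> w K
      by (rule smoothed_rwm.intro[OF rwm_target_axioms])
    have energy0: "0 \<le> energy w"
      unfolding energy_def using mker_nonneg
      by (intro integral_nonneg_AE AE_I2) (auto simp: space_pair_measure)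
    have "(\<integral>x. (w x - (\<integral>y. w y \<partial>target d p))\<^sup>2 \<partial>target d p)
        \<le> (54 / (1 / 12) + 54 * 36 * C / ((1 / 12)\<^sup>2 * \<sigma>\<^sup>2)) * energy w"
    proof (rule variance_u[OF _ PI less_imp_le[OF C]])
      fix x y assume "x \<in> Rd d" "y \<in> Rd d"
      then show "p x * (halfspace_kernel d \<sigma> F x y)\<^sup>2 \<le> 27 * mker d p h x y"
        unfolding \<sigma>_def
        by (intro halfspace_kernel_dominated[OF h_pos d step_M' step_L] p_pos log_p)
    qed
    also have "\<dots> \<le> Q * energy w"
    proof (rule mult_right_mono[OF _ energy0])
      have "54 * 36 * C / ((1 / 12)\<^sup>2 * \<sigma>\<^sup>2) = 279936 * C / \<sigma>\<^sup>2" by (simp add: power2_eq_square)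
      also have "\<dots> \<le> 279936 * C / (h\<^sup>2 / 2)"
        using C h_pos \<sigma>2_ge \<sigma> by (intro divide_left_mono mult_pos_pos) auto
      finally show "54 / (1 / 12) + 54 * 36 * C / ((1 / 12)\<^sup>2 * \<sigma>\<^sup>2) \<le> Q"
        using h_pos by (simp add: Q_def add_divide_distrib)
    qed
    finally show ?thesis .
  qed
  have "1 / (2 * Q) \<le> rwm_gap d p h"
  proof (rule rwm_gap_ge[OF d Q])
    fix u :: "(nat \<Rightarrow> real) \<Rightarrow> real"
    assume "u \<in> borel_measurable (lebd d)" "integrable (target d p) (\<lambda>x. (u x)\<^sup>2)"
      "(\<integral>x. u x \<partial>target d p) = 0"
    with bounded less_imp_le[OF Q] show "(\<integral>x. (u x)\<^sup>2 \<partial>target d p) \<le> Q * energy u"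
      by (rule Poincare_energy_unbounded)
  qed
  then show ?thesis by (simp add: Q_def)
qed

end

lemma decomposition_rwm_target:
  assumes "decomposition_assumption d p f g M L" "0 < h"
  shows "rwm_target d p h"
  using assms unfolding decomposition_assumption_def rwm_target_def by blast

text \<open>Applied with t = h^2. After clearing denominators the claim is t (C + t) \<le> 2 (C^2 +
  t^2), and this 2 turns 1119744 into 2239488.\<close>

lemma gap_rate_compare:
  fixes t C :: real
  assumes "0 < t" "0 < C"
  shows "(1 / 2239488) * t\<^sup>2 / (C\<^sup>2 + t\<^sup>2) \<le> t / (1119744 * (C + t))"
proof -
  have "t * C \<le> t * t + C * C"
    using sum_squares_bound[of t C] mult_pos_pos[OF assms] unfolding power2_eq_square by linarith
  then have "t * (C + t) \<le> 2 * (C\<^sup>2 + t\<^sup>2)"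
    using zero_le_square[of C] unfolding power2_eq_square distrib_left by linarith
  then have "t * (t * (C + t)) \<le> t * (2 * (C\<^sup>2 + t\<^sup>2))"
    using assms by (intro mult_left_mono) auto
  moreover have "0 < C\<^sup>2 + t\<^sup>2" using assms by (simp add: add_pos_pos)
  ultimately show ?thesis using assms by (simp add: field_simps power2_eq_square)
qed

theorem mainTheorem5:
  shows "\<exists>C'>0. \<forall>(d::nat) (p::(nat \<Rightarrow> real) \<Rightarrow> real) f g (M::real) (L::real) (h::real).
    d \<ge> 1 \<and> decomposition_assumption d p f g M L \<and>
    0 < h \<and> 2 * sqrt M * sqrt (real d) * h \<le> 1 \<and> 16 * L * sqrt (real d) * h \<le> 1
    \<longrightarrow>
      (\<forall>C_LSI>0. LSI d p C_LSI \<longrightarrow> rwm_gap d p h \<ge> C' * h ^ 4 / (C_LSI\<^sup>2 + h ^ 4)) \<and>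
      (\<forall>C_PI>0. PI d p C_PI \<longrightarrow> rwm_gap d p h \<ge> C' * h ^ 4 / (C_PI\<^sup>2 + h ^ 4))"
proof (intro exI[of _ "1 / 2239488"] conjI allI impI)
  fix d :: nat and p :: "(nat \<Rightarrow> real) \<Rightarrow> real" and f g and M L h :: real
  assume asm: "d \<ge> 1 \<and> decomposition_assumption d p f g M L \<and>
    0 < h \<and> 2 * sqrt M * sqrt (real d) * h \<le> 1 \<and> 16 * L * sqrt (real d) * h \<le> 1"
  then interpret rwm_target d p h using decomposition_rwm_target by blast
  have gap: "(1 / 2239488) * h ^ 4 / (C\<^sup>2 + h ^ 4) \<le> rwm_gap d p h" if "0 < C" "Lipschitz_PI d p C" for C
  proof -
    have "(1 / 2239488) * (h\<^sup>2)\<^sup>2 / (C\<^sup>2 + (h\<^sup>2)\<^sup>2) \<le> h\<^sup>2 / (1119744 * (C + h\<^sup>2))"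
      using that(1) asm by (intro gap_rate_compare) auto
    also have "\<dots> \<le> rwm_gap d p h"
      by (rule rwm_gap_Lipschitz_PI) (use asm that in auto)
    finally show ?thesis by simp
  qed
  show "(1 / 2239488) * h ^ 4 / (C\<^sup>2 + h ^ 4) \<le> rwm_gap d p h" if "0 < C" "LSI d p C" for C
    using gap that LSI_imp_Lipschitz_PI by blast
  show "(1 / 2239488) * h ^ 4 / (C\<^sup>2 + h ^ 4) \<le> rwm_gap d p h" if "0 < C" "PI d p C" for C
    using gap that PI_imp_Lipschitz_PI by blast
qed simp

end
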